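(* There exist an absolute constant $A>0$ and an absolute threshold $p_0$ such that for every prime $p\ge p_0$ and every real number $V$ with $1\le V\le \frac{2}{\pi}\bigl(\log\log p-2\log\log\log p\bigr)$ one has \[ \frac{1}{p}\left|\left\{K\in\mathbb{F}_p:\ \frac{1}{\sqrt p}\left|f_p\!\left(e_p\!\left(K+\tfrac12\right)\right)\right|\ge V\right\}\right| =\exp\!\left(-C_2^-\,e^{\pi V/2}\,(1+\eta)\right) \] for some real $\eta=\eta(p,V)$ with $|\eta|\le A\,e^{-\pi V/4}$, where \[ C_2^-=\frac{2}{\pi}\exp\!\left(-\gamma-1+\log\frac{\pi}{2}-\int_0^1\frac{\log\cosh u}{u^2}\,du-\int_1^\infty\frac{\log(1+e^{-2u})}{u^2}\,du\right), \] and $\gamma$ is the Euler–Mascheroni constant.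
   Context: For an odd prime $p$, $\left(\frac{\cdot}{p}\right)$ is the Legendre symbol and the Fekete polynomial is $f_p(z)=\sum_{n=0}^{p-1}\left(\frac{n}{p}\right)z^n$. We write $e_p(x)=e^{2\pi i x/p}$ and $\mathbb{F}_p$ for the integers modulo $p$ (represented by $0,\dots,p-1$). *)

theory Defs
  imports "HOL-Analysis.Analysis" "HOL-Number_Theory.Number_Theory"
begin

definition fekete :: "nat \<Rightarrow> complex \<Rightarrow> complex" where
  "fekete p z = (\<Sum>n = 0..p - 1. of_int (Legendre (int n) (int p)) * z ^ n)"

definition e_mod :: "nat \<Rightarrow> real \<Rightarrow> complex" where
  "e_mod p x = exp (2 * of_real pi * \<i> * of_real x / of_nat p)"

definition C2_minus :: real where
  "C2_minus = 2 / pi * exp (- euler_mascheroni - 1 + ln (pi / 2)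
      - (LBINT u=0..1. ln (cosh u) / u\<^sup>2)
      - (LBINT u=1..\<infinity>. ln (1 + exp (- 2 * u)) / u\<^sup>2))"

end

theory Submission
  imports Defs "HOL-Real_Asymp.Real_Asymp"
begin

text \<open>
  Writing the Legendre symbol as a Gauss sum turns the normalised value of the Fekete polynomial at
  the half point K + 1/2 into the absolute value of the sum over b < p of a(b) (b - K | p) with
  a(b) = cot (pi (b + 1/2) / p) / p. By Weil's bound for character sums (proved here by Stepanov's
  method), the moments of this sum as K varies agree, up to order about ln p / ln ln p, with those of
  the random sum Y of a(b) e(b), where the e(b) are independent signs. The cumulant generating
  function of Y is a sum of ln cosh (a(b) s), which is
  2/pi s (ln s + ln (2/pi) + gamma + I1 + I2) + O(1), where I1 and I2 are the two integrals in C2_minus.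
  Its Legendre transform at V is - C2_minus exp (pi V / 2), up to O(1). Chernoff's bound, applied
  through an even moment, gives the upper estimate. For the lower estimate the measure tilted by
  exp (s x) has standard deviation of order exp (- pi V / 4); it is simulated by a polynomial weight,
  and this width is the source of the relative error exp (- pi V / 4).
\<close>

text \<open>The comparison with random signs costs a factor (4 ln p)^m against a saving sqrt p, so
  only power moments of order up to c ln p / ln ln p with c < 1/2 are at hand, and no exponential
  moments. Hence each exponential tilt is replaced by a polynomial whose degree is tied to the
  saddle point by s V = 2k or s W = 2k + 1. The numerical constants serve this budget: the term 2 ln
  ln ln p in the range of V brings s V down to order ln p / ln ln p, and explicit bounds keep the
  factor in front below 2/5.

  The cumulant is known only up to O(1), and its slope is merely bracketed by chords, so the saddle
  point is not located precisely. For the upper tail this is harmless: every admissible s gives a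
  valid bound, so the minimiser of the main term can be used. For the lower tail the tilted mean
  must be exactly W, but the main term minus s W is at least its global minimum, whatever s is.

  For the character sums a bound linear in the degree is enough, so the sharp constant is not
  pursued and integer polynomials modulo p suffice.\<close>

hide_const (open) up_ring.coeff up_ring.monom module.smult

section \<open>Legendre symbols\<close>

lemma Legendre_cong:
  assumes "[a = b] (mod p)"
  shows "Legendre a p = Legendre b p"
proof -
  have "[a = 0] (mod p) \<longleftrightarrow> [b = 0] (mod p)" "QuadRes p a \<longleftrightarrow> QuadRes p b"
    using assms unfolding QuadRes_def by (meson cong_sym cong_trans)+
  then show ?thesis by (simp add: Legendre_def)
qed

lemma Legendre_cases: "Legendre a p = 0 \<or> Legendre a p = 1 \<or> Legendre a p = - 1"
  by (simp add: Legendre_def)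

lemma Legendre_eq_0_iff: "Legendre a p = 0 \<longleftrightarrow> p dvd a"
  by (simp add: Legendre_def cong_0_iff)

text \<open>Euler's criterion gives the identity modulo \<open>p\<close>. The two sides differ by at
  most 2 in absolute value, so for \<open>p > 2\<close> the congruence is an equality.\<close>

lemma Legendre_mult:
  fixes p :: nat
  assumes p: "prime p" "2 < p"
  shows "Legendre (a * b) p = Legendre a p * Legendre b p"
proof -
  let ?h = "(p - 1) div 2"
  have "[Legendre (a * b) p = (a * b) ^ ?h] (mod p)" by (rule euler_criterion[OF p])
  moreover have "[Legendre a p * Legendre b p = a ^ ?h * b ^ ?h] (mod p)"
    by (intro cong_mult euler_criterion[OF p])
  ultimately have "[Legendre (a * b) p = Legendre a p * Legendre b p] (mod p)"
    by (metis cong_sym cong_trans power_mult_distrib)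
  then have d: "int p dvd Legendre (a * b) p - Legendre a p * Legendre b p"
    by (simp add: cong_iff_dvd_diff)
  have "\<bar>Legendre (a * b) p - Legendre a p * Legendre b p\<bar> < int p"
    using p(2) Legendre_cases[of "a * b" p] Legendre_cases[of a p] Legendre_cases[of b p] by auto
  then show ?thesis
    using d zdvd_not_zless[of "\<bar>Legendre (a * b) p - Legendre a p * Legendre b p\<bar>" "int p"] by auto
qed

lemma Legendre_1: "2 < p \<Longrightarrow> Legendre 1 p = 1"
  by (auto simp: Legendre_def QuadRes_def cong_0_iff intro!: exI[of _ 1] dest: zdvd_imp_le)

lemma Legendre_prod:
  fixes p :: nat
  assumes p: "prime p" "2 < p"
  shows "Legendre (\<Prod>x\<in>A. g x) p = (\<Prod>x\<in>A. Legendre (g x) p)"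
  using p Legendre_1[of "int p"] by (induction A rule: infinite_finite_induct) (simp_all add: Legendre_mult)

lemma sum_residues_shift:
  fixes F :: "int \<Rightarrow> 'a::comm_monoid_add" and p :: nat
  assumes p: "0 < p" and F: "\<And>x. F (x mod int p) = F x"
  shows "(\<Sum>x\<in>{0..<int p}. F (x + t)) = (\<Sum>x\<in>{0..<int p}. F x)"
proof (rule sum.reindex_bij_witness[of _ "\<lambda>x. (x - t) mod int p" "\<lambda>x. (x + t) mod int p"])
  fix x assume x: "x \<in> {0..<int p}"
  show "((x + t) mod int p - t) mod int p = x" using x by (simp add: mod_diff_left_eq)
  show "((x - t) mod int p + t) mod int p = x" using x by (simp add: mod_add_left_eq)
  show "F ((x + t) mod int p) = F (x + t)" by (rule F)
qed (use p in auto)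

lemma sum_residues_scale:
  fixes F :: "int \<Rightarrow> 'a::comm_monoid_add" and p :: nat
  assumes p: "prime p" and F: "\<And>x. F (x mod int p) = F x" and n: "\<not> int p dvd n"
  shows "(\<Sum>x\<in>{0..<int p}. F (x * n)) = (\<Sum>x\<in>{0..<int p}. F x)"
proof -
  have "coprime n (int p)" using prime_imp_coprime[of "int p" n] p n by (simp add: coprime_commute)
  then obtain k where k: "[n * k = 1] (mod int p)" using cong_solve_coprime_int by blast
  have nk: "(x * n * k) mod int p = x" "(x * k * n) mod int p = x" if "x \<in> {0..<int p}" for x
  proof -
    have "[x * (n * k) = x * 1] (mod int p)" using k by (rule cong_scalar_left)
    then show "(x * n * k) mod int p = x" "(x * k * n) mod int p = x"
      using that by (simp_all add: cong_def mult_ac)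
  qed
  show ?thesis
  proof (rule sum.reindex_bij_witness[of _ "\<lambda>x. (x * k) mod int p" "\<lambda>x. (x * n) mod int p"])
    fix x assume x: "x \<in> {0..<int p}"
    show "((x * n) mod int p * k) mod int p = x" using nk(1)[OF x] by (simp add: mod_mult_left_eq)
    show "((x * k) mod int p * n) mod int p = x" using nk(2)[OF x] by (simp add: mod_mult_left_eq)
    show "F ((x * n) mod int p) = F (x * n)" by (rule F)
  qed (use p prime_gt_0_nat in auto)
qed

lemma sum_int_residues: "(\<Sum>x\<in>{0..<int p}. F x) = (\<Sum>n<p. F (int n))"
  by (rule sum.reindex_bij_witness[of _ int nat]) auto

text \<open>If squaring mapped the nonzero residues onto themselves it would be injective, yet 1 and
  -1 have the same square. So there is a nonresidue \<open>g\<close>, and the substitution x -> x g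
  changes the sign of the sum.\<close>

lemma Legendre_sum_eq_0:
  fixes p :: nat
  assumes p: "prime p" "2 < p"
  shows "(\<Sum>x\<in>{0..<int p}. Legendre x p) = 0"
proof -
  let ?S = "{1..<int p}" and ?sq = "\<lambda>x. x\<^sup>2 mod int p"
  have pint: "prime (int p)" using p by simp
  have sub: "?sq ` ?S \<subseteq> ?S"
  proof (rule image_subsetI)
    fix x assume x: "x \<in> ?S"
    then have "\<not> int p dvd x" using zdvd_not_zless by force
    then have "\<not> int p dvd x\<^sup>2" using pint prime_dvd_power_int by blast
    moreover have "0 \<le> ?sq x" "?sq x < int p" using p by simp_all
    ultimately show "?sq x \<in> ?S" by (simp add: dvd_eq_mod_eq_0)
  qed
  have "?sq ` ?S \<noteq> ?S"
  proof
    assume "?sq ` ?S = ?S"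
    then have "inj_on ?sq ?S" by (intro eq_card_imp_inj_on) auto
    moreover have "?sq (int p - 1) = ?sq 1"
    proof -
      have "(int p - 1)\<^sup>2 = 1 + int p * (int p - 2)" by (simp add: power2_eq_square algebra_simps)
      then show ?thesis by simp
    qed
    ultimately show False using p(2) by (auto dest!: inj_onD[of _ _ "int p - 1" 1])
  qed
  then obtain g where g: "g \<in> ?S" "g \<notin> ?sq ` ?S" using sub by blast
  have ndvd: "\<not> int p dvd g" using g(1) zdvd_not_zless by force
  have "\<not> QuadRes p g"
  proof
    assume "QuadRes p g"
    then obtain y where y: "[y\<^sup>2 = g] (mod int p)" by (auto simp: QuadRes_def)
    then have "?sq (y mod int p) = g" using g(1) by (simp add: cong_def power_mod)
    moreover have "\<not> int p dvd y" using y ndvd by (metis cong_dvd_iff dvd_power zero_less_numeral dvd_trans)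
    then have "y mod int p \<noteq> 0" by (simp add: dvd_eq_mod_eq_0)
    moreover have "0 \<le> y mod int p" "y mod int p < int p" using p by simp_all
    ultimately have "g \<in> ?sq ` ?S" by (intro image_eqI[of _ _ "y mod int p"]) auto
    with g(2) show False ..
  qed
  then have Lg: "Legendre g p = - 1" using ndvd by (simp add: Legendre_def cong_0_iff)
  have per: "Legendre (x mod int p) p = Legendre x p" for x by (rule Legendre_cong) simp
  have "(\<Sum>x\<in>{0..<int p}. Legendre x p) = (\<Sum>x\<in>{0..<int p}. Legendre (x * g) p)"
    using sum_residues_scale[of p "\<lambda>x. Legendre x p" g, OF p(1) per ndvd] by simp
  also have "\<dots> = - (\<Sum>x\<in>{0..<int p}. Legendre x p)"
    by (simp add: Legendre_mult[OF p] Lg sum_negf)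
  finally show ?thesis by simp
qed

section \<open>Weil's bound by Stepanov's method\<close>

text \<open>Polynomials over the field with p elements are represented by integer polynomials modulo the
  constant p, since p is a variable here. Orders of vanishing are read off Taylor coefficients.\<close>

definition vanishes_mod :: "int \<Rightarrow> nat \<Rightarrow> int poly \<Rightarrow> int \<Rightarrow> bool" where
  "vanishes_mod p k P a \<longleftrightarrow> (\<forall>n<k. p dvd coeff (pcompose P [:a, 1:]) n)"

lemma const_dvd_poly_eval:
  fixes p :: int
  assumes "[:p:] dvd P"
  shows "p dvd poly P a"
proof -
  from assms obtain Q where "P = [:p:] * Q" by (elim dvdE)
  then show ?thesis by simp
qed

lemma const_dvd_pderiv:
  fixes p :: int
  assumes "[:p:] dvd P"
  shows "[:p:] dvd pderiv P"
proof -
  from assms obtain Q where "P = [:p:] * Q" by (elim dvdE)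
  then have "pderiv P = [:p:] * pderiv Q" by (simp add: pderiv_smult)
  then show ?thesis by (metis dvd_triv_left)
qed

lemma prime_const_poly:
  fixes p :: int
  assumes "prime p"
  shows "prime_elem [:p:]"
  using assms by (intro lift_prime_elem_poly prime_imp_prime_elem)

lemma not_const_dvd_linear:
  fixes p :: int
  assumes "prime p"
  shows "\<not> [:p:] dvd [:a, 1:]"
proof
  assume "[:p:] dvd [:a, 1:]"
  then have "p dvd coeff [:a, 1:] 1" unfolding const_poly_dvd_iff by blast
  with assms show False by (auto simp: not_prime_unit)
qed

text \<open>The n-th derivative at \<open>a\<close> is n! times the n-th Taylor coefficient, and n!
  is a unit modulo \<open>p\<close> for n < \<open>p\<close>; this is why \<open>k \<le> p\<close>
  is assumed. The induction applies the claim to \<open>pderiv P\<close> and divides by one factor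
  \<open>Suc m\<close> at a time, so factorials never appear.\<close>

lemma vanishes_mod_by_derivatives:
  fixes p :: nat
  assumes p: "prime p" and k: "k \<le> p"
    and d: "\<And>i. i < k \<Longrightarrow> int p dvd poly ((pderiv ^^ i) P) a"
  shows "vanishes_mod (int p) k P a"
  using k d
proof (induction k arbitrary: P)
  case 0
  then show ?case by (simp add: vanishes_mod_def)
next
  case (Suc k)
  have "int p dvd coeff (pcompose P [:a, 1:]) n" if n: "n < Suc k" for n
  proof (cases n)
    case 0
    have "coeff (pcompose P [:a, 1:]) 0 = poly P a"
      by (simp add: pcompose_coeff_0)
    with Suc.prems(2)[of 0] 0 show ?thesis by simp
  next
    case (Suc m)
    have "vanishes_mod (int p) k (pderiv P) a"
    proof (rule Suc.IH)
      show "k \<le> p" using Suc.prems by simp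
      show "int p dvd poly ((pderiv ^^ i) (pderiv P)) a" if "i < k" for i
        using Suc.prems(2)[of "Suc i"] that by (simp add: funpow_swap1)
    qed
    then have "int p dvd coeff (pcompose (pderiv P) [:a, 1:]) m"
      using n Suc by (simp add: vanishes_mod_def)
    also have "pcompose (pderiv P) [:a, 1:] = pderiv (pcompose P [:a, 1:])"
      by (simp add: pderiv_pcompose pderiv_pCons)
    also have "coeff \<dots> m = int (Suc m) * coeff (pcompose P [:a, 1:]) (Suc m)"
      by (simp add: coeff_pderiv)
    finally have "int p dvd int (Suc m) \<or> int p dvd coeff (pcompose P [:a, 1:]) (Suc m)"
      using p by (simp add: prime_dvd_mult_iff del: of_nat_Suc)
    moreover have "\<not> int p dvd int (Suc m)"
      using n Suc Suc.prems(1) by (auto dest!: dvd_imp_le simp del: of_nat_Suc)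
    ultimately show ?thesis using Suc by blast
  qed
  then show ?case by (simp add: vanishes_mod_def)
qed

lemma coeff_linear_mult:
  fixes Q :: "int poly"
  shows "coeff ([:c, 1:] * Q) n = c * coeff Q n + (if n = 0 then 0 else coeff Q (n - 1))"
  by (cases n) (simp_all add: coeff_pCons)

lemma vanishes_mod_linear_same:
  assumes "vanishes_mod p (Suc k) ([:-a, 1:] * Q) a"
  shows "vanishes_mod p k Q a"
proof -
  have eq: "pcompose ([:-a, 1:] * Q) [:a, 1:] = [:0, 1:] * pcompose Q [:a, 1:]"
    by (simp add: pcompose_mult pcompose_pCons del: mult_pCons_left)
  show ?thesis
    unfolding vanishes_mod_def
  proof (intro allI impI)
    fix n assume "n < k"
    then have "p dvd coeff (pcompose ([:-a, 1:] * Q) [:a, 1:]) (Suc n)"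
      using assms by (auto simp: vanishes_mod_def)
    then show "p dvd coeff (pcompose Q [:a, 1:]) n"
      unfolding eq by (simp add: coeff_linear_mult)
  qed
qed

text \<open>Around \<open>b\<close> the factor becomes (b - a) + X with an invertible constant term,
  so the Taylor coefficients of \<open>Q\<close> can be solved for modulo \<open>p\<close> from the
  lowest one upwards.\<close>

lemma vanishes_mod_linear_other:
  fixes p :: int
  assumes p: "prime p" and v: "vanishes_mod p k ([:-a, 1:] * Q) b" and ab: "\<not> p dvd b - a"
  shows "vanishes_mod p k Q b"
proof -
  have eq: "pcompose ([:-a, 1:] * Q) [:b, 1:] = [:b - a, 1:] * pcompose Q [:b, 1:]"
    by (simp add: pcompose_mult pcompose_pCons del: mult_pCons_left)
  have "n < k \<longrightarrow> p dvd coeff (pcompose Q [:b, 1:]) n" for n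
  proof (induction n)
    case 0
    show ?case
    proof
      assume "0 < k"
      then have "p dvd (b - a) * coeff (pcompose Q [:b, 1:]) 0"
        using v unfolding vanishes_mod_def eq coeff_linear_mult by force
      with p ab show "p dvd coeff (pcompose Q [:b, 1:]) 0"
        by (simp add: prime_dvd_mult_iff)
    qed
  next
    case (Suc n)
    show ?case
    proof
      assume n: "Suc n < k"
      then have "p dvd (b - a) * coeff (pcompose Q [:b, 1:]) (Suc n) + coeff (pcompose Q [:b, 1:]) n"
        using v unfolding vanishes_mod_def eq coeff_linear_mult by force
      with Suc n have "p dvd (b - a) * coeff (pcompose Q [:b, 1:]) (Suc n)"
        by (simp add: dvd_add_left_iff)
      with p ab show "p dvd coeff (pcompose Q [:b, 1:]) (Suc n)"
        by (simp add: prime_dvd_mult_iff)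
    qed
  qed
  then show ?thesis by (simp add: vanishes_mod_def)
qed

lemma vanishes_mod_cong:
  assumes "[:p:] dvd P - Q" and v: "vanishes_mod p k P a"
  shows "vanishes_mod p k Q a"
proof -
  from assms obtain R where "P - Q = [:p:] * R" by (elim dvdE)
  then have "Q = P - smult p R" by (simp add: algebra_simps)
  then have "pcompose Q [:a, 1:] = pcompose P [:a, 1:] - smult p (pcompose R [:a, 1:])"
    by (simp add: pcompose_diff pcompose_smult)
  then show ?thesis using v by (auto simp: vanishes_mod_def)
qed

text \<open>One root is divided out at a time, by induction on the total multiplicity. Synthetic
  division leaves the constant \<open>poly P a\<close>, a multiple of \<open>p\<close>, so replacing
  \<open>P\<close> by the product changes nothing modulo \<open>p\<close>, while the integer degree
  drops by one.\<close>

lemma sum_multiplicities_le_degree: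
  fixes p :: int
  assumes p: "prime p" and fin: "finite N"
    and inc: "\<And>a b. a \<in> N \<Longrightarrow> b \<in> N \<Longrightarrow> a \<noteq> b \<Longrightarrow> \<not> p dvd b - a"
    and "\<not> [:p:] dvd P" and "\<And>a. a \<in> N \<Longrightarrow> vanishes_mod p (\<mu> a) P a"
  shows "(\<Sum>a\<in>N. \<mu> a) \<le> degree P"
  using assms(4,5)
proof (induction "\<Sum>a\<in>N. \<mu> a" arbitrary: P \<mu>)
  case 0
  then show ?case by simp
next
  case (Suc t)
  then obtain a where a: "a \<in> N" "\<mu> a > 0"
    by (metis Zero_not_Suc gr0I sum.neutral)
  define Q where "Q = synthetic_div P a"
  have PQ: "P = [:-a, 1:] * Q + [:poly P a:]"
    by (simp add: Q_def synthetic_div_correct' del: mult_pCons_left)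
  have "p dvd coeff (pcompose P [:a, 1:]) 0"
    using Suc.prems(2)[OF a(1)] a(2) by (auto simp: vanishes_mod_def)
  then have pa: "p dvd poly P a" by (simp add: pcompose_coeff_0)
  have "P - [:-a, 1:] * Q = [:poly P a:]" by (subst PQ) (simp del: mult_pCons_left)
  then have diff: "[:p:] dvd P - [:-a, 1:] * Q" using pa by simp
  have nQ: "\<not> [:p:] dvd Q"
  proof
    assume "[:p:] dvd Q"
    then have "[:p:] dvd (P - [:-a, 1:] * Q) + [:-a, 1:] * Q"
      using diff by (intro dvd_add dvd_mult)
    with Suc.prems(1) show False by simp
  qed
  then have Q0: "Q \<noteq> 0" by auto
  then have deg: "degree P = Suc (degree Q)"
    using degree_synthetic_div[of P a] synthetic_div_eq_0_iff[of P a] by (simp add: Q_def)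
  define \<nu> where "\<nu> = \<mu>(a := \<mu> a - 1)"
  have van: "vanishes_mod p (\<mu> b) ([:-a, 1:] * Q) b" if "b \<in> N" for b
    using vanishes_mod_cong[OF diff Suc.prems(2)[OF that]] .
  have vQ: "vanishes_mod p (\<nu> b) Q b" if b: "b \<in> N" for b
  proof (cases "b = a")
    case True
    have "vanishes_mod p (Suc (\<mu> a - 1)) ([:-a, 1:] * Q) a"
      using van[OF a(1)] a(2) by (simp del: mult_pCons_left)
    then have "vanishes_mod p (\<mu> a - 1) Q a" by (rule vanishes_mod_linear_same)
    then show ?thesis using True by (simp add: \<nu>_def)
  next
    case False
    then have "vanishes_mod p (\<mu> b) Q b"
      using vanishes_mod_linear_other[OF p van[OF b]] inc[OF a(1) b] by blast
    then show ?thesis using False by (simp add: \<nu>_def)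
  qed
  have s1: "(\<Sum>b\<in>N. \<mu> b) = \<mu> a + (\<Sum>b\<in>N - {a}. \<mu> b)"
    using fin a by (simp add: sum.remove)
  have s2: "(\<Sum>b\<in>N. \<nu> b) = \<nu> a + (\<Sum>b\<in>N - {a}. \<nu> b)"
    using fin a by (simp add: sum.remove)
  have s3: "(\<Sum>b\<in>N - {a}. \<nu> b) = (\<Sum>b\<in>N - {a}. \<mu> b)"
    by (intro sum.cong) (auto simp: \<nu>_def)
  have tot: "(\<Sum>b\<in>N. \<mu> b) = Suc (\<Sum>b\<in>N. \<nu> b)"
    using s1 s2 s3 a(2) by (simp add: \<nu>_def)
  then have "t = (\<Sum>b\<in>N. \<nu> b)" using Suc.hyps(2) by simp
  from Suc.hyps(1)[OF this nQ vQ] tot deg show ?case by simp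
qed

text \<open>Descent at the root b: s and then r vanish there, and the quotients satisfy the same congruence.\<close>

lemma squarefree_quadratic_descent:
  fixes p :: int
  assumes p: "prime p" and f: "f = [:-b, 1:] * g" and g: "\<not> p dvd poly g b" and c: "\<not> p dvd c"
    and "degree r \<le> n" "degree s \<le> n"
    and "[:p:] dvd f * r\<^sup>2 - [:c:] * s\<^sup>2"
  shows "[:p:] dvd r \<and> [:p:] dvd s"
  using assms(5-)
proof (induction n arbitrary: r s)
  case base: 0
  obtain r0 s0 where rs: "r = [:r0:]" "s = [:s0:]"
    using base by (auto elim!: degree_eq_zeroE)
  have "p dvd poly (f * r\<^sup>2 - [:c:] * s\<^sup>2) b" using base(3) by (rule const_dvd_poly_eval)
  then have "p dvd c * s0\<^sup>2" unfolding f rs by simp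
  then have s0: "p dvd s0" using p c by (simp add: prime_dvd_mult_iff prime_dvd_power_iff)
  then have "[:p:] dvd s" using rs by simp
  then have sd: "[:p:] dvd [:c:] * s\<^sup>2" by (metis dvd_mult power2_eq_square)
  then have "[:p:] dvd f * r\<^sup>2" using base(3) by (metis dvd_add_right_iff diff_add_cancel add.commute)
  then have "[:p:] dvd f \<or> [:p:] dvd r" using prime_const_poly[OF p]
    by (metis prime_elem_dvd_multD prime_elem_dvd_power)
  moreover have "\<not> [:p:] dvd f"
  proof
    assume "[:p:] dvd f"
    then have "[:p:] dvd g"
      unfolding f using prime_const_poly[OF p] not_const_dvd_linear[OF p] prime_elem_dvd_multD by blast
    with g const_dvd_poly_eval show False by blast
  qed
  ultimately show ?case using s0 rs by simp
next
  case (Suc n)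
  define r1 s1 where "r1 = synthetic_div r b" and "s1 = synthetic_div s b"
  define l where "l = [:-b, 1:]"
  have l: "\<not> [:p:] dvd l" unfolding l_def by (rule not_const_dvd_linear[OF p])
  have lb: "poly l b = 0" by (simp add: l_def)
  have fl: "f = l * g" using f l_def by simp
  have r: "r = l * r1 + [:poly r b:]" and s: "s = l * s1 + [:poly s b:]"
    unfolding l_def by (simp_all add: r1_def s1_def synthetic_div_correct' del: mult_pCons_left)
  have "p dvd poly (f * r\<^sup>2 - [:c:] * s\<^sup>2) b" using Suc.prems(3) by (rule const_dvd_poly_eval)
  then have "p dvd c * (poly s b)\<^sup>2" unfolding fl by (simp add: lb)
  then have sb: "p dvd poly s b" using p c by (simp add: prime_dvd_mult_iff prime_dvd_power_iff)
  have "s - l * s1 = [:poly s b:]" by (subst s) simp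
  then have "[:p:] dvd s - l * s1" using sb by simp
  then obtain u where "s - l * s1 = [:p:] * u" by (elim dvdE)
  then have su: "s = l * s1 + [:p:] * u" by (metis add.commute diff_add_cancel)
  \<comment> \<open>After the substitution for \<open>s\<close> all terms but the first are
    multiples of \<open>p\<close>. Cancelling one factor \<open>l\<close> leaves a congruence in
    which \<open>s1\<close> carries \<open>l\<close>, so evaluation at \<open>b\<close> now isolates
    \<open>r\<close>.\<close>
  have "l * g * r\<^sup>2 - C * (l * s1 + P * u)\<^sup>2 = l * (g * r\<^sup>2 - l * (C * s1\<^sup>2)) + P * (- (C * (u * (l * s1 + l * s1 + P * u))))"
    for C P :: "int poly" by (simp add: power2_eq_square algebra_simps)
  from this[of "[:c:]" "[:p:]"] have "[:p:] dvd l * (g * r\<^sup>2 - l * ([:c:] * s1\<^sup>2))"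
    using Suc.prems(3) unfolding fl su by (metis dvd_triv_left dvd_add_left_iff)
  then have d1: "[:p:] dvd g * r\<^sup>2 - l * ([:c:] * s1\<^sup>2)"
    using prime_const_poly[OF p] l prime_elem_dvd_multD by blast
  then have "p dvd poly (g * r\<^sup>2 - l * ([:c:] * s1\<^sup>2)) b" by (rule const_dvd_poly_eval)
  then have "p dvd poly g b * (poly r b)\<^sup>2" by (simp add: lb)
  then have rb: "p dvd poly r b" using p g by (simp add: prime_dvd_mult_iff prime_dvd_power_iff)
  have "r - l * r1 = [:poly r b:]" by (subst r) simp
  then have "[:p:] dvd r - l * r1" using rb by simp
  then obtain v where "r - l * r1 = [:p:] * v" by (elim dvdE)
  then have rv: "r = l * r1 + [:p:] * v" by (metis add.commute diff_add_cancel)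
  have "g * (l * r1 + P * v)\<^sup>2 - l * (C * s1\<^sup>2) = l * (l * g * r1\<^sup>2 - C * s1\<^sup>2) + P * (g * v * (l * r1 + l * r1 + P * v))"
    for C P :: "int poly" by (simp add: power2_eq_square algebra_simps)
  from this[of "[:p:]" "[:c:]"] have "[:p:] dvd l * (f * r1\<^sup>2 - [:c:] * s1\<^sup>2)"
    using d1 unfolding fl rv by (metis dvd_triv_left dvd_add_left_iff)
  then have "[:p:] dvd f * r1\<^sup>2 - [:c:] * s1\<^sup>2"
    using prime_const_poly[OF p] l prime_elem_dvd_multD by blast
  moreover have "degree r1 \<le> n" "degree s1 \<le> n"
    using Suc.prems by (simp_all add: r1_def s1_def degree_synthetic_div)
  ultimately have "[:p:] dvd r1 \<and> [:p:] dvd s1" by (intro Suc.IH)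
  then show ?case unfolding rv su by (metis dvd_add dvd_mult dvd_triv_left)
qed

section \<open>The Frobenius map modulo p\<close>

lemma fermat_int:
  fixes p :: nat
  assumes "prime p"
  shows "[x ^ p = x] (mod int p)"
proof -
  define y where "y = nat (x mod int p)"
  have p0: "p > 0" using assms by (simp add: prime_gt_0_nat)
  have y: "int y = x mod int p" using p0 by (simp add: y_def)
  have "[y ^ p = y] (mod p)"
  proof (cases "p dvd y")
    case True
    then have "p dvd y ^ p" using p0 by (meson dvd_power dvd_trans)
    then show ?thesis using True by (simp add: cong_def)
  next
    case False
    then have "[y ^ (p - 1) = 1] (mod p)" using assms fermat_theorem by blast
    then have "[y * y ^ (p - 1) = y * 1] (mod p)" by (rule cong_scalar_left)
    moreover have "y * y ^ (p - 1) = y ^ p" using p0 by (simp add: power_eq_if)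
    ultimately show ?thesis by simp
  qed
  then have "[int y ^ p = int y] (mod int p)" by (metis cong_int_iff of_nat_power)
  then show ?thesis unfolding y by (simp add: cong_def power_mod)
qed

lemma freshman_dream_poly:
  fixes p :: nat and A B :: "int poly"
  assumes p: "prime p"
  shows "[:int p:] dvd (A + B) ^ p - A ^ p - B ^ p"
proof -
  have p0: "p > 0" using p by (simp add: prime_gt_0_nat)
  have "(A + B) ^ p = (\<Sum>k\<le>p. of_nat (p choose k) * A ^ k * B ^ (p - k))"
    by (rule binomial_ring)
  also have "{..p} = insert 0 (insert p {1..<p})" using p0 by auto
  also have "(\<Sum>k\<in>insert 0 (insert p {1..<p}). of_nat (p choose k) * A ^ k * B ^ (p - k)) =
     B ^ p + (A ^ p + (\<Sum>k=1..<p. of_nat (p choose k) * A ^ k * B ^ (p - k)))"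
    using p0 by simp
  finally have "(A + B) ^ p - A ^ p - B ^ p = (\<Sum>k=1..<p. of_nat (p choose k) * A ^ k * B ^ (p - k))"
    by simp
  also have "[:int p:] dvd \<dots>"
  proof (intro dvd_sum)
    fix k assume k: "k \<in> {1..<p}"
    then have "p dvd (p choose k)" using p by (intro dvd_choose_prime) auto
    then obtain t where "p choose k = p * t" by (elim dvdE)
    then have "of_nat (p choose k) = [:int p:] * of_nat t"
      by (simp add: of_nat_poly)
    then show "[:int p:] dvd of_nat (p choose k) * A ^ k * B ^ (p - k)"
      by (metis dvd_mult2 dvd_triv_left)
  qed
  finally show ?thesis .
qed

lemma monom_1_not_const_dvd:
  fixes p :: int
  assumes "prime p"
  shows "\<not> [:p:] dvd monom 1 n"
proof
  assume "[:p:] dvd monom 1 n"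
  then have "p dvd coeff (monom 1 n) n" unfolding const_poly_dvd_iff by blast
  with assms show False by (simp add: not_prime_unit)
qed

text \<open>\<open>B\<close> is the root set of a squarefree monic polynomial modulo
  \<open>p\<close>. Keeping 0 out of \<open>B\<close> makes the constant term of \<open>f\<close> a
  unit, which the nonvanishing of the auxiliary polynomial relies on; a general proper set of
  residues is reached by translation.\<close>

locale distinct_roots_mod =
  fixes p :: nat and B :: "int set"
  assumes p: "prime p" and p2: "2 < p" and finB: "finite B" and B_ne: "B \<noteq> {}"
    and B_inc: "\<And>a b. a \<in> B \<Longrightarrow> b \<in> B \<Longrightarrow> a \<noteq> b \<Longrightarrow> \<not> int p dvd b - a"
    and B_nz: "\<And>b. b \<in> B \<Longrightarrow> \<not> int p dvd b"
begin

definition f :: "int poly" where "f = (\<Prod>b\<in>B. [:-b, 1:])"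

abbreviation m :: nat where "m \<equiv> card B"

definition h :: nat where "h = (p - 1) div 2"

lemma h_p: "2 * h + 1 = p"
  using p p2 prime_odd_nat[of p] unfolding h_def by auto

lemma pint: "prime (int p)"
  using p by simp

lemma degree_f: "degree f = m"
  unfolding f_def by (subst degree_prod_eq_sum_degree) auto

lemma m_pos: "m > 0"
  using finB B_ne by (simp add: card_gt_0_iff)

lemma f_split:
  assumes "b \<in> B"
  shows "f = [:-b, 1:] * (\<Prod>c\<in>B - {b}. [:-c, 1:])" and "\<not> int p dvd poly (\<Prod>c\<in>B - {b}. [:-c, 1:]) b"
proof -
  show "f = [:-b, 1:] * (\<Prod>c\<in>B - {b}. [:-c, 1:])"
    unfolding f_def using finB assms by (rule prod.remove)
  show "\<not> int p dvd poly (\<Prod>c\<in>B - {b}. [:-c, 1:]) b"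
    using finB B_inc[of _ b] assms
    by (auto simp: poly_prod prime_dvd_prod_iff[OF _ pint])
qed

lemma poly_f: "poly f x = (\<Prod>b\<in>B. x - b)"
  by (simp add: f_def poly_prod)

lemma f0: "\<not> int p dvd poly f 0"
  using finB B_nz by (auto simp: poly_f prime_dvd_prod_iff[OF _ pint])

lemma not_dvd_f: "\<not> [:int p:] dvd f"
  using f0 const_dvd_poly_eval by blast

text \<open>\<open>T k r\<close> is what remains of the derivative of \<open>f ^ k * r\<close> once
  \<open>f ^ (k - 1)\<close> is taken out. Each derivative thus costs one power of \<open>f\<close>
  and raises the degree of the cofactor by at most \<open>m\<close>; the factor \<open>f ^ l\<close>
  in the auxiliary polynomial pays for \<open>l\<close> derivatives.\<close>

definition T :: "nat \<Rightarrow> int poly \<Rightarrow> int poly" where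
  "T k r = of_nat k * pderiv f * r + f * pderiv r"

primrec E :: "nat \<Rightarrow> nat \<Rightarrow> int poly \<Rightarrow> int poly" where
  "E k 0 r = r"
| "E k (Suc i) r = T (k - i) (E k i r)"

lemma pderiv_f_power: "0 < k \<Longrightarrow> pderiv (f ^ k * r) = f ^ (k - 1) * T k r"
proof (cases k)
  case (Suc n)
  show ?thesis unfolding Suc pderiv_mult pderiv_power_Suc T_def by (simp add: of_nat_poly algebra_simps)
qed simp

lemma degree_T: "degree (T k r) \<le> degree r + m"
proof -
  have "degree (of_nat k * pderiv f * r) \<le> degree (of_nat k * pderiv f) + degree r"
    by (rule degree_mult_le)
  also have "degree (of_nat k * pderiv f) \<le> 0 + degree (pderiv f)"
    by (metis degree_mult_le degree_of_nat)
  also have "degree (pderiv f) \<le> m" by (simp add: degree_pderiv degree_f)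
  finally have 1: "degree (of_nat k * pderiv f * r) \<le> degree r + m" by simp
  have "degree (f * pderiv r) \<le> degree f + degree (pderiv r)" by (rule degree_mult_le)
  also have "\<dots> \<le> degree r + m" by (simp add: degree_f degree_pderiv)
  finally show ?thesis unfolding T_def using 1 by (intro degree_add_le)
qed

lemma degree_E: "degree (E k i r) \<le> degree r + i * m"
proof (induction i)
  case (Suc i)
  then show ?case using degree_T[of "k - i" "E k i r"] by simp
qed simp

lemma E_diff: "E k i (r - s) = E k i r - E k i s"
proof (induction i)
  case (Suc i)
  have "T n (u - v) = T n u - T n v" for n u v by (simp add: T_def pderiv_diff algebra_simps)
  with Suc show ?case by simp
qed simp

text \<open>Stepanov's auxiliary polynomial. At a point x with f(x)^h = a its derivatives reduce modulo p
  to the values of the low degree polynomials cond below, since x^p = x there.\<close>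

definition aux :: "nat \<Rightarrow> nat \<Rightarrow> (nat \<Rightarrow> int poly) \<Rightarrow> (nat \<Rightarrow> int poly) \<Rightarrow> int poly" where
  "aux l J r s = (\<Sum>j<J. monom 1 (p * j) * (f ^ l * r j + f ^ (l + h) * s j))"

text \<open>The derivative of X^(p j) is a multiple of \<open>p\<close>, so these monomials behave
  as constants. Large powers of X^p can therefore be used as free coefficients without growing under
  differentiation.\<close>

lemma pderiv_monom_mult:
  "[:int p:] dvd pderiv (monom 1 (p * j) * u) - monom 1 (p * j) * pderiv u"
proof -
  have "pderiv (monom 1 (p * j)) = [:int p:] * monom (int j) (p * j - 1)"
    by (simp add: pderiv_monom smult_monom)
  then have "pderiv (monom 1 (p * j) * u) - monom 1 (p * j) * pderiv u = [:int p:] * (monom (int j) (p * j - 1) * u)"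
    by (simp add: pderiv_mult mult.commute)
  then show ?thesis by (metis dvd_triv_left)
qed

lemma aux_derivative:
  assumes "i \<le> l"
  shows "[:int p:] dvd (pderiv ^^ i) (aux l J r s) -
    (\<Sum>j<J. monom 1 (p * j) * (f ^ (l - i) * E l i (r j) + f ^ (l + h - i) * E (l + h) i (s j)))"
  using assms
proof (induction i)
  case 0
  then show ?case by (simp add: aux_def)
next
  case (Suc i)
  let ?u = "\<lambda>i j. f ^ (l - i) * E l i (r j) + f ^ (l + h - i) * E (l + h) i (s j)"
  have step: "pderiv (?u i j) = ?u (Suc i) j" for j
    using Suc.prems by (simp add: pderiv_add pderiv_f_power)
  have "[:int p:] dvd pderiv ((pderiv ^^ i) (aux l J r s) - (\<Sum>j<J. monom 1 (p * j) * ?u i j))"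
    using Suc by (intro const_dvd_pderiv) simp
  moreover have "[:int p:] dvd (\<Sum>j<J. pderiv (monom 1 (p * j) * ?u i j) - monom 1 (p * j) * pderiv (?u i j))"
    by (intro dvd_sum pderiv_monom_mult)
  ultimately have "[:int p:] dvd pderiv ((pderiv ^^ i) (aux l J r s) - (\<Sum>j<J. monom 1 (p * j) * ?u i j)) +
     (\<Sum>j<J. pderiv (monom 1 (p * j) * ?u i j) - monom 1 (p * j) * pderiv (?u i j))"
    by (rule dvd_add)
  also have "\<dots> = (pderiv ^^ Suc i) (aux l J r s) - (\<Sum>j<J. monom 1 (p * j) * ?u (Suc i) j)"
    unfolding pderiv_diff higher_pderiv_sum[of 1, simplified] sum_subtractf step by simp
  finally show ?case .
qed

definition cond :: "nat \<Rightarrow> nat \<Rightarrow> (nat \<Rightarrow> int poly) \<Rightarrow> (nat \<Rightarrow> int poly) \<Rightarrow> int \<Rightarrow> nat \<Rightarrow> int poly" where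
  "cond l J r s a i = (\<Sum>j<J. monom 1 j * (E l i (r j) + smult a (E (l + h) i (s j))))"

lemma aux_vanishes:
  assumes c: "\<And>i. i < l \<Longrightarrow> [:int p:] dvd cond l J r s a i"
    and x: "int p dvd poly f x ^ h - a" and l: "l \<le> p"
  shows "vanishes_mod (int p) l (aux l J r s) x"
proof (rule vanishes_mod_by_derivatives[OF p l])
  fix i assume i: "i < l"
  let ?S = "\<Sum>j<J. monom 1 (p * j) * (f ^ (l - i) * E l i (r j) + f ^ (l + h - i) * E (l + h) i (s j))"
  have 1: "[poly ((pderiv ^^ i) (aux l J r s)) x = poly ?S x] (mod int p)"
    using const_dvd_poly_eval[OF aux_derivative[of i l J r s], of x] i by (simp add: cong_iff_dvd_diff)
  have fx: "[poly f x ^ h = a] (mod int p)" using x by (simp add: cong_iff_dvd_diff)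
  have xp: "[x ^ (p * j) = x ^ j] (mod int p)" for j
    unfolding power_mult by (intro cong_pow fermat_int p)
  define e1 e2 where "e1 = (\<lambda>j. poly (E l i (r j)) x)" and "e2 = (\<lambda>j. poly (E (l + h) i (s j)) x)"
  have 2: "poly ?S x = (\<Sum>j<J. x ^ (p * j) * (poly f x ^ (l - i) * (e1 j + poly f x ^ h * e2 j)))"
  proof -
    have "l + h - i = (l - i) + h" using i by simp
    then show ?thesis by (simp add: e1_def e2_def poly_sum poly_monom power_add algebra_simps)
  qed
  have 3: "[(\<Sum>j<J. x ^ (p * j) * (poly f x ^ (l - i) * (e1 j + poly f x ^ h * e2 j))) =
     (\<Sum>j<J. x ^ j * (poly f x ^ (l - i) * (e1 j + a * e2 j)))] (mod int p)"
    by (intro cong_sum cong_mult cong_add cong_refl xp fx)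
  have 4: "(\<Sum>j<J. x ^ j * (poly f x ^ (l - i) * (e1 j + a * e2 j))) =
     poly f x ^ (l - i) * poly (cond l J r s a i) x"
    by (simp add: cond_def e1_def e2_def poly_sum poly_monom sum_distrib_left mult.left_commute)
  have "[poly f x ^ (l - i) * poly (cond l J r s a i) x = 0] (mod int p)"
    using const_dvd_poly_eval[OF c[OF i], of x] by (simp add: cong_0_iff)
  then have "[poly ?S x = 0] (mod int p)"
    unfolding 2 using 3 unfolding 4 by (meson cong_trans)
  with 1 show "int p dvd poly ((pderiv ^^ i) (aux l J r s)) x"
    by (meson cong_0_iff cong_trans)
qed

text \<open>At the least index \<open>j1\<close> with a nontrivial pair, removing X^(p j1) leaves r
  + f^h s = 0 modulo \<open>p\<close> and X^p. Multiplying by f (r - f^h s) and using 2h + 1 = p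
  gives f r^2 = f^p s^2 = f(0) s^2. Both outer terms have degree below \<open>p\<close>, so this
  holds as an identity modulo \<open>p\<close>, and the simple root of \<open>f\<close> rules it out
  unless r and s vanish.\<close>

lemma aux_nonzero:
  assumes deg: "\<And>j. degree (r j) < d" "\<And>j. degree (s j) < d" and d: "2 * (d - 1) + m < p"
    and j0: "j0 < J" "\<not> ([:int p:] dvd r j0 \<and> [:int p:] dvd s j0)"
  shows "\<not> [:int p:] dvd aux l J r s"
proof
  assume dvd: "[:int p:] dvd aux l J r s"
  note pp = prime_const_poly[OF pint]
  define u where "u = (\<lambda>j. r j + f ^ h * s j)"
  have "aux l J r s = f ^ l * (\<Sum>j<J. monom 1 (p * j) * u j)"
    by (simp add: aux_def u_def sum_distrib_left power_add distrib_left mult.assoc mult.left_commute)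
  with dvd have "[:int p:] dvd f ^ l * (\<Sum>j<J. monom 1 (p * j) * u j)" by simp
  then have dsum: "[:int p:] dvd (\<Sum>j<J. monom 1 (p * j) * u j)"
    using prime_elem_dvd_multD[OF pp] prime_elem_dvd_power[OF pp] not_dvd_f by blast
  define j1 where "j1 = (LEAST j. \<not> ([:int p:] dvd r j \<and> [:int p:] dvd s j))"
  have bad: "\<not> ([:int p:] dvd r j1 \<and> [:int p:] dvd s j1)"
    unfolding j1_def by (rule LeastI[of _ j0]) (rule j0(2))
  have "j1 \<le> j0" unfolding j1_def by (rule Least_le) (rule j0(2))
  then have j1: "j1 < J" using j0 by simp
  have good: "[:int p:] dvd r j \<and> [:int p:] dvd s j" if "j < j1" for j
    using not_less_Least[of j "\<lambda>j. \<not> ([:int p:] dvd r j \<and> [:int p:] dvd s j)"] that unfolding j1_def by blast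
  define Z where "Z = (\<Sum>j=Suc j1..<J. monom 1 (p * (j - Suc j1)) * u j)"
  have "sum g {..<J} = sum g {..<j1} + sum g (insert j1 {Suc j1..<J})" for g :: "nat \<Rightarrow> int poly"
  proof -
    have "sum g {..<J} = sum g ({..<j1} \<union> insert j1 {Suc j1..<J})"
      using j1 by (intro sum.cong) auto
    also have "\<dots> = sum g {..<j1} + sum g (insert j1 {Suc j1..<J})"
      by (rule sum.union_disjoint) auto
    finally show ?thesis .
  qed
  from this[of "\<lambda>j. monom 1 (p * j) * u j"] dsum
  have "[:int p:] dvd (\<Sum>j<j1. monom 1 (p * j) * u j) + (\<Sum>j\<in>insert j1 {Suc j1..<J}. monom 1 (p * j) * u j)"
    by simp
  moreover have "[:int p:] dvd (\<Sum>j<j1. monom 1 (p * j) * u j)"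
    using good unfolding u_def by (intro dvd_sum dvd_mult dvd_add) auto
  ultimately have "[:int p:] dvd (\<Sum>j\<in>insert j1 {Suc j1..<J}. monom 1 (p * j) * u j)"
    by (simp only: dvd_add_right_iff)
  also have "(\<Sum>j\<in>insert j1 {Suc j1..<J}. monom 1 (p * j) * u j) =
      monom 1 (p * j1) * u j1 + (\<Sum>j=Suc j1..<J. monom 1 (p * j) * u j)"
    by simp
  also have "(\<Sum>j=Suc j1..<J. monom 1 (p * j) * u j) = monom 1 (p * j1) * (monom 1 p * Z)"
    unfolding Z_def sum_distrib_left
  proof (intro sum.cong refl)
    fix j assume "j \<in> {Suc j1..<J}"
    then obtain k where "j = Suc j1 + k" by (metis atLeastLessThan_iff le_Suc_ex)
    then have "p * j = p * j1 + (p + p * (j - Suc j1))" by (simp add: algebra_simps)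
    then show "monom 1 (p * j) * u j = monom 1 (p * j1) * (monom 1 p * (monom 1 (p * (j - Suc j1)) * u j))"
      by (simp add: mult_monom mult.assoc[symmetric])
  qed
  finally have "[:int p:] dvd monom 1 (p * j1) * (u j1 + monom 1 p * Z)"
    by (simp add: distrib_left)
  then have uZ: "[:int p:] dvd u j1 + monom 1 p * Z"
    using pp monom_1_not_const_dvd[OF pint] prime_elem_dvd_multD by blast
  \<comment> \<open>Frobenius on f = c + X w: f^p = c^p + X^p w^p modulo \<open>p\<close>, and c^p =
    c by Fermat. Modulo X^p only the constant \<open>c\<close> survives.\<close>
  define c where "c = poly f 0"
  define w where "w = synthetic_div f 0"
  have fw: "f = [:c:] + monom 1 1 * w"
    using synthetic_div_correct'[of 0 f] by (simp add: c_def w_def monom_altdef)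
  have "[:int p:] dvd f ^ p - [:c:] ^ p - (monom 1 1 * w) ^ p"
    by (subst fw) (rule freshman_dream_poly[OF p])
  also have "(monom 1 1 * w) ^ p = monom 1 p * w ^ p"
    by (simp add: power_mult_distrib monom_power)
  also have "[:c:] ^ p = [:c ^ p:]" by (simp add: poly_const_pow)
  finally have "[:int p:] dvd f ^ p - [:c ^ p:] - monom 1 p * w ^ p" .
  moreover have "[:int p:] dvd [:c ^ p - c:]"
    using fermat_int[OF p, of c] by (simp add: cong_iff_dvd_diff)
  ultimately have fp: "[:int p:] dvd (f ^ p - [:c ^ p:] - monom 1 p * w ^ p) + [:c ^ p - c:]"
    by (rule dvd_add)
  have "(f ^ p - [:c ^ p:] - monom 1 p * w ^ p) + [:c ^ p - c:] = f ^ p - [:c:] - monom 1 p * w ^ p"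
    by (simp add: algebra_simps)
  with fp have fp': "[:int p:] dvd f ^ p - [:c:] - monom 1 p * w ^ p" by simp
  define A where "A = f * (r j1)\<^sup>2 - [:c:] * (s j1)\<^sup>2"
  \<comment> \<open>\<open>Y\<close> gathers every term that carries X^p, both from \<open>Z\<close>
    and from the Frobenius expansion of f^p.\<close>
  define Y where "Y = w ^ p * (s j1)\<^sup>2 - f * (r j1 - f ^ h * s j1) * Z"
  have fph: "f ^ p = f * f ^ h * f ^ h"
    by (subst h_p[symmetric]) (simp add: power_add mult_2 power_mult power2_eq_square algebra_simps)
  have id: "F * R * R - C * S * S - X * (W * S * S - F * (R - G * S) * ZZ) =
      F * (R - G * S) * (R + G * S + X * ZZ) + (F * G * G - C - X * W) * S * S"
    for F R C S X W G ZZ :: "int poly"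
    by (simp add: algebra_simps)
  have "A - monom 1 p * Y = f * (r j1 - f ^ h * s j1) * (u j1 + monom 1 p * Z) + (f ^ p - [:c:] - monom 1 p * w ^ p) * (s j1)\<^sup>2"
    unfolding A_def Y_def u_def fph power2_eq_square using id[of f "r j1" "[:c:]" "s j1" "monom 1 p" "w ^ p" "f ^ h" Z]
    by (simp only: mult.assoc)
  then have AY: "[:int p:] dvd A - monom 1 p * Y"
    by (simp only:) (rule dvd_add[OF dvd_mult[OF uZ] dvd_mult2[OF fp']])
  have dA: "degree A < p"
  proof -
    have r1: "degree (r j1) \<le> d - 1" "degree (s j1) \<le> d - 1"
      using deg(1)[of j1] deg(2)[of j1] by linarith+
    have "degree (f * (r j1)\<^sup>2) \<le> degree f + degree ((r j1)\<^sup>2)" by (rule degree_mult_le)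
    also have "\<dots> \<le> m + degree (r j1) * 2" using degree_power_le[of "r j1" 2] by (simp add: degree_f)
    finally have 1: "degree (f * (r j1)\<^sup>2) < p" using r1(1) d by linarith
    have "degree ([:c:] * (s j1)\<^sup>2) \<le> degree [:c:] + degree ((s j1)\<^sup>2)" by (rule degree_mult_le)
    also have "\<dots> \<le> degree (s j1) * 2" using degree_power_le[of "s j1" 2] by simp
    finally have 2: "degree ([:c:] * (s j1)\<^sup>2) < p" using r1(2) d by linarith
    show ?thesis unfolding A_def using 1 2 by (rule degree_diff_less)
  qed
  have "[:int p:] dvd A"
    unfolding const_poly_dvd_iff
  proof
    fix n
    show "int p dvd coeff A n"
    proof (cases "n < p")
      case True
      have "int p dvd coeff (A - monom 1 p * Y) n" using AY unfolding const_poly_dvd_iff by blast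
      then show ?thesis using True by (simp add: coeff_monom_mult)
    next
      case False
      then show ?thesis using dA by (simp add: coeff_eq_0)
    qed
  qed
  obtain b where b: "b \<in> B" using B_ne by blast
  have "\<not> int p dvd c" using f0 by (simp add: c_def)
  then have "[:int p:] dvd r j1 \<and> [:int p:] dvd s j1"
    using squarefree_quadratic_descent[OF pint f_split[OF b], of c "r j1" d "s j1"] \<open>[:int p:] dvd A\<close>
      deg(1)[of j1] deg(2)[of j1] unfolding A_def by simp
  with bad show False ..
qed

end

section \<open>Existence of the auxiliary polynomial and the resulting point count\<close>

context distinct_roots_mod
begin

text \<open>A pigeonhole argument stands in for linear algebra over the field. There are
  \<open>p ^ (2 * J * d)\<close> coefficient vectors with entries in 0..p-1, and fewer possible
  outcomes of the linear conditions modulo \<open>p\<close>. The difference of two colliding vectors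
  satisfies all conditions, and it is nonzero modulo \<open>p\<close> since its entries are smaller
  than \<open>p\<close> in absolute value.\<close>

lemma exists_cond:
  assumes size: "l * (d + l * m + J) < 2 * J * d"
  obtains r s where "\<And>j. degree (r j) < d" "\<And>j. degree (s j) < d"
    "\<exists>j<J. \<not> ([:int p:] dvd r j \<and> [:int p:] dvd s j)"
    "\<And>i. i < l \<Longrightarrow> [:int p:] dvd cond l J r s a i"
proof -
  have d0: "d > 0" using size by (cases d) auto
  have p0: "p > 0" using p2 by simp
  \<comment> \<open>A common bound for the number of coefficients of one condition:
    \<open>d + l * m\<close> covers the cofactors after fewer than \<open>l\<close> derivatives, and
    \<open>J\<close> covers the factor X^j.\<close>
  define D where "D = d + l * m + J"
  define I where "I = (UNIV :: bool set) \<times> {..<J} \<times> {..<d}"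
  define C where "C = {..<l} \<times> {..<D}"
  define U where "U = PiE I (\<lambda>_. {0..<int p})"
  define V where "V = PiE C (\<lambda>_. {0..<int p})"
  define pol where "pol = (\<lambda>(c :: bool \<times> nat \<times> nat \<Rightarrow> int) t j. \<Sum>i<d. monom (c (t, j, i)) i)"
  define cd where "cd = (\<lambda>c i. cond l J (pol c False) (pol c True) a i)"
  define \<Phi> where "\<Phi> = (\<lambda>c. \<lambda>x\<in>C. coeff (cd c (fst x)) (snd x) mod int p)"
  have fin: "finite I" "finite C" by (simp_all add: I_def C_def)
  have "card U = p ^ card I" unfolding U_def using fin(1) by (simp add: card_PiE)
  also have "card I = 2 * J * d" by (simp add: I_def card_cartesian_product)
  finally have cU: "card U = p ^ (2 * J * d)" .
  have "card V = p ^ card C" unfolding V_def using fin(2) by (simp add: card_PiE)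
  also have "card C = l * D" by (simp add: C_def card_cartesian_product)
  finally have cV: "card V = p ^ (l * D)" .
  have "\<Phi> c \<in> V" for c
    using p0 by (auto simp: \<Phi>_def V_def)
  then have "\<Phi> ` U \<subseteq> V" by blast
  moreover have "finite V" unfolding V_def using fin by (intro finite_PiE) auto
  ultimately have "card (\<Phi> ` U) \<le> card V" by (rule card_mono[rotated])
  also have "\<dots> < card U" unfolding cU cV using size p2 by (intro power_strict_increasing) (auto simp: D_def)
  finally have "\<not> inj_on \<Phi> U" by (rule pigeonhole)
  then obtain c c' where c: "c \<in> U" "c' \<in> U" "c \<noteq> c'" "\<Phi> c = \<Phi> c'" unfolding inj_on_def by blast
  define e where "e = (\<lambda>x. c x - c' x)"
  have pol_e: "pol e t j = pol c t j - pol c' t j" for t j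
    by (simp add: pol_def e_def sum_subtractf flip: diff_monom)
  have coeff_pol: "coeff (pol g t j) i = (if i < d then g (t, j, i) else 0)" for g t j i
    by (simp add: pol_def coeff_sum)
  have deg_pol: "degree (pol g t j) < d" for g t j
    using d0 coeff_pol by (intro degree_lessI) auto
  have cd_e: "cd e i = cd c i - cd c' i" for i
    unfolding cd_def cond_def pol_e E_diff
    by (simp add: sum_subtractf[symmetric] algebra_simps smult_diff_right)
  show thesis
  proof (rule that[of "pol e False" "pol e True"])
    show "degree (pol e False j) < d" "degree (pol e True j) < d" for j by (rule deg_pol)+
    have "\<exists>x\<in>I. c x \<noteq> c' x" using c(1-3) unfolding U_def by (metis PiE_ext)
    then obtain t j i where x: "j < J" "i < d" "c (t, j, i) \<noteq> c' (t, j, i)"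
      unfolding I_def by auto
    have "(t, j, i) \<in> I" using x by (simp add: I_def)
    then have "c (t, j, i) \<in> {0..<int p}" "c' (t, j, i) \<in> {0..<int p}"
      using c(1,2) unfolding U_def by blast+
    then have "\<bar>e (t, j, i)\<bar> < int p" "e (t, j, i) \<noteq> 0" using x by (auto simp: e_def)
    then have "\<not> int p dvd e (t, j, i)" using zdvd_not_zless[of "\<bar>e (t, j, i)\<bar>" "int p"] by simp
    then have "\<not> int p dvd coeff (pol e t j) i" using x by (simp add: coeff_pol)
    then have "\<not> [:int p:] dvd pol e t j" unfolding const_poly_dvd_iff by blast
    then show "\<exists>j<J. \<not> ([:int p:] dvd pol e False j \<and> [:int p:] dvd pol e True j)"
      using x by (cases t) auto
    fix i assume i: "i < l"
    show "[:int p:] dvd cond l J (pol e False) (pol e True) a i"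
      unfolding const_poly_dvd_iff
    proof
      fix n
      show "int p dvd coeff (cond l J (pol e False) (pol e True) a i) n"
      proof (cases "n < D")
        case True
        then have "(i, n) \<in> C" using i by (simp add: C_def)
        then have "coeff (cd c i) n mod int p = coeff (cd c' i) n mod int p"
          using fun_cong[OF c(4), of "(i, n)"] by (simp add: \<Phi>_def)
        then have "int p dvd coeff (cd e i) n" by (simp add: cd_e mod_eq_dvd_iff)
        then show ?thesis by (simp add: cd_def)
      next
        case False
        have E1: "degree (E k i (pol e t j)) < d + l * m" for k t j
        proof -
          have "degree (E k i (pol e t j)) \<le> degree (pol e t j) + i * m" by (rule degree_E)
          also have "\<dots> < d + i * m" using deg_pol by simp
          also have "\<dots> \<le> d + l * m" using i by simp
          finally show ?thesis .
        qed
        have "degree (cond l J (pol e False) (pol e True) a i) < D"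
          unfolding cond_def
        proof (rule degree_sum_less)
          show "0 < D" using d0 by (simp add: D_def)
          fix j assume "j \<in> {..<J}"
          have "degree (smult a (E (l + h) i (pol e True j))) < d + l * m"
            using degree_smult_le E1 by (rule le_less_trans)
          then have u: "degree (E l i (pol e False j) + smult a (E (l + h) i (pol e True j))) < d + l * m"
            using E1 by (intro degree_add_less)
          have "degree (monom 1 j * (E l i (pol e False j) + smult a (E (l + h) i (pol e True j)))) \<le>
              degree (monom (1::int) j) + degree (E l i (pol e False j) + smult a (E (l + h) i (pol e True j)))"
            by (rule degree_mult_le)
          also have "\<dots> < D" using u \<open>j \<in> {..<J}\<close> by (simp add: D_def degree_monom_eq)
          finally show "degree (monom 1 j * (E l i (pol e False j) + smult a (E (l + h) i (pol e True j)))) < D" .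
        qed
        then show ?thesis using False by (simp add: coeff_eq_0)
      qed
    qed
  qed
qed

lemma degree_aux:
  assumes deg: "\<And>j. degree (r j) < d" "\<And>j. degree (s j) < d"
  shows "degree (aux l J r s) \<le> p * J + (l + h) * m + d"
  unfolding aux_def
proof (rule degree_sum_le)
  fix j assume j: "j \<in> {..<J}"
  have fk: "degree (f ^ k) \<le> k * m" for k
    using degree_power_le[of f k] by (simp add: degree_f mult.commute)
  have 1: "degree (f ^ l * r j) \<le> (l + h) * m + d"
    using degree_mult_le[of "f ^ l" "r j"] fk[of l] deg(1)[of j] by (simp add: add_mult_distrib)
  have 2: "degree (f ^ (l + h) * s j) \<le> (l + h) * m + d"
    using degree_mult_le[of "f ^ (l + h)" "s j"] fk[of "l + h"] deg(2)[of j] by simp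
  have "degree (monom 1 (p * j) * (f ^ l * r j + f ^ (l + h) * s j)) \<le>
      degree (monom (1::int) (p * j)) + degree (f ^ l * r j + f ^ (l + h) * s j)"
    by (rule degree_mult_le)
  also have "\<dots> \<le> p * j + ((l + h) * m + d)"
    using 1 2 by (intro add_mono degree_add_le) (simp_all add: degree_monom_eq)
  also have "\<dots> \<le> p * J + (l + h) * m + d" using j by simp
  finally show "degree (monom 1 (p * j) * (f ^ l * r j + f ^ (l + h) * s j)) \<le> p * J + (l + h) * m + d" .
qed simp

text \<open>The parameters are order \<open>2 * q\<close>, \<open>q + 2 * m\<close> blocks and
  \<open>d\<close> about (p - m)/2, the largest value for which nonvanishing is guaranteed. Counting
  zeros with multiplicity against the degree, whose main term is \<open>p * (q + 2 * m)\<close>, and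
  dividing by \<open>2 * q\<close> gives p/2 plus an error of order m p / q for the point
  count.\<close>

lemma stepanov_count:
  assumes q: "1 \<le> q" "9 * q\<^sup>2 \<le> p" and m3: "3 * m \<le> p"
  shows "2 * q * card {x \<in> {0..<int p}. int p dvd poly f x ^ h - a} \<le> p * (q + 2 * m) + (2 * q + h) * m + p"
proof -
  let ?N = "{x \<in> {0..<int p}. int p dvd poly f x ^ h - a}"
  define d where "d = (p - m + 1) div 2"
  have dp: "p - m \<le> 2 * d" "2 * d \<le> p - m + 1" unfolding d_def by simp_all
  \<comment> \<open>This is the room the surplus of \<open>2 * m\<close> blocks needs:
    \<open>d\<close> is at least p/3, and \<open>9 * q\<^sup>2 \<le> p\<close> turns this into three
    times the square of \<open>q\<close>.\<close>
  then have d3: "3 * q\<^sup>2 \<le> d" using q m3 by linarith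
  have "q \<le> q\<^sup>2" using q(1) by (simp add: power2_eq_square)
  have mq: "q\<^sup>2 \<le> q\<^sup>2 * m" "q * m \<le> q\<^sup>2 * m" using m_pos \<open>q \<le> q\<^sup>2\<close> by simp_all
  have "0 < q\<^sup>2 * m" using m_pos q by simp
  then have "2 * (q\<^sup>2 * m) + q\<^sup>2 + 2 * (q * m) < 6 * (q\<^sup>2 * m)" using mq by linarith
  also have "6 * (q\<^sup>2 * m) \<le> 2 * (m * d)" using mult_le_mono2[OF d3, of "2 * m"] by (simp add: algebra_simps)
  finally have size: "(2 * q) * (d + (2 * q) * m + (q + 2 * m)) < 2 * (q + 2 * m) * d"
    by (simp add: algebra_simps power2_eq_square)
  obtain r s where rs: "\<And>j. degree (r j) < d" "\<And>j. degree (s j) < d"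
    "\<exists>j<q + 2 * m. \<not> ([:int p:] dvd r j \<and> [:int p:] dvd s j)"
    "\<And>i. i < 2 * q \<Longrightarrow> [:int p:] dvd cond (2 * q) (q + 2 * m) r s a i"
    using exists_cond[OF size] by blast
  let ?R = "aux (2 * q) (q + 2 * m) r s"
  have "0 < d" using rs(1)[of 0] by simp
  then have dlt: "2 * (d - 1) + m < p" using dp m3 p2 by linarith
  obtain j0 where j0: "j0 < q + 2 * m" "\<not> ([:int p:] dvd r j0 \<and> [:int p:] dvd s j0)" using rs(3) by blast
  have nz: "\<not> [:int p:] dvd ?R"
    by (rule aux_nonzero[of r d s, OF _ _ dlt j0]) (rule rs(1), rule rs(2))
  have "2 * q \<le> 9 * q\<^sup>2" using \<open>q \<le> q\<^sup>2\<close> by linarith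
  then have qp: "2 * q \<le> p" using q by linarith
  have "(\<Sum>x\<in>?N. 2 * q) \<le> degree ?R"
  proof (rule sum_multiplicities_le_degree[OF pint _ _ nz])
    show "finite ?N" by (rule finite_subset[of _ "{0..<int p}"]) auto
    show "\<not> int p dvd y - x" if "x \<in> ?N" "y \<in> ?N" "x \<noteq> y" for x y
    proof -
      have "\<bar>y - x\<bar> < int p" using that by auto
      then show ?thesis using that(3) zdvd_not_zless[of "\<bar>y - x\<bar>" "int p"] by auto
    qed
    show "vanishes_mod (int p) (2 * q) ?R x" if "x \<in> ?N" for x
      by (rule aux_vanishes[of _ _ r s a, OF rs(4) _ qp]) (use that in auto)
  qed
  also have "\<dots> \<le> p * (q + 2 * m) + (2 * q + h) * m + d" by (rule degree_aux) (rule rs)+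
  also have "d \<le> p" using dp by linarith
  finally show ?thesis by (simp add: mult.commute)
qed

end

section \<open>From point counts to character sums\<close>

context distinct_roots_mod
begin

lemma Legendre_sum_trivial:
  "\<bar>\<Sum>x\<in>{0..<int p}. real_of_int (Legendre (g x) p)\<bar> \<le> real p"
proof -
  have "\<bar>\<Sum>x\<in>{0..<int p}. real_of_int (Legendre (g x) p)\<bar> \<le> (\<Sum>x\<in>{0..<int p}. \<bar>real_of_int (Legendre (g x) p)\<bar>)"
    by (rule sum_abs)
  also have "\<dots> \<le> (\<Sum>x\<in>{0..<int p}. 1)"
  proof (rule sum_mono)
    show "\<bar>real_of_int (Legendre (g x) p)\<bar> \<le> 1" for x using Legendre_cases[of "g x" p] by auto
  qed
  finally show ?thesis by simp
qed

lemma stepanov_bound: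
  assumes m3: "3 * m \<le> p" and p36: "36 \<le> p"
  shows "2 * real (card {x \<in> {0..<int p}. int p dvd poly f x ^ h - a}) \<le> real p + 2 * real m + 21 * real m * sqrt p"
proof -
  define N where "N = card {x \<in> {0..<int p}. int p dvd poly f x ^ h - a}"
  \<comment> \<open>The largest order allowed by \<open>9 * q\<^sup>2 \<le> p\<close>. As sqrt p is
    at least 6, rounding down at most halves it, so \<open>q\<close> is at least sqrt p / 6; the
    secondary terms 7/2 p m, divided by \<open>q\<close>, then give the constant 21.\<close>
  define q where "q = nat \<lfloor>sqrt p / 3\<rfloor>"
  have s6: "6 \<le> sqrt p" using p36 by (intro real_le_rsqrt) simp
  have qr: "real q = real_of_int \<lfloor>sqrt p / 3\<rfloor>" using s6 by (simp add: q_def)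
  have q_le: "real q \<le> sqrt p / 3" and q_ge: "sqrt p / 6 \<le> real q"
    unfolding qr using s6 by linarith+
  have q1: "1 \<le> q" using q_ge s6 by linarith
  have "(3 * real q)\<^sup>2 \<le> (sqrt p)\<^sup>2" using q_le by (intro power_mono) auto
  then have "real (9 * q\<^sup>2) \<le> real p" by (simp add: power_mult_distrib)
  then have q9: "9 * q\<^sup>2 \<le> p" by (simp only: of_nat_le_iff)
  have "2 * q * N \<le> p * (q + 2 * m) + (2 * q + h) * m + p"
    unfolding N_def by (rule stepanov_count[OF q1 q9 m3])
  then have "real (2 * q * N) \<le> real (p * (q + 2 * m) + (2 * q + h) * m + p)" by (simp only: of_nat_le_iff)
  then have 1: "real q * (2 * N) \<le> real q * (real p + 2 * m) + (2 * p * m + real h * m + real p)"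
    by (simp add: algebra_simps)
  have "real h \<le> real p / 2" using h_p by linarith
  then have "real h * m \<le> real p / 2 * m" by (intro mult_right_mono) auto
  moreover have "real p * 1 \<le> real p * m" using m_pos by (intro mult_left_mono) auto
  ultimately have 2: "2 * real p * m + real h * m + real p \<le> 7 / 2 * (real p * m)" by linarith
  have "real p * m = real m * sqrt p * sqrt p" by simp
  also have "\<dots> \<le> real m * sqrt p * (6 * real q)" using q_ge by (intro mult_left_mono) auto
  finally have "7 / 2 * (real p * m) \<le> real q * (21 * real m * sqrt p)" by (simp add: algebra_simps)
  with 1 2 have "real q * (2 * N) \<le> real q * (real p + 2 * m + 21 * real m * sqrt p)"
    by (simp add: algebra_simps)
  then show ?thesis using q1 unfolding N_def by (subst (asm) mult_le_cancel_left_pos) auto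
qed

text \<open>Upper bounds for the number of values 1 and of values -1 suffice: the two numbers add up
  to \<open>p\<close> minus at most \<open>m\<close>, so each upper bound is a lower bound for the
  other. The constant is 21 + 3. If \<open>p\<close> is below 36 or below \<open>3 * m\<close>, the
  trivial bound \<open>p\<close> is already good enough.\<close>

lemma Legendre_sum_bound:
  "\<bar>\<Sum>x\<in>{0..<int p}. real_of_int (Legendre (poly f x) p)\<bar> \<le> 24 * real m * sqrt p"
proof (cases "3 * m \<le> p \<and> 36 \<le> p")
  case False
  have s1: "1 \<le> sqrt p" using p2 by simp
  have "real p \<le> 24 * real m * sqrt p"
  proof (cases "p < 36")
    case True
    then have "sqrt p \<le> sqrt (6\<^sup>2)" by (intro real_sqrt_le_mono) simp
    then have "sqrt p \<le> 24 * real m" using m_pos by (simp del: real_sqrt_pow2_iff)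
    then have "sqrt p * sqrt p \<le> 24 * real m * sqrt p" by (intro mult_right_mono) auto
    then show ?thesis by simp
  next
    case False
    with \<open>\<not> (3 * m \<le> p \<and> 36 \<le> p)\<close> have "real p \<le> 24 * real m * 1" by linarith
    also have "\<dots> \<le> 24 * real m * sqrt p" using s1 by (intro mult_left_mono) auto
    finally show ?thesis .
  qed
  then show ?thesis using Legendre_sum_trivial[of "poly f"] by linarith
next
  case True
  let ?R = "{0..<int p}"
  let ?L = "\<lambda>x. Legendre (poly f x) p"
  define P M Z where "P = {x \<in> ?R. ?L x = 1}" and "M = {x \<in> ?R. ?L x = - 1}" and "Z = {x \<in> ?R. ?L x = 0}"
  have fin: "finite P" "finite M" "finite Z"
    unfolding P_def M_def Z_def by (rule finite_subset[of _ ?R]; auto)+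
  have RPMZ: "?R = P \<union> (M \<union> Z)" using Legendre_cases by (auto simp: P_def M_def Z_def)
  have disj: "P \<inter> (M \<union> Z) = {}" "M \<inter> Z = {}" by (auto simp: P_def M_def Z_def)
  have split: "sum g ?R = sum g P + (sum g M + sum g Z)" for g :: "int \<Rightarrow> real"
    unfolding RPMZ using fin disj by (simp add: sum.union_disjoint)
  have "(\<Sum>x\<in>?R. 1::real) = real (card P) + (real (card M) + real (card Z))"
    by (subst split) simp
  then have tot: "real p = real (card P) + real (card M) + real (card Z)" by simp
  have sm: "(\<Sum>x\<in>?R. real_of_int (?L x)) = real (card P) - real (card M)"
  proof -
    have "(\<Sum>x\<in>P. real_of_int (?L x)) = (\<Sum>x\<in>P. 1)" by (intro sum.cong) (auto simp: P_def)
    moreover have "(\<Sum>x\<in>M. real_of_int (?L x)) = (\<Sum>x\<in>M. - 1)" by (intro sum.cong) (auto simp: M_def)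
    moreover have "(\<Sum>x\<in>Z. real_of_int (?L x)) = (\<Sum>x\<in>Z. 0)" by (intro sum.cong) (auto simp: Z_def)
    ultimately show ?thesis by (subst split) simp
  qed
  have "Z \<subseteq> (\<lambda>b. b mod int p) ` B"
  proof
    fix x assume x: "x \<in> Z"
    then have "int p dvd (\<Prod>b\<in>B. x - b)" by (simp add: Z_def Legendre_eq_0_iff poly_f)
    then obtain b where b: "b \<in> B" "int p dvd x - b" using prime_dvd_prod_iff[OF finB pint] by blast
    then have "x mod int p = b mod int p" by (simp add: mod_eq_dvd_iff)
    then show "x \<in> (\<lambda>b. b mod int p) ` B" using b x by (auto simp: Z_def)
  qed
  then have "card Z \<le> card ((\<lambda>b. b mod int p) ` B)" using finB by (intro card_mono) auto
  also have "\<dots> \<le> m" using finB by (rule card_image_le)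
  finally have cZ: "card Z \<le> m" .
  have finN: "finite {x \<in> ?R. Q x}" for Q by (rule finite_subset[of _ ?R]) auto
  have euler: "[?L x = poly f x ^ h] (mod int p)" for x
    unfolding h_def by (rule euler_criterion[OF p p2])
  have "P \<subseteq> {x \<in> ?R. int p dvd poly f x ^ h - 1}" "M \<subseteq> {x \<in> ?R. int p dvd poly f x ^ h - (- 1)}"
    using euler by (auto simp: P_def M_def cong_iff_dvd_diff dvd_diff_commute)
       (metis cong_iff_dvd_diff cong_sym diff_minus_eq_add euler)+
  then have "card P \<le> card {x \<in> ?R. int p dvd poly f x ^ h - 1}" "card M \<le> card {x \<in> ?R. int p dvd poly f x ^ h - (- 1)}"
    by - (rule card_mono[OF finN], assumption)+
  then have "2 * real (card P) \<le> real p + 2 * real m + 21 * real m * sqrt p"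
    "2 * real (card M) \<le> real p + 2 * real m + 21 * real m * sqrt p"
    using stepanov_bound[of 1] stepanov_bound[of "- 1"] True by linarith+
  then have "\<bar>real (card P) - real (card M)\<bar> \<le> 3 * real m + 21 * real m * sqrt p"
    using tot cZ by linarith
  also have "3 * real m \<le> 3 * real m * sqrt p" using p2 by (simp add: mult_le_cancel_left1)
  finally show ?thesis unfolding sm by simp
qed

end

text \<open>A residue \<open>t\<close> outside \<open>B\<close> serves as new origin, so that no
  shifted root is divisible by \<open>p\<close>. If no such residue exists, \<open>B\<close> has
  \<open>p\<close> elements and the trivial bound applies.\<close>

theorem Legendre_product_sum_bound:
  fixes p :: nat and B :: "int set"
  assumes p: "prime p" "2 < p" and B: "finite B" "B \<noteq> {}" "B \<subseteq> {0..<int p}"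
  shows "\<bar>\<Sum>x\<in>{0..<int p}. real_of_int (Legendre (\<Prod>b\<in>B. x - b) p)\<bar> \<le> 24 * real (card B) * sqrt p"
proof (cases "B = {0..<int p}")
  case True
  have "\<bar>\<Sum>x\<in>{0..<int p}. real_of_int (Legendre (\<Prod>b\<in>B. x - b) p)\<bar> \<le> (\<Sum>x\<in>{0..<int p}. \<bar>real_of_int (Legendre (\<Prod>b\<in>B. x - b) p)\<bar>)"
    by (rule sum_abs)
  also have "\<dots> \<le> (\<Sum>x\<in>{0..<int p}. 1)"
  proof (rule sum_mono)
    show "\<bar>real_of_int (Legendre (\<Prod>b\<in>B. x - b) p)\<bar> \<le> 1" for x
      using Legendre_cases[of "\<Prod>b\<in>B. x - b" p] by auto
  qed
  also have "\<dots> = real p * 1" by simp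
  also have "\<dots> \<le> (24 * real (card B)) * sqrt p" using p True by (intro mult_mono) auto
  finally show ?thesis .
next
  case False
  then obtain t where t: "t \<in> {0..<int p}" "t \<notin> B" using B by blast
  have nd: "\<not> int p dvd y - x" if "x \<in> {0..<int p}" "y \<in> {0..<int p}" "x \<noteq> y" for x y
  proof -
    have "\<bar>y - x\<bar> < int p" using that by auto
    then show ?thesis using that(3) zdvd_not_zless[of "\<bar>y - x\<bar>" "int p"] by auto
  qed
  define B' where "B' = (\<lambda>b. b - t) ` B"
  have inj: "inj_on (\<lambda>b. b - t) B" by (auto intro: inj_onI)
  interpret distinct_roots_mod p B'
  proof
    show "\<not> int p dvd y - x" if "x \<in> B'" "y \<in> B'" "x \<noteq> y" for x y
    proof -
      from that obtain a b where "x = a - t" "y = b - t" "a \<in> B" "b \<in> B" by (auto simp: B'_def)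
      moreover have "a \<in> {0..<int p}" "b \<in> {0..<int p}" using calculation B(3) by blast+
      ultimately show ?thesis using nd[of a b] that(3) by auto
    qed
    show "\<not> int p dvd x" if "x \<in> B'" for x
    proof -
      from that obtain b where "x = b - t" "b \<in> B" by (auto simp: B'_def)
      moreover have "b \<in> {0..<int p}" "b \<noteq> t" using calculation B(3) t(2) by blast+
      ultimately show ?thesis using nd[OF t(1)] by auto
    qed
  qed (use p B in \<open>auto simp: B'_def\<close>)
  have per: "real_of_int (Legendre (\<Prod>b\<in>B. x mod int p - b) p) = real_of_int (Legendre (\<Prod>b\<in>B. x - b) p)" for x
    by (intro arg_cong[of _ _ real_of_int] Legendre_cong cong_prod cong_diff) auto
  have "(\<Sum>x\<in>{0..<int p}. real_of_int (Legendre (\<Prod>b\<in>B. x - b) p)) =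
      (\<Sum>x\<in>{0..<int p}. real_of_int (Legendre (\<Prod>b\<in>B. (x + t) - b) p))"
    using sum_residues_shift[of p "\<lambda>x. real_of_int (Legendre (\<Prod>b\<in>B. x - b) p)", OF _ per, of t] p2 by simp
  also have "\<dots> = (\<Sum>x\<in>{0..<int p}. real_of_int (Legendre (poly f x) p))"
  proof -
    have "poly f x = (\<Prod>b\<in>B. (x + t) - b)" for x
      unfolding poly_f by (simp add: B'_def prod.reindex[OF inj] algebra_simps)
    then show ?thesis by simp
  qed
  finally show ?thesis using Legendre_sum_bound inj by (simp add: B'_def card_image)
qed

section \<open>Gauss sums and Fekete polynomials\<close>

lemma e_mod_add: "e_mod p (x + y) = e_mod p x * e_mod p y"
  by (simp add: e_mod_def exp_add[symmetric] algebra_simps add_divide_distrib)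

lemma e_mod_power: "e_mod p x ^ n = e_mod p (real n * x)"
  by (simp add: e_mod_def exp_of_nat_mult[symmetric] algebra_simps)

lemma e_mod_multiple:
  assumes "0 < p"
  shows "e_mod p (real_of_int (int p * k)) = 1"
proof -
  have "2 * of_real pi * \<i> * of_real (real_of_int (int p * k)) / of_nat p = of_real (2 * of_int k * pi) * \<i>"
    using assms by (simp add: field_simps)
  then show ?thesis unfolding e_mod_def
    using exp_integer_2pi[OF Ints_of_int, of k] by (simp only:)
qed

lemma e_mod_mod:
  assumes "0 < p"
  shows "e_mod p (real_of_int (x mod int p)) = e_mod p (real_of_int x)"
proof -
  have "real_of_int x = real_of_int (x mod int p) + real_of_int (int p * (x div int p))"
    by (metis of_int_add mod_mult_div_eq)
  then show ?thesis using e_mod_multiple[OF assms] by (simp add: e_mod_add)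
qed

lemma cnj_e_mod: "cnj (e_mod p x) = e_mod p (- x)"
  by (simp add: e_mod_def exp_cnj)

lemma e_mod_eq_1_iff:
  assumes "0 < p"
  shows "e_mod p (real_of_int x) = 1 \<longleftrightarrow> int p dvd x"
proof
  assume "e_mod p (real_of_int x) = 1"
  then have "exp (\<i> * of_real (2 * pi * x / p)) = 1" by (simp add: e_mod_def algebra_simps)
  then obtain n :: int where "2 * pi * x / p = of_int (2 * n) * pi"
    by (auto simp: exp_eq_1)
  then have "real_of_int x = real_of_int (n * int p)" using assms by (simp add: field_simps)
  then show "int p dvd x" by (metis dvd_triv_right of_int_eq_iff)
next
  assume "int p dvd x"
  then obtain k where "x = int p * k" by (elim dvdE)
  then show "e_mod p (real_of_int x) = 1" using e_mod_multiple[OF assms] by simp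
qed

lemma e_mod_orthogonality:
  assumes "0 < p"
  shows "(\<Sum>n\<in>{0..<int p}. e_mod p (real_of_int (n * x))) = (if int p dvd x then of_nat p else 0)"
proof -
  define w where "w = e_mod p (real_of_int x)"
  have "(\<Sum>n\<in>{0..<int p}. e_mod p (real_of_int (n * x))) = (\<Sum>n<p. w ^ n)"
    by (simp add: sum_int_residues w_def e_mod_power)
  also have "\<dots> = (if int p dvd x then of_nat p else 0)"
  proof (cases "int p dvd x")
    case True
    then have "w = 1" using e_mod_eq_1_iff[OF assms] by (simp add: w_def)
    then show ?thesis using True by simp
  next
    case False
    then have "w \<noteq> 1" using e_mod_eq_1_iff[OF assms] by (simp add: w_def)
    moreover have "w ^ p = 1" using e_mod_multiple[OF assms, of x] by (simp add: w_def e_mod_power)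
    ultimately show ?thesis using False by (simp add: geometric_sum)
  qed
  finally show ?thesis .
qed

section \<open>Quadratic Gauss sums\<close>

definition gauss_sum :: "nat \<Rightarrow> complex" where
  "gauss_sum p = (\<Sum>a\<in>{0..<int p}. of_int (Legendre a p) * e_mod p (real_of_int a))"

lemma gauss_sum_twisted:
  assumes p: "prime p" "2 < p"
  shows "(\<Sum>a\<in>{0..<int p}. of_int (Legendre a p) * e_mod p (real_of_int (a * n))) = of_int (Legendre n p) * gauss_sum p"
proof (cases "int p dvd n")
  case True
  have "e_mod p (real_of_int (a * n)) = 1" for a
    using True p by (subst e_mod_eq_1_iff) auto
  then have "(\<Sum>a\<in>{0..<int p}. of_int (Legendre a p) * e_mod p (real_of_int (a * n))) =
      of_int (\<Sum>a\<in>{0..<int p}. Legendre a p)" by simp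
  then show ?thesis using True Legendre_sum_eq_0[OF p] by (simp add: Legendre_eq_0_iff)
next
  case False
  define S where "S = (\<Sum>a\<in>{0..<int p}. of_int (Legendre a p) * e_mod p (real_of_int (a * n)))"
  have per: "of_int (Legendre (x mod int p) p) * e_mod p (real_of_int (x mod int p)) = of_int (Legendre x p) * e_mod p (real_of_int x)" for x
    using p Legendre_cong[of "x mod int p" x "int p"] by (simp add: e_mod_mod)
  have "of_int (Legendre n p) * S = (\<Sum>a\<in>{0..<int p}. of_int (Legendre (a * n) p) * e_mod p (real_of_int (a * n)))"
    by (simp add: S_def Legendre_mult[OF p] sum_distrib_left mult_ac)
  also have "\<dots> = gauss_sum p"
    unfolding gauss_sum_def
    by (rule sum_residues_scale[of p "\<lambda>x. of_int (Legendre x p) * e_mod p (real_of_int x)", OF p(1) per False])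
  finally have "of_int (Legendre n p) * (of_int (Legendre n p) * S) = of_int (Legendre n p) * gauss_sum p" by simp
  moreover have "of_int (Legendre n p) * of_int (Legendre n p) = (1 :: complex)"
    using False Legendre_cases[of n p] Legendre_eq_0_iff[of n p] by auto
  ultimately show ?thesis unfolding S_def by (metis mult.assoc mult_1)
qed

text \<open>The squared moduli of all twisted sums are added in two ways: each unit \<open>n\<close>
  contributes the squared modulus of the Gauss sum, and orthogonality of the additive characters
  evaluates the same total as p (p - 1).\<close>

lemma cmod_gauss_sum:
  assumes p: "prime p" "2 < p"
  shows "cmod (gauss_sum p) = sqrt p"
proof -
  let ?R = "{0..<int p}"
  let ?\<chi> = "\<lambda>a. of_int (Legendre a p) :: complex"
  have sq: "(\<Sum>a\<in>?R. ?\<chi> a * ?\<chi> a) = of_nat (p - 1)"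
  proof -
    have "(\<Sum>a\<in>?R. ?\<chi> a * ?\<chi> a) = (\<Sum>a\<in>?R. if a = 0 then 0 else 1)"
    proof (rule sum.cong[OF refl])
      fix a assume a: "a \<in> ?R"
      then have "int p dvd a \<longleftrightarrow> a = 0" using zdvd_not_zless[of a "int p"] by (cases "a = 0") auto
      then show "?\<chi> a * ?\<chi> a = (if a = 0 then 0 else 1)"
        using Legendre_cases[of a p] Legendre_eq_0_iff[of a p] by auto
    qed
    also have "\<dots> = (\<Sum>a\<in>?R - {0}. 1)" by (rule sum.mono_neutral_cong_right) auto
    also have "\<dots> = of_nat (p - 1)" using p by (simp add: of_nat_diff)
    finally show ?thesis .
  qed
  have "(\<Sum>n\<in>?R. (?\<chi> n * gauss_sum p) * cnj (?\<chi> n * gauss_sum p)) = of_nat (p - 1) * (gauss_sum p * cnj (gauss_sum p))"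
    unfolding sq[symmetric] by (simp add: sum_distrib_right sum_distrib_left mult_ac)
  moreover have "(\<Sum>n\<in>?R. (?\<chi> n * gauss_sum p) * cnj (?\<chi> n * gauss_sum p)) = of_nat (p - 1) * of_nat p"
  proof -
    have "(\<Sum>n\<in>?R. (?\<chi> n * gauss_sum p) * cnj (?\<chi> n * gauss_sum p)) =
        (\<Sum>n\<in>?R. (\<Sum>a\<in>?R. ?\<chi> a * e_mod p (real_of_int (a * n))) * (\<Sum>b\<in>?R. ?\<chi> b * e_mod p (- real_of_int (b * n))))"
      unfolding gauss_sum_twisted[OF p, symmetric] by (simp add: cnj_e_mod)
    also have "\<dots> = (\<Sum>n\<in>?R. \<Sum>a\<in>?R. \<Sum>b\<in>?R. ?\<chi> a * ?\<chi> b * e_mod p (real_of_int (n * (a - b))))"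
    proof (rule sum.cong[OF refl])
      fix n
      have "e_mod p (real_of_int (n * (a - b))) = e_mod p (real_of_int (a * n)) * e_mod p (- real_of_int (b * n))" for a b
        unfolding e_mod_add[symmetric] by (simp add: algebra_simps)
      then show "(\<Sum>a\<in>?R. ?\<chi> a * e_mod p (real_of_int (a * n))) * (\<Sum>b\<in>?R. ?\<chi> b * e_mod p (- real_of_int (b * n))) =
          (\<Sum>a\<in>?R. \<Sum>b\<in>?R. ?\<chi> a * ?\<chi> b * e_mod p (real_of_int (n * (a - b))))"
        by (simp add: sum_product mult_ac del: of_int_mult)
    qed
    also have "\<dots> = (\<Sum>a\<in>?R. \<Sum>n\<in>?R. \<Sum>b\<in>?R. ?\<chi> a * ?\<chi> b * e_mod p (real_of_int (n * (a - b))))"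
      by (rule sum.swap)
    also have "\<dots> = (\<Sum>a\<in>?R. \<Sum>b\<in>?R. \<Sum>n\<in>?R. ?\<chi> a * ?\<chi> b * e_mod p (real_of_int (n * (a - b))))"
      by (intro sum.cong[OF refl] sum.swap)
    also have "\<dots> = (\<Sum>a\<in>?R. \<Sum>b\<in>?R. if b = a then ?\<chi> a * ?\<chi> b * of_nat p else 0)"
    proof (intro sum.cong[OF refl])
      fix a b assume ab: "a \<in> ?R" "b \<in> ?R"
      then have "\<bar>a - b\<bar> < int p" by auto
      then have "int p dvd a - b \<longleftrightarrow> b = a"
        using zdvd_not_zless[of "\<bar>a - b\<bar>" "int p"] by auto
      then show "(\<Sum>n\<in>?R. ?\<chi> a * ?\<chi> b * e_mod p (real_of_int (n * (a - b)))) = (if b = a then ?\<chi> a * ?\<chi> b * of_nat p else 0)"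
        using e_mod_orthogonality[of p "a - b"] p by (simp add: sum_distrib_left[symmetric] del: of_int_mult of_int_diff)
    qed
    also have "\<dots> = (\<Sum>a\<in>?R. ?\<chi> a * ?\<chi> a * of_nat p)" by (intro sum.cong[OF refl]) simp
    also have "\<dots> = of_nat (p - 1) * of_nat p" unfolding sum_distrib_right[symmetric] sq ..
    finally show ?thesis .
  qed
  ultimately have "gauss_sum p * cnj (gauss_sum p) = of_nat p" using p by simp
  then have "complex_of_real ((cmod (gauss_sum p))\<^sup>2) = complex_of_real (real p)"
    by (simp add: complex_norm_square del: of_real_power)
  then have "(cmod (gauss_sum p))\<^sup>2 = real p" by (simp only: of_real_eq_iff)
  then show ?thesis by (metis norm_ge_zero real_sqrt_unique)
qed

text \<open>A geometric sum of \<open>p\<close> terms whose ratio w satisfies w^p = -1 equals 2 / (1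
  - w). Its half-angle form is the source of the cotangent weights.\<close>

lemma two_over_one_minus_cis:
  assumes "sin t \<noteq> 0"
  shows "2 / (1 - exp (\<i> * of_real (2 * t))) = 1 + \<i> * of_real (cot t)"
proof -
  have e: "exp (\<i> * of_real (2 * t)) = Complex (cos (2 * t)) (sin (2 * t))"
    by (simp only: cis_conv_exp[symmetric]) (simp add: complex_eq_iff)
  have d: "1 - exp (\<i> * of_real (2 * t)) = 2 * of_real (sin t) * Complex (sin t) (- cos t)"
    unfolding e by (simp add: complex_eq_iff cos_double_sin sin_double power2_eq_square)
  have "(1 + \<i> * of_real (cot t)) * of_real (sin t) = Complex (sin t) (cos t)"
    using assms by (simp add: complex_eq_iff cot_def)
  then have "(1 + \<i> * of_real (cot t)) * (1 - exp (\<i> * of_real (2 * t))) = 2 * (Complex (sin t) (cos t) * Complex (sin t) (- cos t))"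
    unfolding d by (metis (no_types, lifting) mult.assoc mult.commute mult.left_commute)
  also have "Complex (sin t) (cos t) * Complex (sin t) (- cos t) = 1"
    by (simp add: complex_eq_iff sin_squared_eq[symmetric] flip: power2_eq_square)
  finally have m: "(1 + \<i> * of_real (cot t)) * (1 - exp (\<i> * of_real (2 * t))) = 2" by simp
  then have "1 - exp (\<i> * of_real (2 * t)) \<noteq> 0" by auto
  then show ?thesis using m by (metis nonzero_divide_eq_eq)
qed

definition cot_weight :: "nat \<Rightarrow> nat \<Rightarrow> real" where
  "cot_weight p b = cot (pi * (real b + 1 / 2) / real p) / real p"

theorem fekete_half_point:
  assumes p: "prime p" "2 < p"
  shows "1 / sqrt (real p) * cmod (fekete p (e_mod p (real K + 1 / 2))) =
     \<bar>\<Sum>b<p. cot_weight p b * real_of_int (Legendre (int b - int K) p)\<bar>"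
proof -
  let ?R = "{0..<int p}"
  let ?\<chi> = "\<lambda>a. of_int (Legendre a p) :: complex"
  define C where "C = (\<lambda>x::int. cot (pi * (real_of_int x + 1 / 2) / real p))"
  have p0: "0 < p" using p by simp
  have geo: "(\<Sum>n\<in>?R. e_mod p (real_of_int n * (real_of_int x + 1 / 2))) = 1 + \<i> * of_real (C x)" for x
  proof -
    define w where "w = e_mod p (real_of_int x + 1 / 2)"
    define t where "t = pi * (real_of_int x + 1 / 2) / real p"
    have w: "w = exp (\<i> * of_real (2 * t))" by (simp add: w_def t_def e_mod_def algebra_simps)
    \<comment> \<open>The shift by one half gives w^p = -1, so w is never 1 and the cotangent has no
      pole at any of the points.\<close>
    have "w ^ p = e_mod p (real_of_int (int p * x)) * e_mod p (real p / 2)"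
      unfolding w_def e_mod_power e_mod_add[symmetric] by (simp add: algebra_simps)
    also have "\<dots> = - 1" using e_mod_multiple[OF p0, of x] p0 by (simp add: e_mod_def)
    finally have wp: "w ^ p = - 1" .
    then have w1: "w \<noteq> 1" by auto
    have st: "sin t \<noteq> 0"
    proof
      assume "sin t = 0"
      then have "exp (\<i> * of_real (2 * t)) = 1"
        by (simp add: cis_conv_exp[symmetric] complex_eq_iff cos_double_sin sin_double del: of_real_mult)
      with w1 w show False by simp
    qed
    have "(\<Sum>n\<in>?R. e_mod p (real_of_int n * (real_of_int x + 1 / 2))) = (\<Sum>n<p. w ^ n)"
      by (simp add: sum_int_residues w_def e_mod_power)
    also have "\<dots> = 2 / (1 - w)" using w1 wp by (simp add: geometric_sum field_simps)
    also have "\<dots> = 1 + \<i> * of_real (cot t)" unfolding w by (rule two_over_one_minus_cis[OF st])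
    finally show ?thesis by (simp add: C_def t_def)
  qed
  have "fekete p (e_mod p (real K + 1 / 2)) = (\<Sum>n\<in>?R. ?\<chi> n * e_mod p (real_of_int n * (real K + 1 / 2)))"
  proof -
    have "{0..p - 1} = {..<p}" using p0 by auto
    then show ?thesis by (simp add: fekete_def sum_int_residues e_mod_power)
  qed
  then have "gauss_sum p * fekete p (e_mod p (real K + 1 / 2)) =
      (\<Sum>n\<in>?R. (?\<chi> n * gauss_sum p) * e_mod p (real_of_int n * (real K + 1 / 2)))"
    by (simp add: sum_distrib_left mult_ac)
  also have "\<dots> = (\<Sum>n\<in>?R. \<Sum>a\<in>?R. ?\<chi> a * (e_mod p (real_of_int (a * n)) * e_mod p (real_of_int n * (real K + 1 / 2))))"
    unfolding gauss_sum_twisted[OF p, symmetric] sum_distrib_right by (simp only: mult.assoc)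
  also have "\<dots> = (\<Sum>n\<in>?R. \<Sum>a\<in>?R. ?\<chi> a * e_mod p (real_of_int n * (real_of_int (a + int K) + 1 / 2)))"
    unfolding e_mod_add[symmetric] by (simp add: algebra_simps)
  also have "\<dots> = (\<Sum>a\<in>?R. \<Sum>n\<in>?R. ?\<chi> a * e_mod p (real_of_int n * (real_of_int (a + int K) + 1 / 2)))"
    by (rule sum.swap)
  also have "\<dots> = (\<Sum>a\<in>?R. ?\<chi> a * (1 + \<i> * of_real (C (a + int K))))"
    unfolding sum_distrib_left[symmetric] geo ..
  also have "\<dots> = of_int (\<Sum>a\<in>?R. Legendre a p) + \<i> * of_real (\<Sum>a\<in>?R. real_of_int (Legendre a p) * C (a + int K))"
    by (simp add: distrib_left sum.distrib sum_distrib_left mult_ac)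
  \<comment> \<open>The real part 1 of the geometric sum is annihilated because the Legendre symbols
    add up to 0. What is left is purely imaginary, so the modulus becomes the absolute value of a
    real sum of signs.\<close>
  also have "\<dots> = \<i> * of_real (\<Sum>a\<in>?R. real_of_int (Legendre a p) * C (a + int K))"
    using Legendre_sum_eq_0[OF p] by simp
  finally have "cmod (gauss_sum p * fekete p (e_mod p (real K + 1 / 2))) = \<bar>\<Sum>a\<in>?R. real_of_int (Legendre a p) * C (a + int K)\<bar>"
    by (simp only: norm_mult norm_ii norm_of_real mult_1)
  then have eq: "sqrt p * cmod (fekete p (e_mod p (real K + 1 / 2))) = \<bar>\<Sum>a\<in>?R. real_of_int (Legendre a p) * C (a + int K)\<bar>"
    by (simp add: norm_mult cmod_gauss_sum[OF p])
  have Cmod: "C (x mod int p) = C x" for x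
  proof -
    define y k where "y = x mod int p" and "k = x div int p"
    have "x = y + int p * k" by (simp add: y_def k_def)
    then have "pi * (real_of_int x + 1 / 2) / real p = pi * (real_of_int y + 1 / 2) / real p + of_int k * pi"
      using p0 by (simp add: field_simps)
    then have "C x = cot (pi * (real_of_int y + 1 / 2) / real p + of_int k * pi)" by (simp add: C_def)
    also have "\<dots> = C y"
      unfolding C_def cot_altdef by (metis tan_periodic_int)
    finally show ?thesis by (simp add: y_def)
  qed
  have per: "real_of_int (Legendre (x mod int p - int K) p) * C (x mod int p) = real_of_int (Legendre (x - int K) p) * C x" for x
    using Cmod Legendre_cong[of "x mod int p - int K" "x - int K" "int p"] by (simp add: cong_diff)
  have "(\<Sum>a\<in>?R. real_of_int (Legendre a p) * C (a + int K)) = (\<Sum>a\<in>?R. real_of_int (Legendre (a - int K) p) * C a)"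
    using sum_residues_shift[of p "\<lambda>x. real_of_int (Legendre (x - int K) p) * C x", OF p0 per, of "int K"] by simp
  also have "\<dots> = real p * (\<Sum>b<p. cot_weight p b * real_of_int (Legendre (int b - int K) p))"
    using p0 by (simp add: sum_int_residues sum_distrib_left C_def cot_weight_def mult_ac)
  finally have "sqrt p * cmod (fekete p (e_mod p (real K + 1 / 2))) =
      real p * \<bar>\<Sum>b<p. cot_weight p b * real_of_int (Legendre (int b - int K) p)\<bar>"
    using eq by (simp add: abs_mult)
  also have "real p = sqrt p * sqrt p" by simp
  finally have "cmod (fekete p (e_mod p (real K + 1 / 2))) = sqrt p * \<bar>\<Sum>b<p. cot_weight p b * real_of_int (Legendre (int b - int K) p)\<bar>"
    using p0 by (simp only: mult.assoc mult_cancel_left) simp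
  then show ?thesis using p0 by simp
qed

section \<open>Comparison of moments with random signs\<close>

definition sign_vectors :: "nat \<Rightarrow> (nat \<Rightarrow> real) set" where
  "sign_vectors p = PiE {..<p} (\<lambda>_. {- 1, 1})"

lemma sum_sign_vectors_prod:
  "(\<Sum>\<epsilon>\<in>sign_vectors p. \<Prod>b<p. g b (\<epsilon> b)) = (\<Prod>b<p. g b (- 1) + g b (1::real) :: real)"
proof -
  have "(\<Prod>b<p. \<Sum>e\<in>{- 1, 1}. g b e) = (\<Sum>\<epsilon>\<in>sign_vectors p. \<Prod>b<p. g b (\<epsilon> b))"
    unfolding sign_vectors_def by (rule prod_sum_PiE) auto
  then show ?thesis by simp
qed

lemma sum_power_PiE:
  fixes u :: "nat \<Rightarrow> real"
  shows "(\<Sum>b<p. u b) ^ m = (\<Sum>\<beta>\<in>PiE {..<m} (\<lambda>_. {..<p}). \<Prod>i<m. u (\<beta> i))"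
proof -
  have "(\<Prod>i<m. \<Sum>b<p. u b) = (\<Sum>\<beta>\<in>PiE {..<m} (\<lambda>_. {..<p}). \<Prod>i<m. u (\<beta> i))"
    by (rule prod_sum_PiE) auto
  then show ?thesis by simp
qed

text \<open>\<open>S\<close> consists of the indices hit an odd number of times; pairs cancel
  because squares are 1. It is chosen before \<open>u\<close>, since the same set has to serve the
  Legendre symbols for every shift and all sign vectors.\<close>

lemma odd_multiplicity_set:
  fixes \<beta> :: "nat \<Rightarrow> 'b"
  shows "\<exists>S \<subseteq> \<beta> ` {..<m}. card S \<le> m \<and>
    (\<forall>u :: 'b \<Rightarrow> real. (\<forall>i<m. u (\<beta> i) * u (\<beta> i) = 1) \<longrightarrow> (\<Prod>i<m. u (\<beta> i)) = (\<Prod>b\<in>S. u b))"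
proof (induction m)
  case 0
  then show ?case by simp
next
  case (Suc m)
  then obtain S where S: "S \<subseteq> \<beta> ` {..<m}" "card S \<le> m"
    "\<And>u :: 'b \<Rightarrow> real. (\<forall>i<m. u (\<beta> i) * u (\<beta> i) = 1) \<Longrightarrow> (\<Prod>i<m. u (\<beta> i)) = (\<Prod>b\<in>S. u b)"
    by blast
  have fin: "finite S" using S(1) finite_surj by blast
  show ?case
  proof (cases "\<beta> m \<in> S")
    case True
    show ?thesis
    proof (intro exI[of _ "S - {\<beta> m}"] conjI allI impI)
      show "S - {\<beta> m} \<subseteq> \<beta> ` {..<Suc m}" using S(1) by (auto simp: lessThan_Suc)
      show "card (S - {\<beta> m}) \<le> Suc m" using S(2) by (meson card_Diff1_le le_SucI le_trans)
      fix u :: "'b \<Rightarrow> real" assume u: "\<forall>i<Suc m. u (\<beta> i) * u (\<beta> i) = 1"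
      have "(\<Prod>i<Suc m. u (\<beta> i)) = (\<Prod>b\<in>S. u b) * u (\<beta> m)" using S(3) u by simp
      also have "(\<Prod>b\<in>S. u b) = u (\<beta> m) * (\<Prod>b\<in>S - {\<beta> m}. u b)" using fin True by (rule prod.remove)
      also have "u (\<beta> m) * (\<Prod>b\<in>S - {\<beta> m}. u b) * u (\<beta> m) = (u (\<beta> m) * u (\<beta> m)) * (\<Prod>b\<in>S - {\<beta> m}. u b)"
        by (simp only: mult_ac)
      also have "u (\<beta> m) * u (\<beta> m) = 1" using u by simp
      finally show "(\<Prod>i<Suc m. u (\<beta> i)) = (\<Prod>b\<in>S - {\<beta> m}. u b)" by simp
    qed
  next
    case False
    show ?thesis
    proof (intro exI[of _ "insert (\<beta> m) S"] conjI allI impI)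
      show "insert (\<beta> m) S \<subseteq> \<beta> ` {..<Suc m}" using S(1) by (auto simp: lessThan_Suc)
      show "card (insert (\<beta> m) S) \<le> Suc m" using S(2) fin False by simp
      fix u :: "'b \<Rightarrow> real" assume u: "\<forall>i<Suc m. u (\<beta> i) * u (\<beta> i) = 1"
      show "(\<Prod>i<Suc m. u (\<beta> i)) = (\<Prod>b\<in>insert (\<beta> m) S. u b)"
        using S(3)[of u] u fin False by simp
    qed
  qed
qed

lemma sign_vectors_average_prod:
  assumes S: "S \<subseteq> {..<p}"
  shows "(\<Sum>\<epsilon>\<in>sign_vectors p. \<Prod>b\<in>S. \<epsilon> b) / 2 ^ p = (if S = {} then 1 else 0)"
proof -
  have "(\<Prod>b\<in>S. \<epsilon> b) = (\<Prod>b<p. if b \<in> S then \<epsilon> b else 1)" for \<epsilon> :: "nat \<Rightarrow> real"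
    using S by (simp add: prod.If_cases Int_absorb1)
  then have "(\<Sum>\<epsilon>\<in>sign_vectors p. \<Prod>b\<in>S. \<epsilon> b) = (\<Prod>b<p. (if b \<in> S then - 1 else 1) + (if b \<in> S then 1 else (1::real)))"
    using sum_sign_vectors_prod[of "\<lambda>b e. if b \<in> S then e else 1" p] by simp
  also have "\<dots> = (\<Prod>b<p. if b \<in> S then 0 else 2)" by (intro prod.cong) auto
  also have "\<dots> = (if S = {} then 2 ^ p else 0)" using S by (auto intro: prod_zero)
  finally show ?thesis by simp
qed

section \<open>Averages over the shift K\<close>

context
  fixes p :: nat
  assumes p: "prime p" "2 < p"
begin

definition leg :: "nat \<Rightarrow> nat \<Rightarrow> real" where
  "leg K b = real_of_int (Legendre (int b - int K) p)"

lemma abs_leg_le: "\<bar>leg K b\<bar> \<le> 1"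
  using Legendre_cases[of "int b - int K" p] by (auto simp: leg_def)

lemma leg_square: "K < p \<Longrightarrow> b < p \<Longrightarrow> K \<noteq> b \<Longrightarrow> leg K b * leg K b = 1"
proof -
  assume h: "K < p" "b < p" "K \<noteq> b"
  then have "\<bar>int b - int K\<bar> < int p" by auto
  then have "\<not> int p dvd int b - int K" using h zdvd_not_zless[of "\<bar>int b - int K\<bar>" "int p"] by auto
  then show ?thesis using Legendre_cases[of "int b - int K" p] Legendre_eq_0_iff[of "int b - int K" p]
    by (auto simp: leg_def)
qed

lemma abs_prod_leg_le: "\<bar>\<Prod>b\<in>S. leg K (g b)\<bar> \<le> 1"
  unfolding abs_prod by (intro prod_le_1) (simp add: abs_leg_le)

lemma leg_average_prod:
  assumes S: "S \<subseteq> {..<p}" "S \<noteq> {}"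
  shows "\<bar>(\<Sum>K<p. \<Prod>b\<in>S. leg K b) / p\<bar> \<le> 24 * real (card S) / sqrt p"
proof -
  have fin: "finite S" using S finite_subset by blast
  have e: "(\<Prod>b\<in>S. leg K b) = real_of_int (Legendre ((- 1) ^ card S) p) * real_of_int (Legendre (\<Prod>b\<in>int ` S. int K - b) p)" for K
  proof -
    have "(\<Prod>b\<in>S. int b - int K) = (- 1) ^ card S * (\<Prod>b\<in>S. int K - int b)"
      by (simp flip: prod_constant prod.distrib)
    moreover have "(\<Prod>b\<in>S. int K - int b) = (\<Prod>b\<in>int ` S. int K - b)"
      by (simp add: prod.reindex)
    ultimately show ?thesis
      by (simp add: leg_def flip: of_int_prod of_int_mult Legendre_prod[OF p] Legendre_mult[OF p])
  qed
  have "(\<Sum>K<p. \<Prod>b\<in>S. leg K b) = real_of_int (Legendre ((- 1) ^ card S) p) * (\<Sum>x\<in>{0..<int p}. real_of_int (Legendre (\<Prod>b\<in>int ` S. x - b) p))"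
    unfolding e sum_int_residues by (simp add: sum_distrib_left)
  then have "\<bar>\<Sum>K<p. \<Prod>b\<in>S. leg K b\<bar> = \<bar>real_of_int (Legendre ((- 1) ^ card S) p)\<bar> * \<bar>\<Sum>x\<in>{0..<int p}. real_of_int (Legendre (\<Prod>b\<in>int ` S. x - b) p)\<bar>"
    by (simp add: abs_mult)
  also have "\<dots> \<le> 1 * (24 * real (card (int ` S)) * sqrt p)"
    using S fin Legendre_cases[of "(- 1) ^ card S" p]
    by (intro mult_mono Legendre_product_sum_bound[OF p]) auto
  finally have "\<bar>\<Sum>K<p. \<Prod>b\<in>S. leg K b\<bar> \<le> 24 * real (card S) * sqrt p"
    by (simp add: card_image)
  then have "\<bar>\<Sum>K<p. \<Prod>b\<in>S. leg K b\<bar> / p \<le> 24 * real (card S) * sqrt p / p" by (intro divide_right_mono) auto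
  also have "24 * real (card S) * sqrt p / p = 24 * real (card S) / sqrt p"
    using p by (simp add: field_simps)
  finally show ?thesis by simp
qed

text \<open>Both averages reduce to the product over the odd multiplicity set. For Legendre symbols
  the cancellation of squares fails only if \<open>K\<close> is one of the at most \<open>m\<close>
  indices, where the symbol is 0; this adds \<open>m / p\<close>. A nonempty set contributes 0 for
  signs and at most 24 m / sqrt p for the symbols, an empty one 1 on both sides; whence 25.\<close>

lemma average_prod_comparison:
  assumes \<beta>: "\<And>i. i < m \<Longrightarrow> \<beta> i < p"
  shows "\<bar>(\<Sum>K<p. \<Prod>i<m. leg K (\<beta> i)) / p - (\<Sum>\<epsilon>\<in>sign_vectors p. \<Prod>i<m. \<epsilon> (\<beta> i)) / 2 ^ p\<bar> \<le> 25 * real m / sqrt p"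
proof -
  obtain S where S: "S \<subseteq> \<beta> ` {..<m}" "card S \<le> m"
    "\<And>u :: nat \<Rightarrow> real. (\<forall>i<m. u (\<beta> i) * u (\<beta> i) = 1) \<Longrightarrow> (\<Prod>i<m. u (\<beta> i)) = (\<Prod>b\<in>S. u b)"
    using odd_multiplicity_set[of \<beta> m] by blast
  have Sp: "S \<subseteq> {..<p}" using S(1) \<beta> by auto
  have "(\<Sum>\<epsilon>\<in>sign_vectors p. \<Prod>i<m. \<epsilon> (\<beta> i)) = (\<Sum>\<epsilon>\<in>sign_vectors p. \<Prod>b\<in>S. \<epsilon> b)"
  proof (rule sum.cong[OF refl])
    fix \<epsilon> assume e: "\<epsilon> \<in> sign_vectors p"
    have "\<epsilon> b * \<epsilon> b = 1" if "b < p" for b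
      using PiE_mem[OF e[unfolded sign_vectors_def], of b] that by auto
    then show "(\<Prod>i<m. \<epsilon> (\<beta> i)) = (\<Prod>b\<in>S. \<epsilon> b)" using \<beta> by (intro S(3)) auto
  qed
  then have avg: "(\<Sum>\<epsilon>\<in>sign_vectors p. \<Prod>i<m. \<epsilon> (\<beta> i)) / 2 ^ p = (if S = {} then 1 else 0)"
    using sign_vectors_average_prod[OF Sp] by simp
  let ?T = "\<beta> ` {..<m}"
  have T: "?T \<subseteq> {..<p}" using \<beta> by auto
  have "\<bar>(\<Sum>K<p. \<Prod>i<m. leg K (\<beta> i)) - (\<Sum>K<p. \<Prod>b\<in>S. leg K b)\<bar> \<le> (\<Sum>K<p. \<bar>(\<Prod>i<m. leg K (\<beta> i)) - (\<Prod>b\<in>S. leg K b)\<bar>)"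
    unfolding sum_subtractf[symmetric] by (rule sum_abs)
  also have "\<dots> \<le> (\<Sum>K<p. if K \<in> ?T then 1 else 0)"
  proof (rule sum_mono)
    fix K assume K: "K \<in> {..<p}"
    show "\<bar>(\<Prod>i<m. leg K (\<beta> i)) - (\<Prod>b\<in>S. leg K b)\<bar> \<le> (if K \<in> ?T then 1 else 0)"
    proof (cases "K \<in> ?T")
      case True
      then obtain i where i: "i < m" "K = \<beta> i" by auto
      then have "leg K (\<beta> i) = 0" by (simp add: leg_def Legendre_eq_0_iff)
      then have z: "(\<Prod>i<m. leg K (\<beta> i)) = 0" using i by (intro prod_zero) auto
      show ?thesis using True abs_prod_leg_le[of K "\<lambda>b. b" S] unfolding z by simp
    next
      case False
      then have "leg K (\<beta> i) * leg K (\<beta> i) = 1" if "i < m" for i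
        using K \<beta> that by (intro leg_square) auto
      then have "(\<Prod>i<m. leg K (\<beta> i)) = (\<Prod>b\<in>S. leg K b)" by (intro S(3)) auto
      then show ?thesis using False by simp
    qed
  qed
  also have "\<dots> = real (card ?T)"
    using T by (simp add: sum.If_cases Int_absorb1)
  also have "card ?T \<le> m" using card_image_le[of "{..<m}" \<beta>] by simp
  finally have "\<bar>(\<Sum>K<p. \<Prod>i<m. leg K (\<beta> i)) - (\<Sum>K<p. \<Prod>b\<in>S. leg K b)\<bar> / p \<le> real m / p"
    by (intro divide_right_mono) auto
  also have "real m / p \<le> real m / sqrt p"
    using p by (intro divide_left_mono) (auto simp: sqrt_le_D real_le_lsqrt power2_eq_square)
  finally have d: "\<bar>(\<Sum>K<p. \<Prod>i<m. leg K (\<beta> i)) / p - (\<Sum>K<p. \<Prod>b\<in>S. leg K b) / p\<bar> \<le> real m / sqrt p"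
    by (simp add: diff_divide_distrib[symmetric])
  have "\<bar>(\<Sum>K<p. \<Prod>b\<in>S. leg K b) / p - (if S = {} then 1 else 0)\<bar> \<le> 24 * real m / sqrt p"
  proof (cases "S = {}")
    case True
    then show ?thesis using p by simp
  next
    case False
    have "\<bar>(\<Sum>K<p. \<Prod>b\<in>S. leg K b) / p\<bar> \<le> 24 * real (card S) / sqrt p"
      by (rule leg_average_prod[OF Sp False])
    also have "\<dots> \<le> 24 * real m / sqrt p" using S(2) by (intro divide_right_mono) auto
    finally show ?thesis using False by simp
  qed
  with d have "\<bar>(\<Sum>K<p. \<Prod>i<m. leg K (\<beta> i)) / p - (if S = {} then 1 else 0)\<bar> \<le> real m / sqrt p + 24 * real m / sqrt p"
    by linarith
  then show ?thesis unfolding avg by (simp add: add_divide_distrib[symmetric])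
qed

text \<open>Expanding the power over index tuples makes the comparison termwise with a uniform
  error, so the weights enter only through their absolute sum. As that sum is of size ln p for the
  cotangent weights, the usable order is limited to about ln p / ln ln p.\<close>

theorem moment_comparison:
  "\<bar>(\<Sum>K<p. (\<Sum>b<p. a b * leg K b) ^ m) / p - (\<Sum>\<epsilon>\<in>sign_vectors p. (\<Sum>b<p. a b * \<epsilon> b) ^ m) / 2 ^ p\<bar>
     \<le> 25 * real m * (\<Sum>b<p. \<bar>a b\<bar>) ^ m / sqrt p"
proof -
  let ?\<B> = "PiE {..<m} (\<lambda>_. {..<p})"
  define A where "A = (\<lambda>\<beta>. \<Prod>i<m. a (\<beta> i))"
  have ex: "(\<Sum>\<omega>\<in>\<Omega>. (\<Sum>b<p. a b * u \<omega> b) ^ m) / N = (\<Sum>\<beta>\<in>?\<B>. A \<beta> * ((\<Sum>\<omega>\<in>\<Omega>. \<Prod>i<m. u \<omega> (\<beta> i)) / N))"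
    for \<Omega> :: "'z set" and u N
  proof -
    have "(\<Sum>\<omega>\<in>\<Omega>. (\<Sum>b<p. a b * u \<omega> b) ^ m) = (\<Sum>\<omega>\<in>\<Omega>. \<Sum>\<beta>\<in>?\<B>. A \<beta> * (\<Prod>i<m. u \<omega> (\<beta> i)))"
      by (simp add: sum_power_PiE A_def prod.distrib)
    also have "\<dots> = (\<Sum>\<beta>\<in>?\<B>. A \<beta> * (\<Sum>\<omega>\<in>\<Omega>. \<Prod>i<m. u \<omega> (\<beta> i)))"
      by (subst sum.swap) (simp add: sum_distrib_left)
    finally show ?thesis by (simp only: times_divide_eq_right sum_divide_distrib[symmetric])
  qed
  have "\<bar>(\<Sum>K<p. (\<Sum>b<p. a b * leg K b) ^ m) / p - (\<Sum>\<epsilon>\<in>sign_vectors p. (\<Sum>b<p. a b * \<epsilon> b) ^ m) / 2 ^ p\<bar> =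
     \<bar>\<Sum>\<beta>\<in>?\<B>. A \<beta> * ((\<Sum>K<p. \<Prod>i<m. leg K (\<beta> i)) / p - (\<Sum>\<epsilon>\<in>sign_vectors p. \<Prod>i<m. \<epsilon> (\<beta> i)) / 2 ^ p)\<bar>"
    using ex[of leg "{..<p}" "real p"] ex[of "\<lambda>\<epsilon>. \<epsilon>" "sign_vectors p" "2 ^ p"]
    by (simp add: right_diff_distrib sum_subtractf)
  also have "\<dots> \<le> (\<Sum>\<beta>\<in>?\<B>. \<bar>A \<beta> * ((\<Sum>K<p. \<Prod>i<m. leg K (\<beta> i)) / p - (\<Sum>\<epsilon>\<in>sign_vectors p. \<Prod>i<m. \<epsilon> (\<beta> i)) / 2 ^ p)\<bar>)"
    by (rule sum_abs)
  also have "\<dots> \<le> (\<Sum>\<beta>\<in>?\<B>. \<bar>A \<beta>\<bar> * (25 * real m / sqrt p))"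
    unfolding abs_mult by (intro sum_mono mult_left_mono average_prod_comparison) auto
  also have "\<dots> = (\<Sum>\<beta>\<in>?\<B>. \<Prod>i<m. \<bar>a (\<beta> i)\<bar>) * (25 * real m / sqrt p)"
    by (simp only: A_def abs_prod sum_distrib_right)
  also have "\<dots> = 25 * real m * (\<Sum>b<p. \<bar>a b\<bar>) ^ m / sqrt p"
    by (simp add: sum_power_PiE[of "\<lambda>b. \<bar>a b\<bar>"])
  finally show ?thesis .
qed

end

section \<open>Large deviations from moments\<close>

definition sign_mean :: "nat \<Rightarrow> (nat \<Rightarrow> real) \<Rightarrow> (real \<Rightarrow> real) \<Rightarrow> real" where
  "sign_mean p a F = (\<Sum>\<epsilon>\<in>sign_vectors p. F (\<Sum>b<p. a b * \<epsilon> b)) / 2 ^ p"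

definition cumulant :: "nat \<Rightarrow> (nat \<Rightarrow> real) \<Rightarrow> real \<Rightarrow> real" where
  "cumulant p a s = (\<Sum>b<p. ln (cosh (a b * s)))"

definition cumulant' :: "nat \<Rightarrow> (nat \<Rightarrow> real) \<Rightarrow> real \<Rightarrow> real" where
  "cumulant' p a s = (\<Sum>b<p. a b * tanh (a b * s))"

definition cumulant'' :: "nat \<Rightarrow> (nat \<Rightarrow> real) \<Rightarrow> real \<Rightarrow> real" where
  "cumulant'' p a s = (\<Sum>b<p. (a b)\<^sup>2 / (cosh (a b * s))\<^sup>2)"

lemma sign_mean_mono: "(\<And>x. F x \<le> G x) \<Longrightarrow> sign_mean p a F \<le> sign_mean p a G"
  unfolding sign_mean_def by (intro divide_right_mono sum_mono) auto

lemma sign_mean_add: "sign_mean p a (\<lambda>x. F x + G x) = sign_mean p a F + sign_mean p a G"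
  by (simp add: sign_mean_def sum.distrib add_divide_distrib)

lemma sign_mean_cmult: "sign_mean p a (\<lambda>x. c * F x) = c * sign_mean p a F"
  by (simp add: sign_mean_def sum_distrib_left[symmetric])

lemma sign_mean_exp: "sign_mean p a (\<lambda>x. exp (s * x)) = exp (cumulant p a s)"
proof -
  have "(\<Sum>\<epsilon>\<in>sign_vectors p. exp (s * (\<Sum>b<p. a b * \<epsilon> b))) = (\<Sum>\<epsilon>\<in>sign_vectors p. \<Prod>b<p. exp (s * (a b * \<epsilon> b)))"
    by (simp add: sum_distrib_left exp_sum)
  also have "\<dots> = (\<Prod>b<p. exp (s * (a b * - 1)) + exp (s * (a b * 1)))"
    by (rule sum_sign_vectors_prod)
  also have "\<dots> = (\<Prod>b<p. 2 * cosh (a b * s))"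
    by (intro prod.cong refl) (simp add: cosh_def mult_ac)
  also have "\<dots> = 2 ^ p * (\<Prod>b<p. cosh (a b * s))" by (simp add: prod.distrib)
  also have "(\<Prod>b<p. cosh (a b * s)) = exp (cumulant p a s)"
    by (simp add: cumulant_def exp_sum)
  finally show ?thesis by (simp add: sign_mean_def)
qed

lemma cumulant_deriv: "(cumulant p a has_real_derivative cumulant' p a s) (at s)"
  unfolding cumulant_def cumulant'_def
  by (rule derivative_eq_intros DERIV_sum refl | force simp: tanh_def field_simps)+

lemma cumulant'_deriv: "(cumulant' p a has_real_derivative cumulant'' p a s) (at s)"
proof -
  have "((\<lambda>s. a b * tanh (a b * s)) has_real_derivative (a b)\<^sup>2 / (cosh (a b * s))\<^sup>2) (at s)" for b
  proof -
    have "((\<lambda>s. a b * tanh (a b * s)) has_real_derivative a b * ((1 - (tanh (a b * s))\<^sup>2) * a b)) (at s)"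
      by (auto intro!: derivative_eq_intros)
    moreover have "1 - (tanh (a b * s))\<^sup>2 = 1 / (cosh (a b * s))\<^sup>2"
      by (simp add: tanh_def power_divide field_simps) (simp add: cosh_square_eq)
    ultimately show ?thesis by (simp add: power2_eq_square)
  qed
  then show ?thesis unfolding cumulant'_def cumulant''_def by (intro DERIV_sum)
qed

lemma sign_mean_exp_1: "sign_mean p a (\<lambda>x. x * exp (s * x)) = cumulant' p a s * exp (cumulant p a s)"
proof -
  have "((\<lambda>s. sign_mean p a (\<lambda>x. exp (s * x))) has_real_derivative sign_mean p a (\<lambda>x. x * exp (s * x))) (at s)"
    unfolding sign_mean_def by (intro DERIV_cdivide DERIV_sum) (auto intro!: derivative_eq_intros)
  moreover have "((\<lambda>s. exp (cumulant p a s)) has_real_derivative cumulant' p a s * exp (cumulant p a s)) (at s)"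
    by (auto intro!: derivative_eq_intros cumulant_deriv)
  ultimately show ?thesis unfolding sign_mean_exp by (rule DERIV_unique)
qed

lemma sign_mean_exp_2:
  "sign_mean p a (\<lambda>x. x\<^sup>2 * exp (s * x)) = (cumulant'' p a s + (cumulant' p a s)\<^sup>2) * exp (cumulant p a s)"
proof -
  have "((\<lambda>s. sign_mean p a (\<lambda>x. x * exp (s * x))) has_real_derivative sign_mean p a (\<lambda>x. x\<^sup>2 * exp (s * x))) (at s)"
    unfolding sign_mean_def
    by (intro DERIV_cdivide DERIV_sum) (auto intro!: derivative_eq_intros simp: power2_eq_square)
  moreover have "((\<lambda>s. cumulant' p a s * exp (cumulant p a s)) has_real_derivative
      (cumulant'' p a s + (cumulant' p a s)\<^sup>2) * exp (cumulant p a s)) (at s)"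
    by (auto intro!: derivative_eq_intros cumulant_deriv cumulant'_deriv simp: power2_eq_square algebra_simps)
  ultimately show ?thesis unfolding sign_mean_exp_1 by (rule DERIV_unique)
qed

text \<open>Under the law tilted by exp (s x) and normalised, \<open>cumulant'\<close> is the mean
  and \<open>cumulant''\<close> the variance; both come from differentiating the moment generating
  function in \<open>s\<close>.\<close>

lemma sign_mean_tilted_variance:
  "sign_mean p a (\<lambda>x. exp (s * x) * (x - cumulant' p a s)\<^sup>2) = cumulant'' p a s * exp (cumulant p a s)"
proof -
  let ?W = "cumulant' p a s"
  have "(\<lambda>x. exp (s * x) * (x - ?W)\<^sup>2) = (\<lambda>x. x\<^sup>2 * exp (s * x) + ((- 2 * ?W) * (x * exp (s * x)) + ?W\<^sup>2 * exp (s * x)))"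
    by (rule ext) (simp add: power2_eq_square algebra_simps)
  then have "sign_mean p a (\<lambda>x. exp (s * x) * (x - ?W)\<^sup>2) =
     sign_mean p a (\<lambda>x. x\<^sup>2 * exp (s * x)) + ((- 2 * ?W) * sign_mean p a (\<lambda>x. x * exp (s * x)) + ?W\<^sup>2 * sign_mean p a (\<lambda>x. exp (s * x)))"
    by (simp only: sign_mean_add sign_mean_cmult)
  also have "\<dots> = cumulant'' p a s * exp (cumulant p a s)"
    unfolding sign_mean_exp sign_mean_exp_1 sign_mean_exp_2 by (simp add: power2_eq_square algebra_simps)
  finally show ?thesis .
qed

lemma cumulant_minus: "cumulant p a (- s) = cumulant p a s" "cumulant' p a (- s) = - cumulant' p a s"
  "cumulant'' p a (- s) = cumulant'' p a s"
  by (simp_all add: cumulant_def cumulant'_def cumulant''_def sum_negf)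

lemma cumulant_nonneg: "0 \<le> cumulant p a s"
  unfolding cumulant_def by (intro sum_nonneg ln_ge_zero cosh_real_ge_1)

lemma cumulant''_nonneg: "0 \<le> cumulant'' p a s"
  unfolding cumulant''_def by (intro sum_nonneg) auto

text \<open>The weight x ^ (2k) agrees with the exponential tilt near its peak W and lies below it elsewhere,
  so a polynomial can play the role of the tilted indicator function of a window around W.\<close>

definition window_poly :: "nat \<Rightarrow> real \<Rightarrow> real \<Rightarrow> real \<Rightarrow> real" where
  "window_poly k W d x = x ^ (2 * k) * (1 - ((x\<^sup>2 - W\<^sup>2) / (2 * W * d))\<^sup>2)"

text \<open>With v = (x - W)/W the tilt is exp ((2k + 1) v). The even power uses 2k of these units
  and the spare one covers the factor (1 + v/2)^2 of the quadratic cutoff, so the subtracted part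
  lies below the tilt for all x >= 0. A lower bound for the power itself is needed only for |x - W|
  <= d, where replacing exp v by 1 + v loses a bounded factor; outside that range the right-hand
  quadratic has already absorbed the loss.\<close>

lemma window_poly_lower_nonneg:
  assumes W: "0 < W" and d: "0 < d" "2 * d \<le> W" and sW: "s * W = 2 * real k + 1"
    and small: "d / W + 2 * s * d\<^sup>2 / W \<le> 1 / 2" and x: "0 \<le> x"
  shows "W ^ (2 * k) * exp (s * (x - W)) * (1 / 2 - 2 * ((x - W) / d)\<^sup>2) \<le> window_poly k W d x"
proof -
  define v where "v = (x - W) / W"
  define z where "z = ((x - W) / d)\<^sup>2"
  define R where "R = W ^ (2 * k) * exp (s * (x - W))"
  have R0: "0 < R" using W by (simp add: R_def)
  have xv: "x = W * (1 + v)" using W by (simp add: v_def field_simps)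
  have v1: "0 \<le> 1 + v" using x W unfolding xv by (simp add: zero_le_mult_iff)
  have sv: "s * (x - W) = (2 * real k + 1) * v"
    unfolding sW[symmetric] using W by (simp add: v_def)
  have s: "s = (2 * real k + 1) / W" using sW W by (simp add: field_simps)
  have q: "((x\<^sup>2 - W\<^sup>2) / (2 * W * d))\<^sup>2 = z * (1 + v / 2)\<^sup>2"
  proof -
    have "(x\<^sup>2 - W\<^sup>2) / (2 * W * d) = ((x - W) / d) * (1 + v / 2)"
      using W d by (simp add: v_def field_simps power2_eq_square)
    then show ?thesis by (simp only: power_mult_distrib z_def)
  qed
  have "(1 + v) ^ (2 * k) \<le> exp v ^ (2 * k)" using v1 by (intro power_mono exp_ge_add_one_self)
  also have "\<dots> = exp (2 * real k * v)" by (simp add: exp_of_nat_mult[symmetric])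
  finally have a1: "(1 + v) ^ (2 * k) \<le> exp (2 * real k * v)" .
  have "(1 + v / 2)\<^sup>2 \<le> (exp (v / 2))\<^sup>2" using v1 by (intro power_mono exp_ge_add_one_self) auto
  also have "\<dots> = exp v" by (simp add: exp_of_nat_mult[symmetric])
  finally have a2: "(1 + v / 2)\<^sup>2 \<le> exp v" .
  have "(1 + v) ^ (2 * k) * (1 + v / 2)\<^sup>2 \<le> exp (2 * real k * v) * exp v"
    using a1 a2 v1 by (intro mult_mono) auto
  also have "\<dots> = exp (s * (x - W))" by (simp only: sv exp_add[symmetric]) (simp add: algebra_simps)
  finally have "W ^ (2 * k) * ((1 + v) ^ (2 * k) * (1 + v / 2)\<^sup>2) \<le> R"
    unfolding R_def using W by (intro mult_left_mono) auto
  then have "x ^ (2 * k) * (1 + v / 2)\<^sup>2 \<le> R" by (simp add: xv power_mult_distrib mult_ac)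
  then have "x ^ (2 * k) * (1 + v / 2)\<^sup>2 * z \<le> R * z" by (intro mult_right_mono) (auto simp: z_def)
  then have up: "x ^ (2 * k) - R * z \<le> window_poly k W d x"
    unfolding window_poly_def q by (simp add: algebra_simps)
  have "R * (1 / 2 - 2 * z) \<le> x ^ (2 * k) - R * z"
  proof (cases "z \<le> 1")
    case True
    then have "\<bar>(x - W) / d\<bar> \<le> 1" unfolding z_def by (simp only: abs_square_le_1)
    then have xd: "\<bar>x - W\<bar> \<le> d" using d by (simp add: abs_le_iff field_simps)
    have vW: "\<bar>v\<bar> \<le> d / W" unfolding v_def using xd W by (simp add: abs_divide divide_right_mono)
    also have "d / W \<le> 1 / 2" using d W by (simp add: field_simps)
    finally have vh: "\<bar>v\<bar> \<le> 1 / 2" .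
    have lnv: "v - 2 * v\<^sup>2 \<le> ln (1 + v)"
    proof (cases "0 \<le> v")
      case True
      then have "v - v\<^sup>2 \<le> ln (1 + v)" using vh by (intro ln_one_plus_pos_lower_bound) auto
      then show ?thesis using zero_le_power2[of v] by linarith
    next
      case False
      then have "- (- v) - 2 * (- v)\<^sup>2 \<le> ln (1 - (- v))" using vh by (intro ln_one_minus_pos_lower_bound) auto
      then show ?thesis by simp
    qed
    have v2: "v\<^sup>2 \<le> (d / W)\<^sup>2" using power_mono[OF vW, of 2] by simp
    \<comment> \<open>The exponent lost by using v - 2 v^2 in place of v is 4 k v^2, plus |v| for
      the spare unit. The assumption \<open>small\<close> bounds the total by 1/2, and exp (- 1/2)
      is at least 1/2.\<close>
    have "4 * real k * v\<^sup>2 \<le> 2 * (s * W) * v\<^sup>2" unfolding sW by (intro mult_right_mono) auto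
    also have "\<dots> \<le> 2 * (s * W) * (d / W)\<^sup>2" using v2 unfolding sW by (intro mult_left_mono) auto
    also have "\<dots> = 2 * s * d\<^sup>2 / W" using W by (simp add: power2_eq_square)
    finally have "4 * real k * v\<^sup>2 + \<bar>v\<bar> \<le> 1 / 2" using vW small by linarith
    then have "(2 * real k + 1) * v - 1 / 2 \<le> 2 * real k * (v - 2 * v\<^sup>2)" by (simp add: algebra_simps)
    also have "\<dots> \<le> 2 * real k * ln (1 + v)" using lnv by (intro mult_left_mono) auto
    finally have "exp (s * (x - W) - 1 / 2) \<le> exp (2 * real k * ln (1 + v))" unfolding sv by simp
    also have "\<dots> = exp (ln (1 + v)) ^ (2 * k)" by (simp add: exp_of_nat_mult[symmetric])
    also have "exp (ln (1 + v)) = 1 + v" using vh by (intro exp_ln) auto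
    finally have e1: "exp (s * (x - W)) * exp (- (1 / 2)) \<le> (1 + v) ^ (2 * k)"
      by (simp add: exp_add[symmetric])
    have "1 / 2 \<le> exp (- (1 / 2) :: real)" using exp_ge_add_one_self[of "- (1/2) :: real"] by simp
    then have "exp (s * (x - W)) * (1 / 2) \<le> exp (s * (x - W)) * exp (- (1 / 2))" by (intro mult_left_mono) auto
    with e1 have e2: "exp (s * (x - W)) * (1 / 2) \<le> (1 + v) ^ (2 * k)" by linarith
    have "W ^ (2 * k) * (exp (s * (x - W)) * (1 / 2)) \<le> W ^ (2 * k) * (1 + v) ^ (2 * k)"
      using W by (intro mult_left_mono[OF e2]) simp
    then have "R / 2 \<le> x ^ (2 * k)" by (simp add: R_def xv power_mult_distrib)
    moreover have "0 \<le> R * z" using R0 by (simp add: z_def)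
    ultimately show ?thesis by (simp add: algebra_simps)
  next
    case False
    then have "R * (1 / 2) \<le> R * z" using R0 by (intro mult_left_mono) auto
    moreover have "0 \<le> x ^ (2 * k)" using x by simp
    ultimately show ?thesis by (simp add: algebra_simps)
  qed
  with up show ?thesis unfolding R_def z_def by linarith
qed

text \<open>The window polynomial is even and sees both W and -W, so both tilts may be collected. On
  the wrong side the distance to W is at least 2 d, which makes the corresponding summand
  nonpositive.\<close>

lemma window_poly_lower:
  assumes W: "0 < W" and d: "0 < d" "2 * d \<le> W" and sW: "s * W = 2 * real k + 1"
    and small: "d / W + 2 * s * d\<^sup>2 / W \<le> 1 / 2"
  defines "r \<equiv> \<lambda>x. W ^ (2 * k) * exp (s * (x - W)) * (1 / 2 - 2 * ((x - W) / d)\<^sup>2)"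
  shows "r x + r (- x) \<le> window_poly k W d x"
proof -
  have neg: "r (- y) \<le> 0" if "0 \<le> y" for y
  proof -
    have "2 \<le> (y + W) / d" using d W that by (simp add: field_simps)
    then have "2\<^sup>2 \<le> ((y + W) / d)\<^sup>2" by (intro power_mono) auto
    moreover have "((- y - W) / d)\<^sup>2 = ((y + W) / d)\<^sup>2"
      by (metis minus_add_distrib minus_divide_left power2_minus uminus_add_conv_diff add.commute)
    ultimately have "1 / 2 - 2 * ((- y - W) / d)\<^sup>2 \<le> 0" by simp
    then show ?thesis unfolding r_def using W by (intro mult_nonneg_nonpos) auto
  qed
  have pos: "r y \<le> window_poly k W d y" if "0 \<le> y" for y
    unfolding r_def by (rule window_poly_lower_nonneg[OF W d sW small that])
  have even: "window_poly k W d (- x) = window_poly k W d x" by (simp add: window_poly_def)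
  show ?thesis
  proof (cases "0 \<le> x")
    case True
    then show ?thesis using pos[of x] neg[of x] by linarith
  next
    case False
    then show ?thesis using pos[of "- x"] neg[of "- x"] even by simp
  qed
qed

text \<open>Chebyshev's inequality in quadratic form: a tilted variance of at most d^2/16 lowers 1/2
  to 3/8, and the two symmetric tilts together give 3/4.\<close>

lemma sign_mean_window_poly:
  assumes W: "W = cumulant' p a s" "0 < W" and d: "0 < d" "2 * d \<le> W" and sW: "s * W = 2 * real k + 1"
    and small: "d / W + 2 * s * d\<^sup>2 / W \<le> 1 / 2" and var: "16 * cumulant'' p a s \<le> d\<^sup>2"
  shows "3 / 4 * W ^ (2 * k) * exp (cumulant p a s - s * W) \<le> sign_mean p a (window_poly k W d)"
proof -
  define r where "r = (\<lambda>x. W ^ (2 * k) * exp (s * (x - W)) * (1 / 2 - 2 * ((x - W) / d)\<^sup>2))"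
  define c where "c = W ^ (2 * k) * exp (- (s * W))"
  have r: "r x = c * (1 / 2) * exp (s * x) + (- (c * 2 / d\<^sup>2)) * (exp (s * x) * (x - W)\<^sup>2)" for x
    by (simp add: r_def c_def exp_diff exp_minus power_divide algebra_simps inverse_eq_divide)
  have r': "r (- x) = c * (1 / 2) * exp (- s * x) + (- (c * 2 / d\<^sup>2)) * (exp (- s * x) * (x - cumulant' p a (- s))\<^sup>2)" for x
  proof -
    have "(- x - W)\<^sup>2 = (x - cumulant' p a (- s))\<^sup>2" unfolding cumulant_minus W(1)[symmetric]
      by (simp add: power2_eq_square algebra_simps)
    then show ?thesis by (simp only: r) simp
  qed
  have m1: "sign_mean p a r = c * (1 / 2 - 2 * cumulant'' p a s / d\<^sup>2) * exp (cumulant p a s)"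
  proof -
    have "r = (\<lambda>x. c * (1 / 2) * exp (s * x) + (- (c * 2 / d\<^sup>2)) * (exp (s * x) * (x - cumulant' p a s)\<^sup>2))"
      using r W(1) by auto
    then show ?thesis
      by (simp only: sign_mean_add sign_mean_cmult sign_mean_exp sign_mean_tilted_variance) (simp add: algebra_simps)
  qed
  have m2: "sign_mean p a (\<lambda>x. r (- x)) = c * (1 / 2 - 2 * cumulant'' p a s / d\<^sup>2) * exp (cumulant p a s)"
    unfolding r' sign_mean_add sign_mean_cmult sign_mean_exp sign_mean_tilted_variance
    by (simp add: algebra_simps cumulant_minus)
  have "2 * cumulant'' p a s / d\<^sup>2 \<le> 1 / 8" using var d by (simp add: field_simps)
  then have "c * exp (cumulant p a s) * (3 / 8) \<le> c * exp (cumulant p a s) * (1 / 2 - 2 * cumulant'' p a s / d\<^sup>2)"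
    using W by (intro mult_left_mono) (auto simp: c_def)
  then have "3 / 4 * (c * exp (cumulant p a s)) \<le> sign_mean p a r + sign_mean p a (\<lambda>x. r (- x))"
    unfolding m1 m2 by (simp add: algebra_simps)
  also have "\<dots> \<le> sign_mean p a (window_poly k W d)"
    unfolding sign_mean_add[symmetric] r_def by (intro sign_mean_mono window_poly_lower[OF W(2) d sW small])
  finally show ?thesis by (simp add: c_def exp_diff exp_minus field_simps)
qed

text \<open>The polynomial is positive only where x^2 differs from W^2 by less than 2 W d. This puts
  |x| between W - 2 d and W + d, and there the power is at most its value at W + d.\<close>

lemma window_poly_upper:
  assumes W: "0 < W" and d: "0 < d" "2 * d \<le> W"
  shows "window_poly k W d x \<le> (if W - 2 * d \<le> \<bar>x\<bar> then (W + d) ^ (2 * k) else 0)"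
proof (cases "\<bar>x\<^sup>2 - W\<^sup>2\<bar> \<le> 2 * W * d")
  case True
  have "(W - 2 * d)\<^sup>2 \<le> W\<^sup>2 - 2 * W * d"
    using mult_left_mono[OF d(2), of "2 * d"] d(1) by (simp add: power2_eq_square algebra_simps)
  also have "\<dots> \<le> x\<^sup>2" using True by linarith
  finally have lo: "W - 2 * d \<le> \<bar>x\<bar>" using d by (metis abs_le_square_iff abs_of_nonneg diff_ge_0_iff_ge)
  have "x\<^sup>2 \<le> W\<^sup>2 + 2 * W * d" using True by linarith
  also have "\<dots> \<le> (W + d)\<^sup>2" by (simp add: power2_eq_square algebra_simps)
  finally have "(x\<^sup>2) ^ k \<le> ((W + d)\<^sup>2) ^ k" by (rule power_mono) simp
  then have "x ^ (2 * k) \<le> (W + d) ^ (2 * k)" by (simp only: power_mult)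
  moreover have "window_poly k W d x \<le> x ^ (2 * k) * 1"
    unfolding window_poly_def by (intro mult_left_mono) (auto simp: power_mult)
  ultimately show ?thesis using lo by simp
next
  case False
  have "1 < \<bar>x\<^sup>2 - W\<^sup>2\<bar> / (2 * W * d)" using False W d by (simp add: less_divide_eq)
  then have "1 < \<bar>(x\<^sup>2 - W\<^sup>2) / (2 * W * d)\<bar>" using W d by (simp add: abs_divide abs_mult)
  then have "1 - ((x\<^sup>2 - W\<^sup>2) / (2 * W * d))\<^sup>2 \<le> 0" by (metis abs_square_le_1 diff_le_0_iff_le linorder_not_less nle_le)
  then have "window_poly k W d x \<le> 0"
    unfolding window_poly_def by (intro mult_nonneg_nonpos) (auto simp: power_mult)
  also have "0 \<le> (if W - 2 * d \<le> \<bar>x\<bar> then (W + d) ^ (2 * k) else 0)" using W d by simp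
  finally show ?thesis .
qed

lemma window_poly_expand:
  defines "c W d \<equiv> 1 / (4 * W\<^sup>2 * d\<^sup>2)"
  shows "window_poly k W d x = (1 - c W d * W ^ 4) * x ^ (2 * k) + (2 * c W d * W\<^sup>2 * x ^ (2 * k + 2) + (- c W d) * x ^ (2 * k + 4))"
proof -
  have q: "((x\<^sup>2 - W\<^sup>2) / (2 * W * d))\<^sup>2 = c W d * (x ^ 4 - 2 * W\<^sup>2 * x\<^sup>2 + W ^ 4)"
  proof -
    have "(x\<^sup>2 - W\<^sup>2)\<^sup>2 = x ^ 4 - 2 * W\<^sup>2 * x\<^sup>2 + W ^ 4"
      by (simp add: power2_eq_square power4_eq_xxxx algebra_simps)
    then show ?thesis by (simp add: c_def power_divide power_mult_distrib)
  qed
  show ?thesis unfolding window_poly_def q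
    by (simp add: power_add power2_eq_square power4_eq_xxxx algebra_simps)
qed

text \<open>The window polynomial has only the monomials of degree 2k, 2k + 2 and 2k + 4, with
  coefficients of total size at most 1 + W^2/d^2. Its average over \<open>K\<close> therefore
  inherits the lower bound for signs, the moment error taking 1/4 of the 3/4. Division by the
  maximum of the polynomial turns the average into a frequency.\<close>

lemma tail_lower_bound:
  fixes X :: "nat \<Rightarrow> real"
  assumes p: "0 < p"
    and mom: "\<And>m. m \<le> 2 * k + 4 \<Longrightarrow> \<bar>(\<Sum>K<p. X K ^ m) / p - sign_mean p a (\<lambda>x. x ^ m)\<bar> \<le> err"
    and W: "W = cumulant' p a s" "1 \<le> W" and d: "0 < d" "2 * d \<le> W" and sW: "s * W = 2 * real k + 1"
    and small: "d / W + 2 * s * d\<^sup>2 / W \<le> 1 / 2" and var: "16 * cumulant'' p a s \<le> d\<^sup>2"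
    and err: "err * (1 + W\<^sup>2 / d\<^sup>2) \<le> exp (- (s * W)) / 4"
  shows "1 / 2 * (W / (W + d)) ^ (2 * k) * exp (cumulant p a s - s * W) \<le> real (card {K \<in> {0..<p}. W - 2 * d \<le> \<bar>X K\<bar>}) / p"
proof -
  define av where "av = (\<lambda>F :: real \<Rightarrow> real. (\<Sum>K<p. F (X K)) / p)"
  have av_add: "av (\<lambda>x. F x + G x) = av F + av G" for F G by (simp add: av_def sum.distrib add_divide_distrib)
  have av_cm: "av (\<lambda>x. t * F x) = t * av F" for F t by (simp add: av_def sum_distrib_left[symmetric])
  have W0: "0 < W" using W by simp
  define c where "c = 1 / (4 * W\<^sup>2 * d\<^sup>2)"
  have c0: "0 \<le> c" by (simp add: c_def)
  have wp: "window_poly k W d = (\<lambda>x. (1 - c * W ^ 4) * x ^ (2 * k) + (2 * c * W\<^sup>2 * x ^ (2 * k + 2) + (- c) * x ^ (2 * k + 4)))"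
    unfolding c_def by (rule ext) (rule window_poly_expand)
  define D where "D = (\<lambda>m. av (\<lambda>x. x ^ m) - sign_mean p a (\<lambda>x. x ^ m))"
  have D: "\<bar>D m\<bar> \<le> err" if "m \<le> 2 * k + 4" for m using mom[OF that] by (simp add: D_def av_def)
  have tri: "\<bar>x + (y + z)\<bar> \<le> \<bar>x\<bar> + (\<bar>y\<bar> + \<bar>z\<bar>)" for x y z :: real by linarith
  have err0: "0 \<le> err" using D[of 0] by simp
  have "av (window_poly k W d) - sign_mean p a (window_poly k W d) =
      (1 - c * W ^ 4) * D (2 * k) + (2 * c * W\<^sup>2 * D (2 * k + 2) + (- c) * D (2 * k + 4))"
    unfolding wp av_add av_cm sign_mean_add sign_mean_cmult D_def by (simp add: algebra_simps)
  also have "\<bar>\<dots>\<bar> \<le> \<bar>1 - c * W ^ 4\<bar> * \<bar>D (2 * k)\<bar> + (2 * c * W\<^sup>2 * \<bar>D (2 * k + 2)\<bar> + c * \<bar>D (2 * k + 4)\<bar>)"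
    using tri[of "(1 - c * W ^ 4) * D (2 * k)" "2 * c * W\<^sup>2 * D (2 * k + 2)" "(- c) * D (2 * k + 4)"] c0
    by (simp add: abs_mult)
  also have "\<dots> \<le> (1 + c * W ^ 4) * err + (2 * c * W\<^sup>2 * err + c * err)"
    using D c0 err0 by (intro add_mono mult_mono) (auto simp: abs_le_iff)
  also have "\<dots> = err * (1 + c * (1 + W\<^sup>2)\<^sup>2)" by (simp add: power2_eq_square power4_eq_xxxx algebra_simps)
  also have "\<dots> \<le> err * (1 + W\<^sup>2 / d\<^sup>2)"
  proof -
    have "1 \<le> W\<^sup>2" using W by (simp add: one_le_power)
    then have "(1 + W\<^sup>2)\<^sup>2 \<le> (2 * W\<^sup>2)\<^sup>2" by (intro power_mono) auto
    then have "c * (1 + W\<^sup>2)\<^sup>2 \<le> c * (2 * W\<^sup>2)\<^sup>2" using c0 by (intro mult_left_mono)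
    also have "\<dots> = W\<^sup>2 / d\<^sup>2" using W0 d by (simp add: c_def power2_eq_square field_simps)
    finally show ?thesis using err0 by (intro mult_left_mono) auto
  qed
  finally have diff: "\<bar>av (window_poly k W d) - sign_mean p a (window_poly k W d)\<bar> \<le> exp (- (s * W)) / 4"
    using err by linarith
  define Z where "Z = W ^ (2 * k) * exp (cumulant p a s - s * W)"
  have "exp (- (s * W)) \<le> 1 * exp (cumulant p a s - s * W)" using cumulant_nonneg[of p a s] by simp
  also have "\<dots> \<le> Z" unfolding Z_def using W by (intro mult_right_mono one_le_power) auto
  finally have "exp (- (s * W)) \<le> Z" .
  moreover have "3 / 4 * Z \<le> sign_mean p a (window_poly k W d)"
    unfolding Z_def using sign_mean_window_poly[OF W(1) W0 d sW small var] by (simp add: mult.assoc)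
  ultimately have "1 / 2 * Z \<le> av (window_poly k W d)" using diff by linarith
  also have "\<dots> \<le> av (\<lambda>x. if W - 2 * d \<le> \<bar>x\<bar> then (W + d) ^ (2 * k) else 0)"
    unfolding av_def by (intro divide_right_mono sum_mono window_poly_upper[OF W0 d]) auto
  also have "\<dots> = (W + d) ^ (2 * k) * (real (card {K \<in> {0..<p}. W - 2 * d \<le> \<bar>X K\<bar>}) / p)"
  proof -
    have "{..<p} \<inter> {K. W - 2 * d \<le> \<bar>X K\<bar>} = {K \<in> {0..<p}. W - 2 * d \<le> \<bar>X K\<bar>}" by auto
    then show ?thesis by (simp add: av_def sum.If_cases)
  qed
  finally have "1 / 2 * Z / (W + d) ^ (2 * k) \<le> real (card {K \<in> {0..<p}. W - 2 * d \<le> \<bar>X K\<bar>}) / p"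
    using W0 d by (subst pos_divide_le_eq) (auto simp: mult.commute)
  then show ?thesis by (simp add: Z_def power_divide)
qed

text \<open>Markov's inequality for an even power loses nothing against the exponential bound: y <=
  exp (y - 1) with y = |x|/V gives (|x|/V)^(2k) <= exp (s |x| - s V). The factor 3 counts the two
  signs of the tilt and the moment error.\<close>

lemma tail_upper_bound:
  fixes X :: "nat \<Rightarrow> real"
  assumes p: "0 < p"
    and mom: "\<bar>(\<Sum>K<p. X K ^ (2 * k)) / p - sign_mean p a (\<lambda>x. x ^ (2 * k))\<bar> \<le> err"
    and V: "1 \<le> V" and sV: "s * V = 2 * real k" and err: "err \<le> exp (- (s * V))"
  shows "real (card {K \<in> {0..<p}. V \<le> \<bar>X K\<bar>}) / p \<le> 3 * exp (cumulant p a s - s * V)"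
proof -
  have V0: "0 < V" using V by simp
  have s: "s = 2 * real k / V" using sV V0 by (simp add: field_simps)
  then have s0: "0 \<le> s" using V0 by simp
  have pt: "x ^ (2 * k) \<le> V ^ (2 * k) * exp (- (s * V)) * (exp (s * x) + exp (- s * x))" for x
  proof -
    have "\<bar>x\<bar> / V \<le> exp (\<bar>x\<bar> / V - 1)" using exp_ge_add_one_self[of "\<bar>x\<bar> / V - 1"] by simp
    then have "(\<bar>x\<bar> / V) ^ (2 * k) \<le> exp (\<bar>x\<bar> / V - 1) ^ (2 * k)" using V0 by (intro power_mono) auto
    also have "\<dots> = exp (s * \<bar>x\<bar> - s * V)"
      using V0 by (simp add: exp_of_nat_mult[symmetric] s field_simps)
    finally have "\<bar>x\<bar> ^ (2 * k) \<le> V ^ (2 * k) * exp (s * \<bar>x\<bar> - s * V)"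
      using V0 by (simp add: power_divide field_simps)
    moreover have "\<bar>x\<bar> ^ (2 * k) = x ^ (2 * k)" by (simp add: power_even_abs)
    moreover have "exp (s * \<bar>x\<bar> - s * V) \<le> exp (- (s * V)) * (exp (s * x) + exp (- s * x))"
    proof -
      have "exp (s * \<bar>x\<bar>) \<le> exp (s * x) + exp (- s * x)" by (cases "0 \<le> x") (auto simp: add_increasing add_increasing2)
      then have "exp (- (s * V)) * exp (s * \<bar>x\<bar>) \<le> exp (- (s * V)) * (exp (s * x) + exp (- s * x))" by (intro mult_left_mono) auto
      then show ?thesis by (simp add: exp_diff exp_minus field_simps)
    qed
    then have "V ^ (2 * k) * exp (s * \<bar>x\<bar> - s * V) \<le> V ^ (2 * k) * (exp (- (s * V)) * (exp (s * x) + exp (- s * x)))"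
      using V0 by (intro mult_left_mono) auto
    ultimately show ?thesis by (simp add: mult.assoc)
  qed
  have "sign_mean p a (\<lambda>x. x ^ (2 * k)) \<le> sign_mean p a (\<lambda>x. V ^ (2 * k) * exp (- (s * V)) * (exp (s * x) + exp (- s * x)))"
    by (intro sign_mean_mono pt)
  also have "\<dots> = V ^ (2 * k) * exp (- (s * V)) * (2 * exp (cumulant p a s))"
    by (simp only: sign_mean_cmult sign_mean_add sign_mean_exp cumulant_minus) simp
  finally have m: "sign_mean p a (\<lambda>x. x ^ (2 * k)) \<le> 2 * (V ^ (2 * k) * exp (cumulant p a s - s * V))"
    by (simp add: exp_diff exp_minus field_simps)
  have "exp (- (s * V)) \<le> 1 * exp (cumulant p a s - s * V)" using cumulant_nonneg[of p a s] by simp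
  also have "\<dots> \<le> V ^ (2 * k) * exp (cumulant p a s - s * V)" using V by (intro mult_right_mono one_le_power) auto
  finally have e: "err \<le> V ^ (2 * k) * exp (cumulant p a s - s * V)" using err by linarith
  have "V ^ (2 * k) * (real (card {K \<in> {0..<p}. V \<le> \<bar>X K\<bar>}) / p) = (\<Sum>K<p. if V \<le> \<bar>X K\<bar> then V ^ (2 * k) else 0) / p"
  proof -
    have "{..<p} \<inter> {K. V \<le> \<bar>X K\<bar>} = {K \<in> {0..<p}. V \<le> \<bar>X K\<bar>}" by auto
    then show ?thesis by (simp add: sum.If_cases)
  qed
  also have "\<dots> \<le> (\<Sum>K<p. X K ^ (2 * k)) / p"
  proof (intro divide_right_mono sum_mono)
    fix K
    have "V ^ (2 * k) \<le> \<bar>X K\<bar> ^ (2 * k)" if "V \<le> \<bar>X K\<bar>" using that V0 by (intro power_mono) auto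
    then show "(if V \<le> \<bar>X K\<bar> then V ^ (2 * k) else 0) \<le> X K ^ (2 * k)"
      by (auto simp: power_even_abs power_mult)
  qed auto
  also have "\<dots> \<le> 3 * (V ^ (2 * k) * exp (cumulant p a s - s * V))" using mom m e by linarith
  finally have "V ^ (2 * k) * (real (card {K \<in> {0..<p}. V \<le> \<bar>X K\<bar>}) / p) \<le> V ^ (2 * k) * (3 * exp (cumulant p a s - s * V))"
    by simp
  then show ?thesis using V0 by (subst (asm) mult_le_cancel_left_pos) auto
qed

section \<open>The cumulant generating function of the cotangent weights\<close>

abbreviation cosh_integral :: real where "cosh_integral \<equiv> LBINT u=0..1. ln (cosh u) / u\<^sup>2"
abbreviation exp_integral :: real where "exp_integral \<equiv> LBINT u=1..\<infinity>. ln (1 + exp (- 2 * u)) / u\<^sup>2"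

lemma tanh_real_le: "0 \<le> x \<Longrightarrow> tanh x \<le> (x::real)"
proof -
  assume x: "0 \<le> x"
  have "(\<lambda>x. x - tanh x) 0 \<le> (\<lambda>x. x - tanh x) x"
  proof (rule DERIV_nonneg_imp_nondecreasing[OF x])
    fix t :: real
    have "((\<lambda>x. x - tanh x) has_real_derivative (tanh t)\<^sup>2) (at t)"
      by (auto intro!: derivative_eq_intros)
    then show "\<exists>y. ((\<lambda>x. x - tanh x) has_real_derivative y) (at t) \<and> 0 \<le> y" by fastforce
  qed
  then show ?thesis by simp
qed

lemma DERIV_ln_cosh: "((\<lambda>x. ln (cosh x)) has_real_derivative tanh (x::real)) (at x)"
  by (auto intro!: derivative_eq_intros simp: tanh_def)

lemma ln_cosh_nonneg: "0 \<le> ln (cosh (x::real))"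
  by (intro ln_ge_zero cosh_real_ge_1)

lemma ln_cosh_diff:
  assumes "0 \<le> y" "y \<le> (x::real)"
  shows "0 \<le> ln (cosh x) - ln (cosh y)" "ln (cosh x) - ln (cosh y) \<le> x * (x - y)"
proof -
  have "0 \<le> ln (cosh x) - ln (cosh y) \<and> ln (cosh x) - ln (cosh y) \<le> x * (x - y)"
  proof (cases "y = x")
    case False
    have "\<exists>z. y < z \<and> z < x \<and> ln (cosh x) - ln (cosh y) = (x - y) * tanh z"
      by (rule MVT2) (use False assms DERIV_ln_cosh in auto)
    then obtain z where z: "y < z" "z < x" "ln (cosh x) - ln (cosh y) = (x - y) * tanh z" by blast
    have "0 \<le> tanh z" "tanh z \<le> x" using z assms tanh_real_le[of z] by auto
    then show ?thesis using z assms by (auto simp: mult.commute intro!: mult_left_mono)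
  qed simp
  then show "0 \<le> ln (cosh x) - ln (cosh y)" "ln (cosh x) - ln (cosh y) \<le> x * (x - y)" by auto
qed

lemma ln_cosh_le: "ln (cosh (x::real)) \<le> x\<^sup>2"
  using ln_cosh_diff(2)[of 0 x] ln_cosh_diff(2)[of 0 "- x"]
  by (cases "0 \<le> x") (auto simp: power2_eq_square)

text \<open>The value at 0 is the limit there, so the integrand is continuous on the whole line and
  the fundamental theorem applies from the endpoint 0.\<close>

definition log_cosh_ratio :: "real \<Rightarrow> real" where
  "log_cosh_ratio u = (if u = 0 then 1 / 2 else ln (cosh u) / u\<^sup>2)"

lemma log_cosh_ratio_bounds: "0 \<le> log_cosh_ratio u" "log_cosh_ratio u \<le> 1"
  using ln_cosh_nonneg[of u] ln_cosh_le[of u] by (auto simp: log_cosh_ratio_def divide_le_eq_1)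

lemma isCont_log_cosh_ratio: "isCont log_cosh_ratio u"
proof (cases "u = 0")
  case True
  have "((\<lambda>u::real. ln ((exp u + exp (- u)) / 2) / u\<^sup>2) \<longlongrightarrow> 1 / 2) (at 0)" by real_asymp
  then have "((\<lambda>u::real. ln (cosh u) / u\<^sup>2) \<longlongrightarrow> 1 / 2) (at 0)"
    by (simp add: cosh_def add_divide_distrib)
  then have "(log_cosh_ratio \<longlongrightarrow> 1 / 2) (at 0)"
    by (rule Lim_transform_eventually) (auto simp: log_cosh_ratio_def eventually_at_filter)
  then show ?thesis using True by (simp add: isCont_def log_cosh_ratio_def)
next
  case False
  have "isCont (\<lambda>u. ln (cosh u) / u\<^sup>2) u" using False by (intro continuous_intros) auto
  moreover have "eventually (\<lambda>x. ln (cosh x) / x\<^sup>2 = log_cosh_ratio x) (nhds u)"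
    using False t1_space_nhds[of u 0] by (auto simp: log_cosh_ratio_def elim!: eventually_mono)
  ultimately show ?thesis using isCont_cong by fast
qed

lemma antiderivative_exists:
  fixes f :: "real \<Rightarrow> real"
  assumes "\<And>x. c < x \<Longrightarrow> isCont f x" "c < d"
  obtains F where "F d = 0" "\<And>x. d \<le> x \<Longrightarrow> (F has_real_derivative f x) (at x)"
proof -
  \<comment> \<open>Integration starts strictly to the left of \<open>d\<close>, so that the
    derivative at \<open>d\<close> itself is two-sided.\<close>
  define e where "e = (c + d) / 2"
  have e: "c < e" "e < d" using assms by (auto simp: e_def)
  define F where "F = (\<lambda>x. integral {e..x} f - integral {e..d} f)"
  have "(F has_real_derivative f x) (at x)" if "d \<le> x" for x
  proof -
    have "continuous_on {e..x + 1} f" using e assms(1)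
      by (intro continuous_at_imp_continuous_on) auto
    then have "((\<lambda>x. integral {e..x} f) has_real_derivative f x) (at x within {e..x + 1})"
      using e that by (intro integral_has_real_derivative) auto
    moreover have "at x within {e..x + 1} = at x" using e that by (intro at_within_interior) auto
    ultimately show ?thesis unfolding F_def by (auto intro!: derivative_eq_intros)
  qed
  moreover have "F d = 0" by (simp add: F_def)
  ultimately show ?thesis using that by blast
qed

lemma log_cosh_antiderivative:
  obtains G where "\<And>x. 0 \<le> x \<Longrightarrow> (G has_real_derivative log_cosh_ratio x) (at x)" "G 0 = 0" "G 1 = cosh_integral"
    "\<And>x y. 0 \<le> x \<Longrightarrow> x \<le> y \<Longrightarrow> 0 \<le> G y - G x" "\<And>x y. 0 \<le> x \<Longrightarrow> x \<le> y \<Longrightarrow> G y - G x \<le> y - x"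
proof -
  obtain G where G: "G 0 = 0" "\<And>x. 0 \<le> x \<Longrightarrow> (G has_real_derivative log_cosh_ratio x) (at x)"
    using antiderivative_exists[of "- 1" log_cosh_ratio 0] isCont_log_cosh_ratio by auto
  have cont: "isCont G x" if "0 \<le> x" for x using G(2)[OF that] by (rule DERIV_isCont)
  have "(LBINT u=ereal 0..ereal 1. log_cosh_ratio u) = G 1 - G 0"
  proof (rule interval_integral_FTC_nonneg(2))
    show "((G \<circ> real_of_ereal) \<longlongrightarrow> G 0) (at_right (ereal 0))" "((G \<circ> real_of_ereal) \<longlongrightarrow> G 1) (at_left (ereal 1))"
      using cont[of 0] cont[of 1] by (auto simp: ereal_tendsto_simps isCont_def filterlim_at_split)
  qed (use G isCont_log_cosh_ratio log_cosh_ratio_bounds in auto)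
  moreover have "(LBINT u=ereal 0..ereal 1. log_cosh_ratio u) = (LBINT u=ereal 0..ereal 1. ln (cosh u) / u\<^sup>2)"
    by (rule interval_integral_cong) (auto simp: log_cosh_ratio_def)
  ultimately have "G 1 = cosh_integral" using G(1) by (simp add: zero_ereal_def one_ereal_def)
  moreover have "0 \<le> G y - G x \<and> G y - G x \<le> y - x" if "0 \<le> x" "x \<le> y" for x y
  proof (cases "x = y")
    case False
    have "\<exists>z. x < z \<and> z < y \<and> G y - G x = (y - x) * log_cosh_ratio z"
      by (rule MVT2) (use False that G(2) in auto)
    then obtain z where "x < z" "z < y" "G y - G x = (y - x) * log_cosh_ratio z" by blast
    then show ?thesis using log_cosh_ratio_bounds[of z] by (auto simp: mult_left_le)
  qed simp
  ultimately show ?thesis using that G by blast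
qed

lemma ln_1_plus_exp_bounds:
  assumes "0 \<le> (u::real)"
  shows "0 \<le> ln (1 + exp (- 2 * u))" "ln (1 + exp (- 2 * u)) \<le> ln 2" "ln (1 + exp (- 2 * u)) \<le> 1"
proof -
  show "0 \<le> ln (1 + exp (- 2 * u))" by (intro ln_ge_zero) simp
  show l2: "ln (1 + exp (- 2 * u)) \<le> ln 2" using assms by (subst ln_le_cancel_iff) (auto intro: add_pos_pos)
  show "ln (1 + exp (- 2 * u)) \<le> 1" using l2 ln_2_less_1 by linarith
qed

text \<open>\<open>J x\<close> is the integral from \<open>x\<close> to infinity. The integrand is
  at most 1/x^2, hence the bound 1/x.\<close>

lemma log_exp_antiderivative:
  obtains J where "\<And>x. 1 \<le> x \<Longrightarrow> (J has_real_derivative - (ln (1 + exp (- 2 * x)) / x\<^sup>2)) (at x)" "J 1 = exp_integral"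
    "\<And>x. 1 \<le> x \<Longrightarrow> 0 \<le> J x" "\<And>x. 1 \<le> x \<Longrightarrow> J x \<le> 1 / x"
    "\<And>x y. 1 \<le> x \<Longrightarrow> x \<le> y \<Longrightarrow> 0 \<le> J x - J y" "\<And>x y. 1 \<le> x \<Longrightarrow> x \<le> y \<Longrightarrow> J x - J y \<le> y - x"
proof -
  define \<psi> where "\<psi> = (\<lambda>u::real. ln (1 + exp (- 2 * u)) / u\<^sup>2)"
  have cont: "isCont \<psi> x" if "0 < x" for x
    unfolding \<psi>_def using that by (intro continuous_intros) (auto simp: add_pos_pos less_imp_neq[symmetric])
  obtain F where F: "F 1 = 0" "\<And>x. 1 \<le> x \<Longrightarrow> (F has_real_derivative \<psi> x) (at x)"
    using antiderivative_exists[of 0 \<psi> 1] cont by auto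
  have \<psi>0: "0 \<le> \<psi> x" "\<psi> x \<le> 1 / x\<^sup>2" if "1 \<le> x" for x
    using ln_1_plus_exp_bounds[of x] that by (auto simp: \<psi>_def divide_right_mono)
  have \<psi>1: "\<psi> x \<le> 1" if "1 \<le> x" for x
  proof -
    have "1 / x\<^sup>2 \<le> 1" using that by (simp add: one_le_power)
    then show ?thesis using \<psi>0(2)[OF that] by linarith
  qed
  have inc: "0 \<le> F y - F x \<and> F y - F x \<le> y - x" if "1 \<le> x" "x \<le> y" for x y
  proof (cases "x = y")
    case False
    have "\<exists>z. x < z \<and> z < y \<and> F y - F x = (y - x) * \<psi> z"
      by (rule MVT2) (use False that F(2) in auto)
    then obtain z where z: "x < z" "z < y" "F y - F x = (y - x) * \<psi> z" by blast
    then show ?thesis using \<psi>0[of z] \<psi>1[of z] that by (auto simp: mult_left_le)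
  qed simp
  have dec: "F y + 1 / y \<le> F x + 1 / x" if "1 \<le> x" "x \<le> y" for x y
  proof -
    have "(\<lambda>x. F x + 1 / x) y \<le> (\<lambda>x. F x + 1 / x) x"
    proof (rule DERIV_nonpos_imp_nonincreasing[OF that(2)])
      fix t assume t: "x \<le> t" "t \<le> y"
      have "((\<lambda>x. F x + 1 / x) has_real_derivative \<psi> t - 1 / t\<^sup>2) (at t)"
        using t that by (auto intro!: derivative_eq_intros F(2) simp: power2_eq_square)
      then show "\<exists>y. ((\<lambda>x. F x + 1 / x) has_real_derivative y) (at t) \<and> y \<le> 0"
        using \<psi>0(2)[of t] t that by (intro exI[of _ "\<psi> t - 1 / t\<^sup>2"]) auto
    qed
    then show ?thesis by simp
  qed
  have bd: "F x \<le> 1" if "1 \<le> x" for x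
  proof -
    have "0 \<le> 1 / x" using that by simp
    then show ?thesis using dec[of 1 x] F(1) that by linarith
  qed
  \<comment> \<open>A bounded nondecreasing antiderivative converges to its supremum; this is the
    value of the improper integral.\<close>
  define L where "L = Sup (F ` {1..})"
  have bdd: "bdd_above (F ` {1..})" using bd by (intro bdd_aboveI[of _ 1]) auto
  have upper: "F x \<le> L" if "1 \<le> x" for x unfolding L_def using bdd that by (intro cSup_upper) auto
  have lim: "(F \<longlongrightarrow> L) at_top"
  proof (rule order_tendstoI)
    fix a assume "a < L"
    then obtain x where x: "1 \<le> x" "a < F x" unfolding L_def using bdd by (subst (asm) less_cSup_iff) auto
    then have "a < F y" if "x \<le> y" for y using inc[of x y] that by linarith
    then show "eventually (\<lambda>y. a < F y) at_top" unfolding eventually_at_top_linorder by blast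
  next
    fix a assume "L < a"
    then have "F y < a" if "1 \<le> y" for y using upper[OF that] by linarith
    then show "eventually (\<lambda>y. F y < a) at_top" unfolding eventually_at_top_linorder by blast
  qed
  have "(LBINT u=ereal 1..\<infinity>. \<psi> u) = L - F 1"
  proof (rule interval_integral_FTC_nonneg(2))
    show "((F \<circ> real_of_ereal) \<longlongrightarrow> F 1) (at_right (ereal 1))"
      using DERIV_isCont[OF F(2)[of 1]] by (auto simp: ereal_tendsto_simps isCont_def filterlim_at_split)
    show "((F \<circ> real_of_ereal) \<longlongrightarrow> L) (at_left \<infinity>)" using lim by (simp add: ereal_tendsto_simps)
    show "AE x in lborel. ereal 1 < ereal x \<longrightarrow> ereal x < \<infinity> \<longrightarrow> 0 \<le> \<psi> x" using \<psi>0 by auto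
  qed (use F cont in auto)
  then have exp_integral: "L = exp_integral" using F(1) by (simp add: \<psi>_def one_ereal_def)
  show thesis
  proof (rule that[of "\<lambda>x. L - F x"])
    show "((\<lambda>x. L - F x) has_real_derivative - (ln (1 + exp (- 2 * x)) / x\<^sup>2)) (at x)" if "1 \<le> x" for x
      using F(2)[OF that] unfolding \<psi>_def by (auto intro!: derivative_eq_intros)
    show "L - F x \<le> 1 / x" if x: "1 \<le> x" for x
    proof -
      have "F y \<le> F x + 1 / x" if "1 \<le> y" for y
      proof (cases "x \<le> y")
        case True
        have "0 \<le> 1 / y" using that by simp
        then show ?thesis using dec[OF x True] by linarith
      next
        case False
        have "0 \<le> 1 / x" using x by simp
        then show ?thesis using inc[of y x] that False by linarith
      qed
      then have "L \<le> F x + 1 / x" unfolding L_def by (intro cSup_least) auto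
      then show ?thesis by simp
    qed
  qed (use upper inc exp_integral F(1) in \<open>auto simp: algebra_simps\<close>)
qed

lemma ln_cosh_split: "ln (cosh u) = u - ln 2 + ln (1 + exp (- 2 * u))" for u :: real
proof -
  have c: "cosh u = exp u * (1 + exp (- 2 * u)) / 2"
    by (simp add: cosh_def distrib_left exp_add[symmetric])
  have "0 < 1 + exp (- 2 * u)" by (simp add: add_pos_pos)
  then have "ln (exp u * (1 + exp (- 2 * u)) / 2) = u - ln 2 + ln (1 + exp (- 2 * u))"
    by (simp add: ln_mult ln_div)
  then show ?thesis by (simp only: c)
qed

text \<open>Under u = y/t the function t -> y J(y/t) is an antiderivative of the summand. As the
  summand is monotone and the odd points t are 2 apart, twice the sum is sandwiched between
  increments. The last odd point lies within 2 of \<open>y\<close>, so the upper endpoint misses y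
  J(1) by at most 6.\<close>

lemma sum_ln_1_plus_exp:
  assumes y: "2 * real m + 1 \<le> y" "y < 2 * real m + 3"
  shows "\<bar>2 * (\<Sum>b<Suc m. ln (1 + exp (- 2 * (y / (2 * real b + 1))))) - y * exp_integral\<bar> \<le> 7"
proof -
  obtain J where J: "\<And>x. 1 \<le> x \<Longrightarrow> (J has_real_derivative - (ln (1 + exp (- 2 * x)) / x\<^sup>2)) (at x)" "J 1 = exp_integral"
    "\<And>x. 1 \<le> x \<Longrightarrow> 0 \<le> J x" "\<And>x. 1 \<le> x \<Longrightarrow> J x \<le> 1 / x"
    "\<And>x y. 1 \<le> x \<Longrightarrow> x \<le> y \<Longrightarrow> 0 \<le> J x - J y" "\<And>x y. 1 \<le> x \<Longrightarrow> x \<le> y \<Longrightarrow> J x - J y \<le> y - x"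
    using log_exp_antiderivative by blast
  define k where "k = (\<lambda>t. ln (1 + exp (- 2 * (y / t))))"
  define F where "F = (\<lambda>t. y * J (y / t))"
  have y1: "1 \<le> y" using y by linarith
  have dF: "(F has_real_derivative k t) (at t)" if t: "0 < t" "t \<le> y" for t
  proof -
    have "1 \<le> y / t" using t by simp
    then have "(J has_real_derivative - (ln (1 + exp (- 2 * (y / t))) / (y / t)\<^sup>2)) (at (y / t))" by (rule J(1))
    moreover have "((\<lambda>t. y / t) has_real_derivative - y / t\<^sup>2) (at t)"
      using t by (auto intro!: derivative_eq_intros simp: power2_eq_square)
    ultimately have "((\<lambda>t. J (y / t)) has_real_derivative - (k t / (y / t)\<^sup>2) * (- y / t\<^sup>2)) (at t)"
      unfolding k_def by (rule DERIV_chain2)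
    then have "(F has_real_derivative y * (- (k t / (y / t)\<^sup>2) * (- y / t\<^sup>2))) (at t)"
      unfolding F_def by (rule DERIV_cmult)
    moreover have "y * (- (k t / (y / t)\<^sup>2) * (- y / t\<^sup>2)) = k t"
      using t y1 by (simp add: power2_eq_square field_simps)
    ultimately show ?thesis by simp
  qed
  have kmono: "k t \<le> k t'" if "0 < t" "t \<le> t'" for t t'
  proof -
    have "y / t' \<le> y / t" using that y1 by (intro divide_left_mono) auto
    then show ?thesis unfolding k_def by (subst ln_le_cancel_iff) (auto intro: add_pos_pos)
  qed
  have step: "2 * k t \<le> F (t + 2) - F t \<and> F (t + 2) - F t \<le> 2 * k (t + 2)" if t: "0 < t" "t + 2 \<le> y" for t
  proof -
    have "\<exists>z. t < z \<and> z < t + 2 \<and> F (t + 2) - F t = (t + 2 - t) * k z"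
      by (rule MVT2) (use dF t in auto)
    then obtain z where z: "t < z" "z < t + 2" "F (t + 2) - F t = 2 * k z" by auto
    then show ?thesis using kmono[of t z] kmono[of z "t + 2"] t by auto
  qed
  define o1 where "o1 = (\<lambda>b::nat. 2 * real b + 1)"
  have o1: "o1 (Suc b) = o1 b + 2" "0 < o1 b" for b by (auto simp: o1_def)
  have le: "o1 b + 2 \<le> y" if "b < m" for b
  proof -
    have "real b + 1 \<le> real m" using that by linarith
    then show ?thesis using y by (simp add: o1_def)
  qed
  have tel: "(\<Sum>b<m. F (o1 (Suc b)) - F (o1 b)) = F (o1 m) - F 1"
    by (subst sum_lessThan_telescope) (simp add: o1_def)
  have x1: "1 \<le> y / o1 m" using y by (simp add: o1_def)
  have k01: "0 \<le> k t" "k t \<le> 1" if "0 < t" for t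
    unfolding k_def using that y1 ln_1_plus_exp_bounds[of "y / t"] by auto
  have F1: "0 \<le> F 1" "F 1 \<le> 1"
  proof -
    show "0 \<le> F 1" unfolding F_def using J(3)[of y] y1 by simp
    have "y * J y \<le> y * (1 / y)" using J(4)[of y] y1 by (intro mult_left_mono) auto
    then show "F 1 \<le> 1" using y1 by (simp add: F_def)
  qed
  have Fm: "y * exp_integral - 6 \<le> F (o1 m)" "F (o1 m) \<le> y * exp_integral"
  proof -
    have "J 1 - J (y / o1 m) \<le> y / o1 m - 1" using J(6)[of 1 "y / o1 m"] x1 by simp
    then have "y * (J 1 - J (y / o1 m)) \<le> y * (y / o1 m - 1)" using y1 by (intro mult_left_mono) auto
    also have "\<dots> = (y / o1 m) * (y - o1 m)" using o1(2)[of m] by (simp add: field_simps)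
    also have "\<dots> \<le> 3 * 2"
    proof (intro mult_mono)
      have "y \<le> 3 * o1 m" using y by (simp add: o1_def)
      then show "y / o1 m \<le> 3" using o1(2)[of m] by (simp add: divide_le_eq)
    qed (use y in \<open>auto simp: o1_def\<close>)
    finally show "y * exp_integral - 6 \<le> F (o1 m)" by (simp add: F_def J(2) algebra_simps)
    have "J (y / o1 m) \<le> J 1" using J(5)[of 1 "y / o1 m"] x1 by simp
    then show "F (o1 m) \<le> y * exp_integral" unfolding F_def J(2)[symmetric] using y1 by (intro mult_left_mono) auto
  qed
  have "(\<Sum>b<m. 2 * k (o1 b)) \<le> (\<Sum>b<m. F (o1 (Suc b)) - F (o1 b))"
    using step le o1 by (intro sum_mono) auto
  then have up: "2 * (\<Sum>b<Suc m. k (o1 b)) \<le> F (o1 m) - F 1 + 2"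
    unfolding tel using k01(2)[OF o1(2)[of m]] by (simp add: sum_distrib_left)
  have "(\<Sum>b<m. F (o1 (Suc b)) - F (o1 b)) \<le> (\<Sum>b<m. 2 * k (o1 (Suc b)))"
    using step le o1 by (intro sum_mono) auto
  also have "\<dots> \<le> 2 * (\<Sum>b<Suc m. k (o1 b))"
    using k01(1)[OF o1(2)[of 0]] by (subst sum.lessThan_Suc_shift) (simp add: sum_distrib_left)
  finally have lo: "F (o1 m) - F 1 \<le> 2 * (\<Sum>b<Suc m. k (o1 b))" unfolding tel .
  have "\<bar>2 * (\<Sum>b<Suc m. k (o1 b)) - y * exp_integral\<bar> \<le> 7"
    using up lo F1 Fm by linarith
  then show ?thesis by (simp only: k_def o1_def)
qed

text \<open>The same comparison beyond \<open>y\<close>, with the antiderivative t -> - y G(y/t).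
  Stopping at the last index instead of infinity costs at most y^2 / (2 (M + N) + 1), which is where
  the lower bound on \<open>M + N\<close> enters.\<close>

lemma sum_ln_cosh_tail:
  assumes y: "1 \<le> y" "y \<le> 2 * real M + 1" "2 * real M - 1 \<le> y" and n: "y\<^sup>2 \<le> real (M + N)"
  shows "\<bar>2 * (\<Sum>b<N. ln (cosh (y / (2 * real (M + b) + 1)))) - y * cosh_integral\<bar> \<le> 3"
proof -
  obtain G where G: "\<And>x. 0 \<le> x \<Longrightarrow> (G has_real_derivative log_cosh_ratio x) (at x)" "G 0 = 0" "G 1 = cosh_integral"
    "\<And>x y. 0 \<le> x \<Longrightarrow> x \<le> y \<Longrightarrow> 0 \<le> G y - G x" "\<And>x y. 0 \<le> x \<Longrightarrow> x \<le> y \<Longrightarrow> G y - G x \<le> y - x"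
    using log_cosh_antiderivative by blast
  define h where "h = (\<lambda>t. ln (cosh (y / t)))"
  define F where "F = (\<lambda>t. - y * G (y / t))"
  have dF: "(F has_real_derivative h t) (at t)" if t: "0 < t" for t
  proof -
    have x0: "0 < y / t" using t y by simp
    then have "(G has_real_derivative log_cosh_ratio (y / t)) (at (y / t))" by (intro G(1)) simp
    moreover have "((\<lambda>t. y / t) has_real_derivative - y / t\<^sup>2) (at t)"
      using t by (auto intro!: derivative_eq_intros simp: power2_eq_square)
    ultimately have "((\<lambda>t. G (y / t)) has_real_derivative log_cosh_ratio (y / t) * (- y / t\<^sup>2)) (at t)"
      by (rule DERIV_chain2)
    then have "(F has_real_derivative - y * (log_cosh_ratio (y / t) * (- y / t\<^sup>2))) (at t)"
      unfolding F_def by (rule DERIV_cmult)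
    moreover have "- y * (log_cosh_ratio (y / t) * (- y / t\<^sup>2)) = h t"
      using t y by (simp add: log_cosh_ratio_def h_def power2_eq_square field_simps)
    ultimately show ?thesis by simp
  qed
  have hmono: "h t' \<le> h t" if "0 < t" "t \<le> t'" for t t'
  proof -
    have "y / t' \<le> y / t" using that y by (intro divide_left_mono) auto
    moreover have "0 \<le> y / t'" using that y by simp
    ultimately show ?thesis unfolding h_def using ln_cosh_diff(1)[of "y / t'" "y / t"] by simp
  qed
  have step: "2 * h (t + 2) \<le> F (t + 2) - F t \<and> F (t + 2) - F t \<le> 2 * h t" if t: "0 < t" for t
  proof -
    have "\<exists>z. t < z \<and> z < t + 2 \<and> F (t + 2) - F t = (t + 2 - t) * h z"
      by (rule MVT2) (use dF t in auto)
    then obtain z where z: "t < z" "z < t + 2" "F (t + 2) - F t = 2 * h z" by auto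
    then show ?thesis using hmono[of t z] hmono[of z "t + 2"] t by auto
  qed
  define o1 where "o1 = (\<lambda>b::nat. 2 * real (M + b) + 1)"
  have o1: "o1 (Suc b) = o1 b + 2" "0 < o1 b" for b by (auto simp: o1_def)
  have tel: "(\<Sum>b<n. F (o1 (Suc b)) - F (o1 b)) = F (o1 n) - F (o1 0)" for n
    by (subst sum_lessThan_telescope) simp
  have q0: "0 \<le> y / o1 b" for b using y o1(2)[of b] by simp
  have q1: "y / o1 0 \<le> 1" using y by (simp add: o1_def)
  have Fn: "F (o1 b) \<le> 0" for b
    unfolding F_def using y G(4)[of 0 "y / o1 b"] G(2) q0[of b] by simp
  have F0: "- (y * cosh_integral) \<le> F (o1 0)" "F (o1 0) \<le> - (y * cosh_integral) + 2"
  proof -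
    have "G (y / o1 0) \<le> G 1" using G(4)[of "y / o1 0" 1] q0[of 0] q1 by simp
    then have "y * G (y / o1 0) \<le> y * G 1" using y by (intro mult_left_mono) auto
    then show "- (y * cosh_integral) \<le> F (o1 0)" by (simp add: F_def G(3))
    have "G 1 - G (y / o1 0) \<le> 1 - y / o1 0" using G(5)[of "y / o1 0" 1] q0[of 0] q1 by simp
    then have "y * (G 1 - G (y / o1 0)) \<le> y * (1 - y / o1 0)" using y by (intro mult_left_mono) auto
    also have "\<dots> = (y / o1 0) * (o1 0 - y)" using o1(2)[of 0] by (simp add: field_simps)
    also have "\<dots> \<le> 1 * 2" using q1 q0[of 0] y by (intro mult_mono) (auto simp: o1_def)
    finally show "F (o1 0) \<le> - (y * cosh_integral) + 2" by (simp add: F_def G(3) algebra_simps)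
  qed
  have FN: "- 1 \<le> F (o1 N)"
  proof -
    have "G (y / o1 N) \<le> y / o1 N" using G(5)[of 0 "y / o1 N"] G(2) q0[of N] by simp
    then have "y * G (y / o1 N) \<le> y * (y / o1 N)" using y by (intro mult_left_mono) auto
    also have "\<dots> = y\<^sup>2 / o1 N" by (simp add: power2_eq_square)
    also have "\<dots> \<le> 1" using n o1(2)[of N] by (simp add: divide_le_eq o1_def)
    finally show ?thesis by (simp add: F_def)
  qed
  have h0: "0 \<le> h t" for t unfolding h_def by (rule ln_cosh_nonneg)
  have h1: "h (o1 0) \<le> 1"
  proof -
    have "h (o1 0) \<le> (y / o1 0)\<^sup>2" unfolding h_def by (rule ln_cosh_le)
    also have "\<dots> \<le> 1" using q0[of 0] q1 by (simp add: power_le_one)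
    finally show ?thesis .
  qed
  have "(\<Sum>b<N. F (o1 (Suc b)) - F (o1 b)) \<le> (\<Sum>b<N. 2 * h (o1 b))"
    using step o1 by (intro sum_mono) auto
  then have lo: "F (o1 N) - F (o1 0) \<le> 2 * (\<Sum>b<N. h (o1 b))" unfolding tel by (simp add: sum_distrib_left)
  have up: "2 * (\<Sum>b<N. h (o1 b)) \<le> 2 - F (o1 0)"
  proof (cases N)
    case 0
    then show ?thesis using Fn[of 0] by simp
  next
    case (Suc k)
    have "(\<Sum>b<k. 2 * h (o1 (Suc b))) \<le> (\<Sum>b<k. F (o1 (Suc b)) - F (o1 b))"
      using step o1 by (intro sum_mono) auto
    then have "2 * (\<Sum>b<k. h (o1 (Suc b))) \<le> F (o1 k) - F (o1 0)" unfolding tel by (simp add: sum_distrib_left)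
    moreover have "(\<Sum>b<N. h (o1 b)) = h (o1 0) + (\<Sum>b<k. h (o1 (Suc b)))"
      unfolding Suc by (rule sum.lessThan_Suc_shift)
    ultimately show ?thesis using h1 Fn[of k] by simp
  qed
  have "\<bar>2 * (\<Sum>b<N. h (o1 b)) - y * cosh_integral\<bar> \<le> 3"
    using lo up F0 FN by linarith
  then show ?thesis by (simp only: h_def o1_def)
qed

section \<open>Harmonic sums and the asymptotic formula for the limiting weights\<close>

lemma harm_approx:
  assumes "1 \<le> n"
  shows "\<bar>harm n - ln (real n) - euler_mascheroni\<bar> \<le> 1 / real n"
proof -
  have e: "euler_mascheroni \<in> {harm n - ln (real (Suc n)) + inverse (real (2 * (n + 1)))..harm n - ln (real (Suc n)) + inverse (real (2 * n))}"
    using euler_mascheroni_bounds[OF assms] by simp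
  have "ln (real (Suc n) / real n) \<le> real (Suc n) / real n - 1" using assms by (intro ln_le_minus_one) auto
  then have "ln (real (Suc n)) - ln (real n) \<le> 1 / real n" using assms by (simp add: ln_div field_simps)
  moreover have "ln (real n) \<le> ln (real (Suc n))" using assms by simp
  moreover have "0 \<le> inverse (real (2 * (n + 1)))" "inverse (real (2 * n)) \<le> 1 / real n"
    using assms by (auto simp: field_simps)
  ultimately show ?thesis using e unfolding atLeastAtMost_iff by linarith
qed

lemma sum_odd_reciprocals: "2 * (\<Sum>b<M. 1 / (2 * real b + 1)) = 2 * harm (2 * M) - harm M"
proof (induction M)
  case (Suc M)
  have "harm (2 * Suc M) = harm (2 * M) + 1 / (2 * real M + 1) + 1 / (2 * real M + 2)"
    by (simp add: harm_Suc inverse_eq_divide add.commute)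
  moreover have "2 * (1 / (2 * real M + 2)) = inverse (real (Suc M))" by (simp add: field_simps)
  ultimately show ?case using Suc by (simp add: harm_Suc algebra_simps)
qed (simp add: harm_def)

text \<open>The sum is cut where 2b + 1 passes \<open>y\<close>. Above the cut the terms give
  \<open>cosh_integral\<close>; below it ln cosh u = u - ln 2 + ln (1 + exp (-2u)), whose last part
  gives \<open>exp_integral\<close>. The linear part is y times an odd harmonic sum, worth ln (2M) +
  ln 2 + gamma, and this y ln 2 cancels the 2M ln 2 from the constants because 2M is within 1 of
  \<open>y\<close>.\<close>

theorem sum_ln_cosh_asymptotic:
  assumes y: "1 \<le> y" and n: "y\<^sup>2 \<le> real n"
  shows "\<bar>2 * (\<Sum>b<n. ln (cosh (y / (2 * real b + 1)))) - y * (ln y + euler_mascheroni + cosh_integral + exp_integral)\<bar> \<le> 20"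
proof -
  define m where "m = nat \<lfloor>(y - 1) / 2\<rfloor>"
  have "real m = real_of_int \<lfloor>(y - 1) / 2\<rfloor>" using y by (simp add: m_def)
  then have "real m \<le> (y - 1) / 2" "(y - 1) / 2 < real m + 1" using floor_correct[of "(y - 1) / 2"] by auto
  then have m: "2 * real m + 1 \<le> y" "y < 2 * real m + 3" by auto
  define M where "M = Suc m"
  have M: "2 * real M - 1 \<le> y" "y < 2 * real M + 1" "1 \<le> real M" using m by (auto simp: M_def)
  have "y \<le> y\<^sup>2" using y by (simp add: power2_eq_square)
  then have "y \<le> real n" using n by linarith
  then have "real M \<le> real n" using M by linarith
  then obtain N where N: "n = M + N" by (metis le_iff_add of_nat_le_iff)
  have sum_split: "sum g {..<M + k} = sum g {..<M} + (\<Sum>b<k. g (M + b))" for g :: "nat \<Rightarrow> real" and k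
    by (induction k) simp_all
  define A where "A = (\<Sum>b<M. ln (1 + exp (- 2 * (y / (2 * real b + 1)))))"
  define T where "T = (\<Sum>b<N. ln (cosh (y / (2 * real (M + b) + 1))))"
  have "(\<Sum>b<n. ln (cosh (y / (2 * real b + 1)))) = (\<Sum>b<M. ln (cosh (y / (2 * real b + 1)))) + T"
    unfolding N T_def by (rule sum_split)
  also have "(\<Sum>b<M. ln (cosh (y / (2 * real b + 1)))) = (\<Sum>b<M. y * (1 / (2 * real b + 1)) - ln 2) + A"
    unfolding A_def ln_cosh_split by (simp add: sum.distrib)
  also have "(\<Sum>b<M. y * (1 / (2 * real b + 1)) - ln 2) = y * (\<Sum>b<M. 1 / (2 * real b + 1)) - real M * ln 2"
    by (simp only: sum_subtractf sum_distrib_left) simp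
  finally have split: "2 * (\<Sum>b<n. ln (cosh (y / (2 * real b + 1)))) =
      y * (2 * (\<Sum>b<M. 1 / (2 * real b + 1))) - 2 * real M * ln 2 + 2 * A + 2 * T" by (simp add: algebra_simps)
  have a1: "\<bar>2 * A - y * exp_integral\<bar> \<le> 7"
    unfolding A_def M_def by (rule sum_ln_1_plus_exp[OF m])
  have a2: "\<bar>2 * T - y * cosh_integral\<bar> \<le> 3"
    unfolding T_def using sum_ln_cosh_tail[of y M N] y M n N by simp
  have h1: "\<bar>harm (2 * M) - ln (real (2 * M)) - euler_mascheroni\<bar> \<le> 1 / real (2 * M)"
    and h2: "\<bar>harm M - ln (real M) - euler_mascheroni\<bar> \<le> 1 / real M"
    by (rule harm_approx; simp add: M_def)+
  define E where "E = 2 * harm (2 * M) - harm M - (ln (2 * real M) + ln 2 + euler_mascheroni)"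
  have "ln (real (2 * M)) = ln 2 + ln (real M)" using M by (simp add: ln_mult)
  then have "\<bar>E\<bar> \<le> 2 * (1 / real (2 * M)) + 1 / real M"
    using h1 h2 unfolding E_def by (simp add: abs_le_iff)
  also have "\<dots> = 2 / real M" by simp
  finally have E: "\<bar>E\<bar> \<le> 2 / real M" .
  have "\<bar>y * E\<bar> = y * \<bar>E\<bar>" using y by (simp add: abs_mult)
  also have "\<dots> \<le> y * (2 / real M)" using E y by (intro mult_left_mono) auto
  also have "\<dots> \<le> 6" using M by (simp add: divide_le_eq)
  finally have a3: "\<bar>y * E\<bar> \<le> 6" .
  have a4: "\<bar>y * (ln (2 * real M) - ln y)\<bar> \<le> 2"
  proof (cases "y \<le> 2 * real M")
    case True
    have "ln (2 * real M) - ln y = ln (2 * real M / y)" using y M by (simp add: ln_div)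
    also have "\<dots> \<le> 2 * real M / y - 1" using y M by (intro ln_le_minus_one) auto
    finally have "y * (ln (2 * real M) - ln y) \<le> y * (2 * real M / y - 1)" using y by (intro mult_left_mono) auto
    also have "\<dots> = 2 * real M - y" using y by (simp add: field_simps)
    finally have "y * (ln (2 * real M) - ln y) \<le> 1" using M by linarith
    moreover have "0 \<le> y * (ln (2 * real M) - ln y)" using True y by (intro mult_nonneg_nonneg) auto
    ultimately show ?thesis by linarith
  next
    case False
    have "ln y - ln (2 * real M) = ln (y / (2 * real M))" using y M by (simp add: ln_div)
    also have "\<dots> \<le> y / (2 * real M) - 1" using y M by (intro ln_le_minus_one) auto
    also have "\<dots> = (y - 2 * real M) / (2 * real M)" using M by (simp add: field_simps)
    also have "\<dots> \<le> 1 / (2 * real M)" using M by (intro divide_right_mono) auto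
    finally have "y * (ln y - ln (2 * real M)) \<le> y * (1 / (2 * real M))" using y by (intro mult_left_mono) auto
    also have "\<dots> \<le> 2" using M by (simp add: divide_le_eq)
    finally have "y * (ln y - ln (2 * real M)) \<le> 2" .
    moreover have "0 \<le> y * (ln y - ln (2 * real M))" using False y M by (intro mult_nonneg_nonneg) auto
    ultimately show ?thesis by (simp add: algebra_simps)
  qed
  have a5: "\<bar>(y - 2 * real M) * ln 2\<bar> \<le> 1"
  proof -
    have "\<bar>y - 2 * real M\<bar> * ln 2 \<le> 1 * 1" using M ln_2_less_1 by (intro mult_mono) auto
    then show ?thesis by (simp add: abs_mult)
  qed
  have "2 * (\<Sum>b<n. ln (cosh (y / (2 * real b + 1)))) - y * (ln y + euler_mascheroni + cosh_integral + exp_integral) =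
     y * E + y * (ln (2 * real M) - ln y) + (y - 2 * real M) * ln 2 + (2 * A - y * exp_integral) + (2 * T - y * cosh_integral)"
    unfolding split sum_odd_reciprocals E_def by (simp add: algebra_simps)
  then show ?thesis using a1 a2 a3 a4 a5 by linarith
qed

section \<open>The cotangent weights and their cumulant\<close>

lemma cot_weight_reflect:
  assumes "b < p"
  shows "cot_weight p (p - 1 - b) = - cot_weight p b"
proof -
  have "real (p - 1 - b) = real p - 1 - real b" using assms by (simp add: of_nat_diff)
  then have "pi * (real (p - 1 - b) + 1 / 2) / real p = pi - pi * (real b + 1 / 2) / real p"
    using assms by (simp add: field_simps)
  then show ?thesis by (simp add: cot_weight_def cot_def)
qed

lemma sum_cot_weight_even:
  fixes F :: "real \<Rightarrow> real"
  assumes p: "p = 2 * n + 1" and F: "\<And>x. F (- x) = F x" "F 0 = 0"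
  shows "(\<Sum>b<p. F (cot_weight p b)) = 2 * (\<Sum>b<n. F (cot_weight p b))"
proof -
  have "pi * (real n + 1 / 2) / real p = pi / 2" unfolding p by (simp add: field_simps)
  then have mid: "cot_weight p n = 0" unfolding cot_weight_def cot_def by (simp only: cos_pi_half div_0)
  have "{..<p} = {..<n} \<union> insert n {n<..<p}" unfolding p by auto
  then have "(\<Sum>b<p. F (cot_weight p b)) = (\<Sum>b\<in>{..<n} \<union> insert n {n<..<p}. F (cot_weight p b))" by simp
  also have "\<dots> = (\<Sum>b<n. F (cot_weight p b)) + (\<Sum>b\<in>insert n {n<..<p}. F (cot_weight p b))"
    by (rule sum.union_disjoint) auto
  also have "(\<Sum>b\<in>insert n {n<..<p}. F (cot_weight p b)) = (\<Sum>b\<in>{n<..<p}. F (cot_weight p b))"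
    using mid F(2) by simp
  also have "\<dots> = (\<Sum>b<n. F (cot_weight p b))"
  proof (rule sum.reindex_bij_witness[of _ "\<lambda>b. p - 1 - b" "\<lambda>b. p - 1 - b"])
    fix b assume b: "b \<in> {n<..<p}"
    then show "F (cot_weight p (p - 1 - b)) = F (cot_weight p b)"
      using cot_weight_reflect[of b p] F(1) by simp
  qed (auto simp: p)
  finally show ?thesis by simp
qed

lemma cot_bounds:
  assumes x: "0 < x" "x < pi / 2"
  shows "0 \<le> cot x" "cot x \<le> 1 / x" "1 / x - x / 2 \<le> cot x"
proof -
  have s: "0 < sin x" and c: "0 < cos x" using x by (auto intro: sin_gt_zero cos_gt_zero)
  show c0: "0 \<le> cot x" using s c by (simp add: cot_def)
  have "(\<lambda>x. sin x - x * cos x) 0 \<le> (\<lambda>x. sin x - x * cos x) x"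
  proof (rule DERIV_nonneg_imp_nondecreasing[OF less_imp_le[OF x(1)]])
    fix t assume t: "0 \<le> t" "t \<le> x"
    have "((\<lambda>x. sin x - x * cos x) has_real_derivative t * sin t) (at t)"
      by (auto intro!: derivative_eq_intros)
    moreover have "0 \<le> t * sin t" using t x by (intro mult_nonneg_nonneg sin_ge_zero) auto
    ultimately show "\<exists>y. ((\<lambda>x. sin x - x * cos x) has_real_derivative y) (at t) \<and> 0 \<le> y" by blast
  qed
  then have "x * cos x \<le> sin x" by simp
  then show "cot x \<le> 1 / x" using x s by (simp add: cot_def field_simps)
  show "1 / x - x / 2 \<le> cot x"
  proof (cases "1 - x\<^sup>2 / 2 \<le> 0")
    case True
    then have "1 / x - x / 2 \<le> 0" using x by (simp add: field_simps power2_eq_square)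
    then show ?thesis using c0 by linarith
  next
    case False
    have "sin (x / 2) \<le> x / 2" using x by (intro sin_x_le_x) auto
    moreover have "0 \<le> sin (x / 2)" using x by (intro sin_ge_zero) auto
    ultimately have "(sin (x / 2))\<^sup>2 \<le> (x / 2)\<^sup>2" by (intro power_mono) auto
    moreover have "cos x = 1 - 2 * (sin (x / 2))\<^sup>2" using cos_double_sin[of "x / 2"] by simp
    ultimately have "1 - x\<^sup>2 / 2 \<le> cos x" by (simp add: power_divide)
    then have "(1 - x\<^sup>2 / 2) / x \<le> cos x / sin x"
      using False s x sin_x_le_x[of x] by (intro frac_le) auto
    then show ?thesis using x by (simp add: cot_def field_simps power2_eq_square)
  qed
qed

text \<open>Replacing cot x by 1/x yields \<open>\<alpha>\<close>, which no longer depends on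
  \<open>p\<close>: these are the limiting weights. The correction is at most x/2, divided by
  \<open>p\<close>.\<close>

lemma cot_weight_bounds:
  assumes p: "p = 2 * n + 1" and b: "b < n"
  defines "\<alpha> \<equiv> 2 / (pi * (2 * real b + 1))"
  shows "0 \<le> cot_weight p b" "cot_weight p b \<le> \<alpha>" "\<alpha> - cot_weight p b \<le> pi * (2 * real b + 1) / (4 * (real p)\<^sup>2)"
proof -
  define x where "x = pi * (real b + 1 / 2) / real p"
  have p0: "0 < real p" using p by simp
  have x0: "0 < x" unfolding x_def using p0 by (intro divide_pos_pos mult_pos_pos) auto
  have "real b + 1 / 2 < real p / 2" using b unfolding p by simp
  then have "pi * (real b + 1 / 2) < pi * (real p / 2)" by (intro mult_strict_left_mono) auto
  then have x1: "x < pi / 2" using p0 by (simp add: x_def divide_less_eq)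
  have w: "cot_weight p b = cot x / real p" by (simp add: cot_weight_def x_def)
  have "x * real p = pi * (2 * real b + 1) / 2" using p0 by (simp add: x_def field_simps)
  then have ax: "1 / x / real p = \<alpha>" by (simp only: divide_divide_eq_left) (simp add: \<alpha>_def)
  show "0 \<le> cot_weight p b" unfolding w using cot_bounds(1)[OF x0 x1] p0 by simp
  show "cot_weight p b \<le> \<alpha>" unfolding w ax[symmetric] using cot_bounds(2)[OF x0 x1] p0 by (intro divide_right_mono) auto
  have "(1 / x - x / 2) / real p \<le> cot x / real p" using cot_bounds(3)[OF x0 x1] p0 by (intro divide_right_mono) auto
  then have "\<alpha> - x / 2 / real p \<le> cot_weight p b" unfolding w using ax by (simp add: diff_divide_distrib)
  moreover have "x / 2 / real p = pi * (2 * real b + 1) / (4 * (real p)\<^sup>2)"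
    using p0 by (simp add: x_def field_simps power2_eq_square)
  ultimately show "\<alpha> - cot_weight p b \<le> pi * (2 * real b + 1) / (4 * (real p)\<^sup>2)" by linarith
qed

definition saddle_const :: real where
  "saddle_const = ln (2 / pi) + euler_mascheroni + cosh_integral + exp_integral"

text \<open>Passing to the limiting weights changes each ln cosh by at most s^2 / (2 p^2): the
  weight falls like 1/(2b + 1) while its deviation grows like 2b + 1, so their product is uniform in
  \<open>b\<close>. Altogether this costs at most 1, and 20 comes from the limiting sum at y = 2 s /
  pi.\<close>

theorem cumulant_cot_weight:
  assumes p: "p = 2 * n + 1" and s: "2 \<le> s" "4 * s\<^sup>2 \<le> real p"
  shows "\<bar>cumulant p (cot_weight p) s - 2 / pi * s * (ln s + saddle_const)\<bar> \<le> 21"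
proof -
  define y where "y = 2 * s / pi"
  define \<alpha> where "\<alpha> = (\<lambda>b::nat. 2 / (pi * (2 * real b + 1)))"
  have p0: "0 < real p" using p by simp
  have y1: "1 \<le> y" using s pi_less_4 by (simp add: y_def)
  have ys: "y \<le> s" using s pi_ge_two by (simp add: y_def divide_le_eq mult.commute)
  have "2\<^sup>2 \<le> s\<^sup>2" using s(1) by (intro power_mono) auto
  then have n1: "1 \<le> real n" using s(2) p by simp
  have "y\<^sup>2 \<le> s\<^sup>2" using ys y1 by (intro power_mono) auto
  then have yn: "y\<^sup>2 \<le> real n" using s(2) n1 unfolding p by simp
  have \<alpha>s: "\<alpha> b * s = y / (2 * real b + 1)" for b by (simp add: \<alpha>_def y_def field_simps)
  have cum: "cumulant p (cot_weight p) s = 2 * (\<Sum>b<n. ln (cosh (cot_weight p b * s)))"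
    unfolding cumulant_def using sum_cot_weight_even[OF p, of "\<lambda>x. ln (cosh (x * s))"] by simp
  have bd: "0 \<le> ln (cosh (\<alpha> b * s)) - ln (cosh (cot_weight p b * s)) \<and>
      ln (cosh (\<alpha> b * s)) - ln (cosh (cot_weight p b * s)) \<le> s\<^sup>2 / (2 * (real p)\<^sup>2)" if b: "b < n" for b
  proof -
    note w = cot_weight_bounds[OF p b, folded \<alpha>_def]
    have w': "0 \<le> cot_weight p b" "cot_weight p b \<le> \<alpha> b" "\<alpha> b - cot_weight p b \<le> pi * (2 * real b + 1) / (4 * (real p)\<^sup>2)"
      using w by (auto simp: \<alpha>_def)
    have le: "0 \<le> cot_weight p b * s" "cot_weight p b * s \<le> \<alpha> b * s" using w' s by (auto intro: mult_right_mono)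
    have "\<alpha> b * s * (\<alpha> b * s - cot_weight p b * s) = s\<^sup>2 * (\<alpha> b * (\<alpha> b - cot_weight p b))"
      by (simp add: power2_eq_square algebra_simps)
    also have "\<dots> \<le> s\<^sup>2 * (\<alpha> b * (pi * (2 * real b + 1) / (4 * (real p)\<^sup>2)))"
      using w' by (intro mult_left_mono) auto
    also have "\<dots> = s\<^sup>2 / (2 * (real p)\<^sup>2)"
    proof -
      define w where "w = pi * (2 * real b + 1)"
      have "w \<noteq> 0" by (simp add: w_def)
      then show ?thesis unfolding \<alpha>_def w_def[symmetric] by simp
    qed
    finally show ?thesis using ln_cosh_diff[OF le] by linarith
  qed
  have "0 \<le> (\<Sum>b<n. ln (cosh (\<alpha> b * s)) - ln (cosh (cot_weight p b * s)))"
    using bd by (intro sum_nonneg) auto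
  moreover have "(\<Sum>b<n. ln (cosh (\<alpha> b * s)) - ln (cosh (cot_weight p b * s))) \<le> (\<Sum>b<n. s\<^sup>2 / (2 * (real p)\<^sup>2))"
    using bd by (intro sum_mono) auto
  moreover have "(\<Sum>b<n. s\<^sup>2 / (2 * (real p)\<^sup>2)) \<le> 1 / 2"
  proof -
    have "real n * s\<^sup>2 \<le> real p * real p" using s(2) zero_le_power2[of s] by (intro mult_mono) (auto simp: p)
    then show ?thesis using p0 by (simp add: divide_le_eq power2_eq_square)
  qed
  ultimately have d: "\<bar>2 * (\<Sum>b<n. ln (cosh (\<alpha> b * s))) - cumulant p (cot_weight p) s\<bar> \<le> 1"
    unfolding cum sum_subtractf by linarith
  have "\<bar>2 * (\<Sum>b<n. ln (cosh (\<alpha> b * s))) - y * (ln y + euler_mascheroni + cosh_integral + exp_integral)\<bar> \<le> 20"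
    unfolding \<alpha>s by (rule sum_ln_cosh_asymptotic[OF y1 yn])
  moreover have "y * (ln y + euler_mascheroni + cosh_integral + exp_integral) = 2 / pi * s * (ln s + saddle_const)"
  proof -
    have "ln y = ln (2 / pi) + ln s" using s by (simp add: y_def ln_mult ln_div)
    then show ?thesis by (simp add: y_def saddle_const_def)
  qed
  ultimately show ?thesis using d by linarith
qed

lemma C2_minus_saddle: "C2_minus = 2 / pi * exp (- saddle_const - 1)"
proof -
  have "ln (2 / pi) = - ln (pi / 2)" by (simp add: ln_div)
  then show ?thesis by (simp add: C2_minus_def saddle_const_def algebra_simps)
qed

text \<open>From cosh^2 = 1 + sinh^2 >= 1 + a^2 s^2 and a <= 1/(b + 1), each term is at most 1/((b +
  1)^2 + s^2). That is dominated by an increment of arctan (b/s)/s, so the sum telescopes to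
  O(1/s).\<close>

lemma cumulant''_cot_weight:
  assumes p: "p = 2 * n + 1" and s: "0 < s"
  shows "cumulant'' p (cot_weight p) s \<le> 4 / s"
proof -
  have bd: "(cot_weight p b)\<^sup>2 / (cosh (cot_weight p b * s))\<^sup>2 \<le> (arctan (real (Suc b) / s) - arctan (real b / s)) / s" if b: "b < n" for b
  proof -
    define a where "a = cot_weight p b"
    have a0: "0 \<le> a" using cot_weight_bounds[OF p b] by (simp add: a_def)
    have "a \<le> 2 / (pi * (2 * real b + 1))" using cot_weight_bounds[OF p b] by (simp add: a_def)
    also have "\<dots> \<le> 1 / (real b + 1)"
    proof -
      have "2 * (real b + 1) \<le> 2 * (2 * real b + 1)" by simp
      also have "\<dots> \<le> pi * (2 * real b + 1)" using pi_ge_two by (intro mult_right_mono) auto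
      finally show ?thesis by (simp add: field_simps)
    qed
    finally have "a * (real b + 1) \<le> 1" by (simp add: field_simps)
    then have ab: "(a * (real b + 1))\<^sup>2 \<le> 1" using a0 by (intro power_le_one) auto
    have "(a * s)\<^sup>2 \<le> (sinh (a * s))\<^sup>2"
    proof -
      have "a * s \<le> sinh (a * s)"
      proof -
        have as: "0 \<le> a * s" using a0 s by simp
        have "(\<lambda>x. sinh x - x) 0 \<le> (\<lambda>x. sinh x - x) (a * s)"
        proof (rule DERIV_nonneg_imp_nondecreasing[OF as])
          fix t :: real
          have "((\<lambda>x. sinh x - x) has_real_derivative cosh t - 1) (at t)" by (auto intro!: derivative_eq_intros)
          moreover have "0 \<le> cosh t - 1" using cosh_real_ge_1[of t] by simp
          ultimately show "\<exists>y. ((\<lambda>x. sinh x - x) has_real_derivative y) (at t) \<and> 0 \<le> y" by blast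
        qed
        then show ?thesis by simp
      qed
      then show ?thesis using a0 s by (intro power_mono) auto
    qed
    then have ch: "1 + a\<^sup>2 * s\<^sup>2 \<le> (cosh (a * s))\<^sup>2" by (simp add: cosh_square_eq power_mult_distrib)
    have pos: "0 < 1 + a\<^sup>2 * s\<^sup>2" by (simp add: add_pos_nonneg)
    have "a\<^sup>2 / (cosh (a * s))\<^sup>2 \<le> a\<^sup>2 / (1 + a\<^sup>2 * s\<^sup>2)" using ch pos by (intro divide_left_mono) auto
    also have "\<dots> \<le> 1 / ((real b + 1)\<^sup>2 + s\<^sup>2)"
    proof -
      have "a\<^sup>2 * ((real b + 1)\<^sup>2 + s\<^sup>2) \<le> 1 + a\<^sup>2 * s\<^sup>2" using ab[unfolded power_mult_distrib] by (simp add: distrib_left)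
      moreover have "0 < (real b + 1)\<^sup>2 + s\<^sup>2" by (simp add: add_pos_nonneg)
      ultimately show ?thesis using pos by (simp add: divide_simps mult.commute)
    qed
    also have "\<dots> \<le> (arctan (real (Suc b) / s) - arctan (real b / s)) / s"
    proof -
      have "\<exists>z. real b / s < z \<and> z < real (Suc b) / s \<and> arctan (real (Suc b) / s) - arctan (real b / s) = (real (Suc b) / s - real b / s) * inverse (1 + z\<^sup>2)"
        by (rule MVT2) (use s in \<open>auto intro!: DERIV_arctan divide_strict_right_mono\<close>)
      then obtain z where z: "real b / s < z" "z < real (Suc b) / s"
        "arctan (real (Suc b) / s) - arctan (real b / s) = (real (Suc b) / s - real b / s) * inverse (1 + z\<^sup>2)" by blast
      have "0 \<le> real b / s" using s by simp
      then have "z\<^sup>2 \<le> (real (Suc b) / s)\<^sup>2" using z by (intro power_mono) auto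
      then have "inverse (1 + (real (Suc b) / s)\<^sup>2) \<le> inverse (1 + z\<^sup>2)" by (intro le_imp_inverse_le) (auto simp: add_pos_nonneg)
      then have "1 / s / s * inverse (1 + (real (Suc b) / s)\<^sup>2) \<le> 1 / s / s * inverse (1 + z\<^sup>2)" using s by (intro mult_left_mono) auto
      moreover have "1 / s / s * inverse (1 + (real (Suc b) / s)\<^sup>2) = 1 / ((real b + 1)\<^sup>2 + s\<^sup>2)"
      proof -
        have "1 + (real (Suc b) / s)\<^sup>2 = ((real b + 1)\<^sup>2 + s\<^sup>2) / s\<^sup>2" using s by (simp add: field_simps)
        then show ?thesis using s by (simp add: power2_eq_square)
      qed
      moreover have "real (Suc b) / s - real b / s = 1 / s" using s by (simp add: field_simps)
      ultimately show ?thesis unfolding z(3) by simp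
    qed
    finally show ?thesis by (simp add: a_def)
  qed
  have "cumulant'' p (cot_weight p) s = 2 * (\<Sum>b<n. (cot_weight p b)\<^sup>2 / (cosh (cot_weight p b * s))\<^sup>2)"
    unfolding cumulant''_def using sum_cot_weight_even[OF p, of "\<lambda>x. x\<^sup>2 / (cosh (x * s))\<^sup>2"] by simp
  also have "\<dots> \<le> 2 * (\<Sum>b<n. (arctan (real (Suc b) / s) - arctan (real b / s)) / s)"
    using bd by (intro mult_left_mono sum_mono) auto
  also have "(\<Sum>b<n. (arctan (real (Suc b) / s) - arctan (real b / s)) / s) = arctan (real n / s) / s"
    unfolding sum_divide_distrib[symmetric] using sum_lessThan_telescope[of "\<lambda>b. arctan (real b / s)" n] by simp
  also have "\<dots> \<le> 2 / s"
    using arctan_ubound[of "real n / s"] pi_less_4 s by (intro divide_right_mono) auto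
  finally show ?thesis by simp
qed

lemma sum_abs_cot_weight:
  assumes p: "p = 2 * n + 1" "3 \<le> p"
  shows "(\<Sum>b<p. \<bar>cot_weight p b\<bar>) \<le> 4 * ln (real p)"
proof -
  have n1: "1 \<le> n" using p by simp
  have "(\<Sum>b<p. \<bar>cot_weight p b\<bar>) = 2 * (\<Sum>b<n. \<bar>cot_weight p b\<bar>)"
    using sum_cot_weight_even[OF p(1), of abs] by simp
  also have "\<dots> \<le> 2 * (\<Sum>b<n. inverse (real (Suc b)))"
  proof (intro mult_left_mono sum_mono)
    fix b assume "b \<in> {..<n}"
    then have b: "b < n" by simp
    have "2 * (real b + 1) \<le> pi * (2 * real b + 1)"
      using mult_right_mono[OF pi_ge_two, of "2 * real b + 1"] by simp
    then have "2 / (pi * (2 * real b + 1)) \<le> inverse (real (Suc b))" by (simp add: field_simps)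
    then show "\<bar>cot_weight p b\<bar> \<le> inverse (real (Suc b))" using cot_weight_bounds[OF p(1) b] by linarith
  qed auto
  also have "(\<Sum>b<n. inverse (real (Suc b))) = harm n"
    unfolding harm_def by (rule sum.reindex_bij_witness[of _ "\<lambda>k. k - 1" Suc]) auto
  also have "harm n - ln (real n) \<le> harm 1 - ln (real 1)"
    using euler_mascheroni_sequence_decreasing[of 1 n] n1 by simp
  then have "harm n \<le> 1 + ln (real n)" by (simp add: harm_def)
  also have "ln (real n) \<le> ln (real p)" using n1 p by simp
  also have "1 \<le> ln (real p)"
  proof -
    have "exp 1 \<le> (3::real)" using exp_le by simp
    also have "\<dots> \<le> real p" using p by simp
    finally show ?thesis using p by (subst ln_ge_iff) auto
  qed
  finally show ?thesis by simp
qed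

section \<open>Convexity of the cumulant\<close>

lemma cumulant'_mono: "s \<le> t \<Longrightarrow> cumulant' p a s \<le> cumulant' p a t"
  by (rule DERIV_nonneg_imp_nondecreasing[of s t "cumulant' p a"]) (use cumulant'_deriv cumulant''_nonneg in blast)+

lemma cumulant_tangent: "cumulant p a s + (t - s) * cumulant' p a s \<le> cumulant p a t"
proof -
  consider "s < t" | "s = t" | "t < s" by linarith
  then show ?thesis
  proof cases
    case 1
    have "\<exists>z. s < z \<and> z < t \<and> cumulant p a t - cumulant p a s = (t - s) * cumulant' p a z"
      by (rule MVT2[OF 1]) (rule cumulant_deriv)
    then obtain z where z: "s < z" "cumulant p a t - cumulant p a s = (t - s) * cumulant' p a z" by blast
    have "(t - s) * cumulant' p a s \<le> (t - s) * cumulant' p a z"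
      using 1 z by (intro mult_left_mono cumulant'_mono) auto
    then show ?thesis using z by linarith
  next
    case 3
    have "\<exists>z. t < z \<and> z < s \<and> cumulant p a s - cumulant p a t = (s - t) * cumulant' p a z"
      by (rule MVT2[OF 3]) (rule cumulant_deriv)
    then obtain z where z: "z < s" "cumulant p a s - cumulant p a t = (s - t) * cumulant' p a z" by blast
    have "(s - t) * cumulant' p a z \<le> (s - t) * cumulant' p a s"
      using 3 z by (intro mult_left_mono cumulant'_mono) auto
    then show ?thesis using z by (simp add: algebra_simps)
  qed simp
qed

section \<open>The tail of the value distribution\<close>

text \<open>Both integrals are nonnegative, gamma is at least 1/2 and exp (1/2) is at least 13/8.
  This numerical value is what brings the required moment order below 2/5 ln p / ln ln p.\<close>

lemma exp_saddle_bound: "exp (- saddle_const) \<le> 4 * pi / 13"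
proof -
  obtain G where G: "\<And>x. 0 \<le> x \<Longrightarrow> (G has_real_derivative log_cosh_ratio x) (at x)" "G 0 = 0" "G 1 = cosh_integral"
    "\<And>x y. 0 \<le> x \<Longrightarrow> x \<le> y \<Longrightarrow> 0 \<le> G y - G x" "\<And>x y. 0 \<le> x \<Longrightarrow> x \<le> y \<Longrightarrow> G y - G x \<le> y - x"
    using log_cosh_antiderivative by blast
  have cosh_integral: "0 \<le> cosh_integral" using G(4)[of 0 1] G(2,3) by simp
  obtain J where J: "\<And>x. 1 \<le> x \<Longrightarrow> (J has_real_derivative - (ln (1 + exp (- 2 * x)) / x\<^sup>2)) (at x)" "J 1 = exp_integral"
    "\<And>x. 1 \<le> x \<Longrightarrow> 0 \<le> J x" "\<And>x. 1 \<le> x \<Longrightarrow> J x \<le> 1 / x"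
    "\<And>x y. 1 \<le> x \<Longrightarrow> x \<le> y \<Longrightarrow> 0 \<le> J x - J y" "\<And>x y. 1 \<le> x \<Longrightarrow> x \<le> y \<Longrightarrow> J x - J y \<le> y - x"
    using log_exp_antiderivative by blast
  have exp_integral: "0 \<le> exp_integral" using J(3)[of 1] J(2) by simp
  have "1 / 2 \<le> (euler_mascheroni :: real)" using euler_mascheroni_gt_19_over_33 by simp
  then have "- saddle_const \<le> - ln (2 / pi) - 1 / 2" using cosh_integral exp_integral by (simp add: saddle_const_def)
  then have "exp (- saddle_const) \<le> exp (- ln (2 / pi) - 1 / 2)" by simp
  also have "\<dots> = pi / 2 / exp (1 / 2)" by (simp add: exp_diff exp_minus)
  also have "\<dots> \<le> pi / 2 / (13 / 8)"
    using exp_lower_Taylor_quadratic[of "1 / 2 :: real"] by (intro divide_left_mono) (auto simp: power2_eq_square)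
  finally show ?thesis by simp
qed

definition saddle_main :: "real \<Rightarrow> real" where
  "saddle_main s = 2 / pi * s * (ln s + saddle_const)"

lemma cumulant_saddle_main:
  assumes "p = 2 * n + 1" "2 \<le> s" "4 * s\<^sup>2 \<le> real p"
  shows "\<bar>cumulant p (cot_weight p) s - saddle_main s\<bar> \<le> 21"
  unfolding saddle_main_def using assms by (rule cumulant_cot_weight)

text \<open>An asymptotic formula with bounded error cannot be differentiated, but convexity bounds
  the slope at \<open>s\<close> by the chord from \<open>s\<close> to 2s. Differentiating the main
  term would give the constant 1 in place of 2 ln 2; the overshoot is harmless.\<close>

lemma cumulant'_upper:
  assumes p: "p = 2 * n + 1" and s: "2 \<le> s" "16 * s\<^sup>2 \<le> real p"
  shows "cumulant' p (cot_weight p) s \<le> 2 / pi * (ln s + 2 * ln 2 + saddle_const) + 42 / s"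
proof -
  let ?L = "cumulant p (cot_weight p)"
  have 1: "\<bar>?L s - saddle_main s\<bar> \<le> 21"
    using s zero_le_power2[of s] by (intro cumulant_saddle_main[OF p]) auto
  have "4 * (2 * s)\<^sup>2 \<le> real p" using s by (simp add: power_mult_distrib)
  then have 2: "\<bar>?L (2 * s) - saddle_main (2 * s)\<bar> \<le> 21"
    using s by (intro cumulant_saddle_main[OF p]) auto
  have ln: "ln (2 * s) = ln 2 + ln s" using s by (simp add: ln_mult)
  have "s * cumulant' p (cot_weight p) s \<le> ?L (2 * s) - ?L s"
    using cumulant_tangent[of p "cot_weight p" s "2 * s"] by simp
  also have "\<dots> \<le> saddle_main (2 * s) - saddle_main s + 42"
    using 1 2 by linarith
  also have "\<dots> = s * (2 / pi * (ln s + 2 * ln 2 + saddle_const) + 42 / s)"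
    using s unfolding saddle_main_def ln by (simp add: field_simps)
  finally show ?thesis using s by (subst (asm) mult_le_cancel_left_pos) auto
qed

text \<open>The chord from s/2 to \<open>s\<close> bounds the slope from below. Here ln 2 replaces
  the constant 1 of the differentiated main term.\<close>

lemma cumulant'_lower:
  assumes p: "p = 2 * n + 1" and s: "4 \<le> s" "4 * s\<^sup>2 \<le> real p"
  shows "2 / pi * (ln s + ln 2 + saddle_const) - 84 / s \<le> cumulant' p (cot_weight p) s"
proof -
  let ?L = "cumulant p (cot_weight p)"
  have 1: "\<bar>?L s - saddle_main s\<bar> \<le> 21"
    using s by (intro cumulant_saddle_main[OF p]) auto
  have "4 * (s / 2)\<^sup>2 \<le> real p" using s zero_le_power2[of s] by (simp add: power_divide)
  then have 2: "\<bar>?L (s / 2) - saddle_main (s / 2)\<bar> \<le> 21"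
    using s by (intro cumulant_saddle_main[OF p]) auto
  have ln: "ln (s / 2) = ln s - ln 2" using s by (simp add: ln_div)
  have "s * (2 / pi * (ln s + ln 2 + saddle_const) - 84 / s) = 2 * (saddle_main s - saddle_main (s / 2) - 42)"
    using s unfolding saddle_main_def ln by (simp add: field_simps)
  also have "\<dots> \<le> 2 * (?L s - ?L (s / 2))"
  proof -
    have "saddle_main s - saddle_main (s / 2) - 42 \<le> ?L s - ?L (s / 2)" using 1 2 unfolding abs_le_iff by argo
    then show ?thesis by simp
  qed
  also have "\<dots> \<le> s * cumulant' p (cot_weight p) s"
    using cumulant_tangent[of p "cot_weight p" s "s / 2"] by (simp add: algebra_simps)
  finally show ?thesis using s by (subst (asm) mult_le_cancel_left_pos) auto
qed

lemma C2_minus_exp: "C2_minus * exp (pi * W / 2) = 2 / pi * exp (pi * W / 2 - saddle_const - 1)"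
  unfolding C2_minus_saddle mult.assoc exp_add[symmetric] by (simp add: algebra_simps)

text \<open>The right-hand side is stationary at t = exp (pi W/2 - saddle_const - 1) with value - 2
  t / pi, and ln x <= x - 1 at x = t/s shows that this is a global minimum. Hence the lower tail can
  use it with any \<open>s\<close>.\<close>

lemma saddle_min:
  assumes "0 < s"
  shows "- (C2_minus * exp (pi * W / 2)) \<le> saddle_main s - s * W"
proof -
  define t where "t = exp (pi * W / 2 - saddle_const - 1)"
  have t: "0 < t" "ln t = pi * W / 2 - saddle_const - 1" by (auto simp: t_def)
  have C: "C2_minus * exp (pi * W / 2) = 2 / pi * t" unfolding t_def by (rule C2_minus_exp)
  have "ln (t / s) \<le> t / s - 1" using assms t by (intro ln_le_minus_one) auto
  then have "s * (ln t - ln s) \<le> s * (t / s - 1)" using assms t by (intro mult_left_mono) (auto simp: ln_div)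
  also have "\<dots> = t - s" using assms by (simp add: field_simps)
  finally have "- t \<le> s * (ln s - ln t - 1)" by (simp add: algebra_simps)
  then have "2 / pi * - t \<le> 2 / pi * (s * (ln s - ln t - 1))" by (intro mult_left_mono) auto
  also have "\<dots> = saddle_main s - s * W"
    unfolding t(2) saddle_main_def by (simp add: field_simps)
  finally show ?thesis unfolding C by simp
qed

text \<open>The inequality ln x <= x - 1, now at x = s/t, shows that leaving the minimiser costs
  only a quadratic term. Rounding \<open>s\<close> by a bounded amount to reach an integral moment
  is therefore an O(1) loss.\<close>

lemma saddle_near_min:
  fixes s V :: real
  assumes s: "0 < s"
  defines "t \<equiv> exp (pi * V / 2 - saddle_const - 1)"
  shows "saddle_main s - s * V \<le> - (C2_minus * exp (pi * V / 2)) + 2 / pi * ((s - t)\<^sup>2 / t)"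
proof -
  have t: "0 < t" "ln t = pi * V / 2 - saddle_const - 1" by (auto simp: t_def)
  have C: "C2_minus * exp (pi * V / 2) = 2 / pi * t" unfolding t_def by (rule C2_minus_exp)
  have "ln (s / t) \<le> s / t - 1" using s t by (intro ln_le_minus_one) auto
  then have "ln s - ln t - 1 \<le> s / t - 2" using s t by (simp add: ln_div)
  then have "s * (ln s - ln t - 1) \<le> s * (s / t - 2)" using s by (intro mult_left_mono) auto
  also have "\<dots> = (s - t)\<^sup>2 / t - t" using t by (simp add: power2_eq_square field_simps)
  finally have "2 / pi * (s * (ln s - ln t - 1)) \<le> 2 / pi * ((s - t)\<^sup>2 / t - t)" by (intro mult_left_mono) auto
  moreover have "2 / pi * (s * (ln s - ln t - 1)) = saddle_main s - s * V"
    unfolding t(2) saddle_main_def by (simp add: field_simps)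
  moreover have "2 / pi * ((s - t)\<^sup>2 / t - t) = - (2 / pi * t) + 2 / pi * ((s - t)\<^sup>2 / t)"
    by (simp only: right_diff_distrib)
  ultimately show ?thesis unfolding C by linarith
qed

section \<open>Tail frequencies and the admissible range\<close>

definition cot_sum :: "nat \<Rightarrow> nat \<Rightarrow> real" where
  "cot_sum p K = (\<Sum>b<p. cot_weight p b * leg p K b)"

definition tail_freq :: "nat \<Rightarrow> real \<Rightarrow> real" where
  "tail_freq p V = real (card {K \<in> {0..<p}. V \<le> \<bar>cot_sum p K\<bar>}) / real p"

lemma tail_freq_antimono: "U \<le> V \<Longrightarrow> tail_freq p V \<le> tail_freq p U"
  unfolding tail_freq_def by (intro divide_right_mono) (auto intro!: card_mono)

lemma tail_freq_le_1: "tail_freq p V \<le> 1"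
proof -
  have "card {K \<in> {0..<p}. V \<le> \<bar>cot_sum p K\<bar>} \<le> card {0..<p}" by (intro card_mono) auto
  then show ?thesis unfolding tail_freq_def by (cases "p = 0") (auto simp: divide_le_eq_1)
qed

definition moment_error :: "nat \<Rightarrow> nat \<Rightarrow> real" where
  "moment_error p m = 25 * real m * (4 * ln (real p)) ^ m / sqrt (real p)"

text \<open>The last condition limits the range of V: the relevant moments have order at most
  2/5 ln p / ln ln p, and for these the accumulated error stays below the square root saving.\<close>

definition large_prime :: "nat \<Rightarrow> bool" where
  "large_prime p \<longleftrightarrow> prime p \<and> 2 < p \<and> 1 \<le> ln (ln (real p)) \<and> 4000 \<le> (ln (real p))\<^sup>2 \<and>
     16 * ((ln (real p))\<^sup>2 + 2)\<^sup>2 \<le> real p \<and>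
     2 / pi * ln (ln (real p)) + 1 \<le> 2 / pi * (2 * ln (ln (real p)) + ln 2 + saddle_const) - 84 / (ln (real p))\<^sup>2 \<and>
     (\<forall>m. real m \<le> 2 / 5 * ln (real p) / ln (ln (real p)) + 4 \<longrightarrow>
        moment_error p m * (1 + (real m)\<^sup>2) \<le> exp (- real m) / 4)"

lemma large_prime_odd:
  assumes "large_prime p"
  obtains n where "p = 2 * n + 1"
  using assms prime_odd_nat[of p] unfolding large_prime_def by (auto elim!: oddE)

lemma cot_sum_moments:
  assumes "large_prime p" "m \<le> N"
  shows "\<bar>(\<Sum>K<p. cot_sum p K ^ m) / p - sign_mean p (cot_weight p) (\<lambda>x. x ^ m)\<bar> \<le> moment_error p N"
proof -
  have p: "prime p" "2 < p" using assms by (auto simp: large_prime_def)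
  obtain n where n: "p = 2 * n + 1" using large_prime_odd[OF assms(1)] .
  have "ln 3 \<le> ln (real p)" using p by (subst ln_le_cancel_iff) auto
  then have l: "1 \<le> 4 * ln (real p)" using ln_ge_zero[of 3] exp_le ln_ge_iff[of 3 1] by simp
  have "\<bar>(\<Sum>K<p. cot_sum p K ^ m) / p - sign_mean p (cot_weight p) (\<lambda>x. x ^ m)\<bar> \<le> 25 * real m * (\<Sum>b<p. \<bar>cot_weight p b\<bar>) ^ m / sqrt p"
    unfolding cot_sum_def sign_mean_def by (rule moment_comparison[OF p])
  also have "\<dots> \<le> 25 * real N * (4 * ln (real p)) ^ N / sqrt p"
  proof (intro divide_right_mono mult_mono)
    have "(\<Sum>b<p. \<bar>cot_weight p b\<bar>) ^ m \<le> (4 * ln (real p)) ^ m"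
      using sum_abs_cot_weight[OF n] p by (intro power_mono sum_nonneg) auto
    also have "\<dots> \<le> (4 * ln (real p)) ^ N" using l assms(2) by (intro power_increasing) auto
    finally show "(\<Sum>b<p. \<bar>cot_weight p b\<bar>) ^ m \<le> (4 * ln (real p)) ^ N" .
  qed (use assms(2) in \<open>auto intro!: zero_le_power sum_nonneg\<close>)
  finally show ?thesis by (simp add: moment_error_def)
qed

text \<open>The term 2 ln ln ln p divides exp (pi V/2) by (ln ln p)^2. One factor ln ln p is
  consumed by V itself; the other leaves s V of order ln p / ln ln p, as the moment comparison
  demands. The number 8/13 is 4 pi/13 times 2/pi.\<close>

lemma range_V:
  assumes lp: "large_prime p" and V: "V \<le> 2 / pi * (ln (ln (real p)) - 2 * ln (ln (ln (real p))))" "0 \<le> V"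
  shows "V \<le> 2 / pi * ln (ln (real p))" "exp (- saddle_const) * (exp (pi * V / 2) * V) \<le> 8 / 13 * (ln (real p) / ln (ln (real p)))"
    "exp (- saddle_const) * exp (pi * V / 2) \<le> ln (real p)"
proof -
  define l where "l = ln (real p)"
  define g where "g = ln l"
  have g1: "1 \<le> g" using lp by (simp add: large_prime_def g_def l_def)
  have l0: "0 < l" using lp by (simp add: large_prime_def l_def)
  then have "exp 1 \<le> l" using g1 by (simp add: g_def ln_ge_iff)
  then have l1: "1 < l" using exp_ge_add_one_self[of "1::real"] by linarith
  have lg: "l = exp g" using l1 by (simp add: g_def)
  have V': "V \<le> 2 / pi * (g - 2 * ln g)" using V by (simp add: g_def l_def)
  also have "\<dots> \<le> 2 / pi * g" using g1 by (intro mult_left_mono) auto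
  finally have a: "V \<le> 2 / pi * g" .
  then show "V \<le> 2 / pi * ln (ln (real p))" by (simp add: g_def l_def)
  have "pi * V / 2 \<le> g - 2 * ln g" using V' by (simp add: field_simps)
  then have "exp (pi * V / 2) \<le> exp (g - 2 * ln g)" by simp
  also have "\<dots> = l / g\<^sup>2" using g1 unfolding lg by (simp add: exp_diff exp_double)
  finally have b: "exp (pi * V / 2) \<le> l / g\<^sup>2" .
  have "exp (pi * V / 2) * V \<le> l / g\<^sup>2 * (2 / pi * g)" using a b V l1 by (intro mult_mono) auto
  also have "\<dots> = 2 / pi * (l / g)" using g1 by (simp add: power2_eq_square field_simps)
  finally have c: "exp (pi * V / 2) * V \<le> 2 / pi * (l / g)" .
  have "exp (- saddle_const) * (exp (pi * V / 2) * V) \<le> 4 * pi / 13 * (2 / pi * (l / g))"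
    by (rule mult_mono[OF exp_saddle_bound c]) (use V in auto)
  also have "\<dots> = 8 / 13 * (l / g)" by simp
  finally show "exp (- saddle_const) * (exp (pi * V / 2) * V) \<le> 8 / 13 * (ln (real p) / ln (ln (real p)))"
    by (simp add: g_def l_def)
  have "exp (pi * V / 2) \<le> l / g\<^sup>2" by (rule b)
  also have "\<dots> \<le> l / 1" using g1 l1 by (intro divide_left_mono) (auto simp: one_le_power)
  finally have e: "exp (pi * V / 2) \<le> l" by simp
  have "4 * pi / 13 \<le> 1" using pi_approx by simp
  then have "exp (- saddle_const) \<le> 1" using exp_saddle_bound by linarith
  then have "exp (- saddle_const) * exp (pi * V / 2) \<le> 1 * l" using e by (intro mult_mono) auto
  then show "exp (- saddle_const) * exp (pi * V / 2) \<le> ln (real p)" by (simp add: l_def)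
qed

lemma tail_freq_upper:
  assumes lp: "large_prime p" and V: "V \<le> 2 / pi * (ln (ln (real p)) - 2 * ln (ln (ln (real p))))" "1 \<le> V"
    and V4: "2 \<le> exp (pi * V / 2 - saddle_const - 1)"
  shows "tail_freq p V \<le> exp (- (C2_minus * exp (pi * V / 2)) + 25)"
proof -
  obtain n where n: "p = 2 * n + 1" using large_prime_odd[OF lp] .
  have p: "prime p" "2 < p" using lp by (auto simp: large_prime_def)
  define l g where "l = ln (real p)" and "g = ln l"
  have lpc: "16 * (l\<^sup>2 + 2)\<^sup>2 \<le> real p" "4000 \<le> l\<^sup>2" "1 \<le> g"
    using lp by (auto simp: large_prime_def l_def g_def)
  have l0: "0 < l" using p by (simp add: l_def)
  define t where "t = exp (pi * V / 2 - saddle_const - 1)"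
  have t2: "2 \<le> t" using V4 by (simp add: t_def)
  \<comment> \<open>The minimiser \<open>t\<close> is rounded up to s = 2k/V, so that s V is an even
    moment order; since V is at least 1, s exceeds \<open>t\<close> by at most 2.\<close>
  define k where "k = nat \<lceil>t * V / 2\<rceil>"
  have tV0: "0 \<le> t * V / 2" using V t2 by simp
  then have k: "t * V / 2 \<le> real k" "real k < t * V / 2 + 1"
    unfolding k_def using ceiling_correct[of "t * V / 2"] by auto
  define s where "s = 2 * real k / V"
  have sV: "s * V = 2 * real k" using V by (simp add: s_def)
  have st: "t \<le> s" "s \<le> t + 2"
  proof -
    show "t \<le> s" using k(1) V by (simp add: s_def field_simps)
    have "2 * real k \<le> t * V + 2 * V" using k(2) V by linarith
    then show "s \<le> t + 2" using V by (simp add: s_def field_simps)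
  qed
  have t': "t = exp (- saddle_const) * exp (pi * V / 2) * exp (- 1)"
    by (simp add: t_def exp_add[symmetric] algebra_simps)
  have e1: "exp (- 1) \<le> (1 / 2 :: real)" using exp_ge_add_one_self[of "1::real"] by (simp add: exp_minus field_simps)
  have "t \<le> l * 1"
    unfolding t' using range_V(3)[OF lp V(1)] V e1 l0 by (intro mult_mono) (auto simp: l_def)
  then have tl: "t \<le> l" by simp
  then have "l \<le> l\<^sup>2" using t2 by (simp add: power2_eq_square)
  then have "s \<le> l\<^sup>2 + 2" using st tl by linarith
  then have "s\<^sup>2 \<le> (l\<^sup>2 + 2)\<^sup>2" using st t2 by (intro power_mono) auto
  then have s4: "4 * s\<^sup>2 \<le> real p" using lpc zero_le_power2[of s] by linarith
  have "t * V = exp (- saddle_const) * (exp (pi * V / 2) * V) * exp (- 1)" unfolding t' by simp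
  \<comment> \<open>The factor exp (-1) in the minimiser halves 8/13 at least, leaving 4/13 below
    the admissible 2/5.\<close>
  also have "\<dots> \<le> 8 / 13 * (l / g) * (1 / 2)"
  proof (rule mult_mono)
    show "exp (- saddle_const) * (exp (pi * V / 2) * V) \<le> 8 / 13 * (l / g)"
      using range_V(2)[OF lp V(1)] V by (simp add: l_def g_def)
  qed (use e1 l0 lpc in auto)
  also have "\<dots> \<le> 2 / 5 * (l / g)"
  proof -
    have le: "8 / 13 * y * (1 / 2) \<le> 2 / 5 * y" if "0 \<le> y" for y :: real using that by simp
    show ?thesis by (rule le) (use l0 lpc in simp)
  qed
  finally have "t * V \<le> 2 / 5 * l / g" by simp
  then have "real (2 * k) \<le> 2 / 5 * l / g + 4" using k(2) by simp
  then have me: "moment_error p (2 * k) * (1 + (real (2 * k))\<^sup>2) \<le> exp (- real (2 * k)) / 4"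
    using lp unfolding large_prime_def l_def g_def by blast
  have "0 \<le> moment_error p (2 * k)" using p unfolding moment_error_def by simp
  then have "moment_error p (2 * k) * 1 \<le> moment_error p (2 * k) * (1 + (real (2 * k))\<^sup>2)" by (intro mult_left_mono) auto
  also have "\<dots> \<le> exp (- real (2 * k)) / 4" by (rule me)
  also have "\<dots> \<le> exp (- (s * V))" unfolding sV by simp
  finally have err: "moment_error p (2 * k) \<le> exp (- (s * V))" by simp
  have "tail_freq p V \<le> 3 * exp (cumulant p (cot_weight p) s - s * V)"
    unfolding tail_freq_def using cot_sum_moments[OF lp order_refl] p V sV err
    by (intro tail_upper_bound) auto
  also have "3 * exp (cumulant p (cot_weight p) s - s * V) \<le> exp 2 * exp (cumulant p (cot_weight p) s - s * V)"
    using exp_ge_add_one_self[of "2::real"] by (intro mult_right_mono) auto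
  also have "\<dots> = exp (cumulant p (cot_weight p) s - s * V + 2)" by (simp add: exp_add)
  also have "\<dots> \<le> exp (- (C2_minus * exp (pi * V / 2)) + 25)"
  proof -
    have "\<bar>cumulant p (cot_weight p) s - saddle_main s\<bar> \<le> 21"
      using st t2 s4 by (intro cumulant_saddle_main[OF n]) auto
    moreover have "saddle_main s - s * V \<le> - (C2_minus * exp (pi * V / 2)) + 2 / pi * ((s - t)\<^sup>2 / t)"
      unfolding t_def using st t2 by (intro saddle_near_min) auto
    moreover have "2 / pi * ((s - t)\<^sup>2 / t) \<le> 1 * 2"
    proof (intro mult_mono)
      show "2 / pi \<le> 1" using pi_ge_two by simp
      have "(s - t)\<^sup>2 \<le> 2\<^sup>2" using st by (intro power_mono) auto
      then show "(s - t)\<^sup>2 / t \<le> 2" using t2 by (simp add: divide_le_eq)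
    qed (use t2 in auto)
    ultimately have "cumulant p (cot_weight p) s - s * V + 2 \<le> - (C2_minus * exp (pi * V / 2)) + 25" by linarith
    then show ?thesis by (simp only: exp_le_cancel_iff)
  qed
  finally show ?thesis .
qed

text \<open>The square of exp (pi V/4) times this constant is a lower bound for the saddle point.
  The quarter comes from the 2 ln 2 in the upper slope bound, and the extra exp (-1) absorbs the
  remaining slack.\<close>

definition scale_const :: real where
  "scale_const = exp (- saddle_const - 1) / 4"

text \<open>Divided by exp (pi V/4), this bounds how far the window centre W lies above V. The first
  summand is the gap 16 / sqrt s that keeps the whole window above V; the second pays for raising s
  by at most 2, which moves the mean by at most 2 times the variance bound 4/s.\<close>

definition shift_const :: real where
  "shift_const = 16 / sqrt scale_const + 8 / scale_const"

lemma scale_const_pos: "0 < scale_const"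
  by (simp add: scale_const_def)

lemma shift_const_pos: "0 < shift_const"
  unfolding shift_const_def using scale_const_pos by (intro add_pos_pos divide_pos_pos) auto

text \<open>The saddle point is first placed slightly above V and then moved up to the next point where
  s times its mean is an odd integer, so that the exponential tilt is matched by an even power.\<close>

lemma saddle_point_exists:
  fixes p :: nat and V :: real
  assumes lp: "large_prime p" and V: "V \<le> 2 / pi * (ln (ln (real p)) - 2 * ln (ln (ln (real p))))" "300 \<le> V"
    and Vc: "2 / pi * (ln 4000 + 2 * ln 2 + saddle_const) + 1 \<le> V"
    and r: "50 * shift_const \<le> exp (pi * V / 4)"
  obtains s k W where "W = cumulant' p (cot_weight p) s" "s * W = 2 * real k + 1" "4000 \<le> s" "s \<le> (ln (real p))\<^sup>2 + 2"
    "V + 16 / sqrt s \<le> W" "W \<le> V + shift_const / exp (pi * V / 4)"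
proof -
  obtain n where n: "p = 2 * n + 1" using large_prime_odd[OF lp] .
  define L where "L = cumulant' p (cot_weight p)"
  define r where "r = exp (pi * V / 4)"
  define l g where "l = ln (real p)" and "g = ln l"
  have p: "prime p" "2 < p" using lp by (auto simp: large_prime_def)
  have lpc: "16 * (l\<^sup>2 + 2)\<^sup>2 \<le> real p" "4000 \<le> l\<^sup>2" "1 \<le> g"
    "2 / pi * g + 1 \<le> 2 / pi * (2 * g + ln 2 + saddle_const) - 84 / l\<^sup>2"
    using lp by (auto simp: large_prime_def l_def g_def)
  have l0: "0 < l" using p by (simp add: l_def)
  have rng: "16 * s\<^sup>2 \<le> real p" "4 * s\<^sup>2 \<le> real p" if "0 \<le> s" "s \<le> l\<^sup>2 + 2" for s
  proof -
    have "s\<^sup>2 \<le> (l\<^sup>2 + 2)\<^sup>2" using that by (intro power_mono) auto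
    then show "16 * s\<^sup>2 \<le> real p" "4 * s\<^sup>2 \<le> real p" using lpc zero_le_power2[of s] by linarith+
  qed
  have cont: "continuous_on S L" for S
    unfolding L_def by (intro continuous_at_imp_continuous_on ballI DERIV_isCont[OF cumulant'_deriv])
  have r1: "1 \<le> r" using V by (simp add: r_def)
  have r2: "r * r = exp (pi * V / 2)" by (simp add: r_def exp_add[symmetric])
  define a where "a = 16 / sqrt scale_const"
  have a0: "0 \<le> a" using scale_const_pos by (simp add: a_def)
  have "a \<le> shift_const" unfolding a_def shift_const_def using scale_const_pos by simp
  then have ar: "a / r \<le> 1" using r r1 a0 by (simp add: r_def[symmetric] divide_le_eq)
  \<comment> \<open>The gap is fixed in terms of V before s is known; the later bound
    \<open>s1_lower\<close> shows that it is at least 16 / sqrt s.\<close>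
  define W1 where "W1 = V + a / r"
  have W1: "V \<le> W1" "W1 \<le> V + 1" using a0 r1 ar by (auto simp: W1_def)
  have "L 4000 \<le> 2 / pi * (ln 4000 + 2 * ln 2 + saddle_const) + 42 / 4000"
    unfolding L_def using rng(1)[of 4000] lpc by (intro cumulant'_upper[OF n]) auto
  then have lo: "L 4000 \<le> W1" using Vc W1 by linarith
  have "ln (l\<^sup>2) = 2 * g" using l0 by (simp add: g_def ln_realpow)
  then have "2 / pi * (2 * g + ln 2 + saddle_const) - 84 / l\<^sup>2 \<le> L (l\<^sup>2)"
    unfolding L_def using cumulant'_lower[OF n, of "l\<^sup>2"] rng(2)[of "l\<^sup>2"] lpc by simp
  moreover have "V \<le> 2 / pi * g" using range_V(1)[OF lp V(1)] V by (simp add: g_def l_def)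
  ultimately have hi: "W1 \<le> L (l\<^sup>2)" using W1 lpc(4) by linarith
  obtain s1 where s1: "4000 \<le> s1" "s1 \<le> l\<^sup>2" "L s1 = W1"
    using IVT'[of L 4000 W1 "l\<^sup>2", OF lo hi lpc(2) cont] by blast
  \<comment> \<open>An odd integer lies in [x, x + 2). Raising \<open>s\<close> by 2 increases s
    times its mean by at least 2 W1, hence by more than 2, so by continuity the product attains that
    integer.\<close>
  define x where "x = s1 * W1"
  define k where "k = nat \<lceil>(x - 1) / 2\<rceil>"
  have "1 * 1 \<le> x" unfolding x_def using s1 W1 V by (intro mult_mono) auto
  then have "0 \<le> (x - 1) / 2" by simp
  moreover have "z \<le> real (nat \<lceil>z\<rceil>) \<and> real (nat \<lceil>z\<rceil>) < z + 1" if "0 \<le> z" for z :: real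
    using that ceiling_correct[of z] by auto
  ultimately have "(x - 1) / 2 \<le> real k" "real k < (x - 1) / 2 + 1" unfolding k_def by blast+
  then have k: "x \<le> 2 * real k + 1" "2 * real k + 1 < x + 2" by (simp_all add: field_simps)
  have "s1 * L s1 \<le> 2 * real k + 1" using k(1) s1 by (simp add: x_def)
  moreover have "2 * real k + 1 \<le> (s1 + 2) * L (s1 + 2)"
  proof -
    have "W1 \<le> L (s1 + 2)" using cumulant'_mono[of s1 "s1 + 2" p "cot_weight p"] s1 by (simp add: L_def)
    then have "(s1 + 2) * W1 \<le> (s1 + 2) * L (s1 + 2)" using s1 by (intro mult_left_mono) auto
    moreover have "x + 2 \<le> (s1 + 2) * W1" using W1 V by (simp add: x_def algebra_simps)
    ultimately show ?thesis using k(2) by linarith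
  qed
  moreover have "continuous_on {s1..s1 + 2} (\<lambda>s. s * L s)" by (intro continuous_intros cont)
  ultimately obtain s where s: "s1 \<le> s" "s \<le> s1 + 2" "s * L s = 2 * real k + 1"
    using IVT'[of "\<lambda>s. s * L s" s1 "2 * real k + 1" "s1 + 2"] by auto
  define W where "W = L s"
  have WW: "W1 \<le> W" using cumulant'_mono[OF s(1), of p "cot_weight p"] s1 by (simp add: L_def W_def)
  have WW': "W \<le> W1 + 8 / s1"
  proof (cases "s1 = s")
    case False
    then have lt: "s1 < s" using s by simp
    have "\<exists>z. s1 < z \<and> z < s \<and> L s - L s1 = (s - s1) * cumulant'' p (cot_weight p) z"
      unfolding L_def by (rule MVT2[OF lt]) (rule cumulant'_deriv)
    then obtain z where z: "s1 < z" "z < s" "L s - L s1 = (s - s1) * cumulant'' p (cot_weight p) z" by blast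
    have "cumulant'' p (cot_weight p) z \<le> 4 / z" using z s1 by (intro cumulant''_cot_weight[OF n]) auto
    also have "\<dots> \<le> 4 / s1" using z s1 by (intro divide_left_mono) auto
    finally have "(s - s1) * cumulant'' p (cot_weight p) z \<le> 2 * (4 / s1)"
      using s cumulant''_nonneg[of p "cot_weight p" z] by (intro mult_mono) auto
    then show ?thesis using z s1 by (simp add: W_def)
  qed (use s1 in \<open>simp add: W_def\<close>)
  have s1_lower: "scale_const * (r * r) \<le> s1"
  proof -
    have "V \<le> 2 / pi * (ln s1 + 2 * ln 2 + saddle_const) + 42 / s1"
      using cumulant'_upper[OF n, of s1] s1 rng(1)[of s1] W1 by (simp add: L_def)
    moreover have "42 / s1 \<le> 42 / 4000" using s1 by (intro divide_left_mono) auto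
    ultimately have "V \<le> 2 / pi * (ln s1 + 2 * ln 2 + saddle_const) + 1 / 90" by simp
    then have "pi / 2 * V \<le> pi / 2 * (2 / pi * (ln s1 + 2 * ln 2 + saddle_const) + 1 / 90)"
      by (intro mult_left_mono) auto
    also have "\<dots> = ln s1 + 2 * ln 2 + saddle_const + pi / 180" by (simp add: field_simps)
    also have "\<dots> \<le> ln s1 + 2 * ln 2 + saddle_const + 1" using pi_less_4 by simp
    finally have "exp (pi * V / 2 + (- saddle_const - 1) - 2 * ln 2) \<le> exp (ln s1)" by simp
    moreover have "exp (pi * V / 2 + (- saddle_const - 1) - 2 * ln 2) = scale_const * (r * r)"
      unfolding r2 scale_const_def exp_diff[of _ "2 * ln 2"] exp_add[of "pi * V / 2"] exp_double by simp
    ultimately show ?thesis using s1 by simp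
  qed
  have "8 / s1 \<le> 8 / (scale_const * (r * r))"
    using s1_lower scale_const_pos r1 s1 by (intro divide_left_mono mult_pos_pos) auto
  also have "\<dots> = (8 / scale_const) / r / r" by simp
  also have "\<dots> \<le> (8 / scale_const) / r / 1" using r1 scale_const_pos by (intro divide_left_mono) auto
  finally have W_up: "W \<le> V + shift_const / r"
    using WW' by (simp add: W1_def a_def shift_const_def add_divide_distrib)
  have "sqrt scale_const * r = sqrt (scale_const * (r * r))" using r1 by (simp add: real_sqrt_mult)
  also have "\<dots> \<le> sqrt s" using s1_lower s by (intro real_sqrt_le_mono) linarith
  finally have "16 / sqrt s \<le> 16 / (sqrt scale_const * r)"
    using scale_const_pos r1 s s1 by (intro divide_left_mono mult_pos_pos) auto
  then have W_lo: "V + 16 / sqrt s \<le> W" using WW by (simp add: W1_def a_def)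
  show thesis
  proof (rule that[of W s k])
    show "W = cumulant' p (cot_weight p) s" by (simp add: W_def L_def)
    show "s * W = 2 * real k + 1" using s by (simp add: W_def)
    show "4000 \<le> s" using s s1 by simp
    show "s \<le> (ln (real p))\<^sup>2 + 2" using s s1 by (simp add: l_def)
    show "V + 16 / sqrt s \<le> W" by (rule W_lo)
    show "W \<le> V + shift_const / exp (pi * V / 4)" using W_up by (simp add: r_def)
  qed
qed

text \<open>Three losses in the exponent are of order exp (pi V/4): moving the target from V to W,
  which changes the main term by a factor 1 + O(exp (- pi V/4)); the ratio of the power at W to that
  at W + d, at least exp (- s d) with s d = 8 sqrt s; and bounded terms, 21 from the cumulant and 1
  from the factor 1/2.\<close>

lemma tail_freq_lower:
  fixes p :: nat and V :: real
  assumes lp: "large_prime p" and V: "V \<le> 2 / pi * (ln (ln (real p)) - 2 * ln (ln (ln (real p))))" "300 \<le> V"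
    and Vc: "2 / pi * (ln 4000 + 2 * ln 2 + saddle_const) + 1 \<le> V"
    and r: "50 * shift_const \<le> exp (pi * V / 4)"
  shows "exp (- (C2_minus * exp (pi * V / 2)) - (22 + 8 * exp (- saddle_const / 2) + C2_minus * pi * shift_const) * exp (pi * V / 4))
    \<le> tail_freq p V"
proof -
  obtain n where n: "p = 2 * n + 1" using large_prime_odd[OF lp] .
  have p: "prime p" "2 < p" using lp by (auto simp: large_prime_def)
  define l g where "l = ln (real p)" and "g = ln l"
  have lpc: "16 * (l\<^sup>2 + 2)\<^sup>2 \<le> real p" "1 \<le> g" using lp by (auto simp: large_prime_def l_def g_def)
  have l0: "0 < l" using p by (simp add: l_def)
  define r where "r = exp (pi * V / 4)"
  have r1: "1 \<le> r" using V by (simp add: r_def)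
  have r2: "r * r = exp (pi * V / 2)" by (simp add: r_def exp_add[symmetric])
  obtain s k W where W: "W = cumulant' p (cot_weight p) s" and sW: "s * W = 2 * real k + 1"
    and s: "4000 \<le> s" "s \<le> l\<^sup>2 + 2" and W_lo: "V + 16 / sqrt s \<le> W" and W_up: "W \<le> V + shift_const / r"
    using saddle_point_exists[OF lp V Vc r] unfolding l_def r_def by metis
  have s4: "4 * s\<^sup>2 \<le> real p"
  proof -
    have "s\<^sup>2 \<le> (l\<^sup>2 + 2)\<^sup>2" using s by (intro power_mono) auto
    then show ?thesis using lpc zero_le_power2[of s] by linarith
  qed
  have shr: "0 \<le> shift_const / r" "shift_const / r \<le> 1 / 50"
    using r r1 shift_const_pos by (auto simp: r_def[symmetric] divide_le_eq)
  \<comment> \<open>Four times the standard deviation bound 2 / sqrt s, so that sixteen variances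
    fit into d^2.\<close>
  define d where "d = 8 / sqrt s"
  have d0: "0 < d" using s by (simp add: d_def)
  have d2: "d\<^sup>2 = 64 / s" using s by (simp add: d_def power_divide)
  have Wd: "V + 2 * d \<le> W" using W_lo by (simp add: d_def)
  have d1: "d \<le> 1 / 100" using Wd W_up shr by linarith
  have W300: "300 \<le> W" using Wd d0 V by linarith
  \<comment> \<open>The product 2 s d^2 equals 128 whatever s is, so \<open>small\<close> amounts to
    W being large; this explains the threshold 300.\<close>
  have small: "d / W + 2 * s * d\<^sup>2 / W \<le> 1 / 2"
  proof -
    have "d / W + 2 * s * d\<^sup>2 / W = (d + 128) / W" unfolding d2 using s by (simp add: add_divide_distrib)
    also have "\<dots> \<le> 129 / 300" using d1 d0 W300 by (intro frac_le) auto
    also have "\<dots> \<le> 1 / 2" by simp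
    finally show ?thesis .
  qed
  have var: "16 * cumulant'' p (cot_weight p) s \<le> d\<^sup>2"
    unfolding d2 using cumulant''_cot_weight[OF n, of s] s by simp
  \<comment> \<open>The chord bound gives exp (- ln 2) = 1/2 where the true saddle point has exp
    (-1), and the slack raises it to 11/20. It still suffices: 11/20 times 11/10 times 8/13 is below
    2/5.\<close>
  have s_up: "s \<le> 11 / 20 * exp (- saddle_const) * (r * r)"
  proof -
    have "2 / pi * (ln s + ln 2 + saddle_const) \<le> W + 84 / s"
      using cumulant'_lower[OF n, of s] s s4 W by simp
    also have "84 / s \<le> 84 / 4000" using s by (intro divide_left_mono) auto
    also have "W + 84 / 4000 \<le> V + 41 / 1000" using W_up shr by simp
    finally have "pi / 2 * (2 / pi * (ln s + ln 2 + saddle_const)) \<le> pi / 2 * (V + 41 / 1000)"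
      by (intro mult_left_mono) auto
    then have "ln s + ln 2 + saddle_const \<le> pi / 2 * (V + 41 / 1000)" by simp
    also have "\<dots> = pi * V / 2 + pi * 41 / 2000" by (simp add: field_simps)
    also have "pi * 41 / 2000 \<le> 82 / 1000" using pi_less_4 by simp
    finally have "exp (ln s) \<le> exp (82 / 1000 + (pi * V / 2 + (- saddle_const)) - ln 2)" by simp
    also have "\<dots> = exp (82 / 1000) * (exp (pi * V / 2) * exp (- saddle_const)) / 2"
      unfolding exp_diff[of _ "ln 2"] exp_add by simp
    also have "\<dots> \<le> 11 / 10 * (exp (pi * V / 2) * exp (- saddle_const)) / 2"
    proof (intro divide_right_mono mult_right_mono)
      have "1 - 82 / 1000 \<le> exp (- (82 / 1000) :: real)" using exp_ge_add_one_self[of "- (82 / 1000) :: real"] by simp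
      then have "inverse (exp (- (82 / 1000) :: real)) \<le> inverse (1 - 82 / 1000)" by (intro le_imp_inverse_le) auto
      then have "exp (82 / 1000 :: real) \<le> inverse (1 - 82 / 1000)" by (simp add: exp_minus)
      then show "exp (82 / 1000 :: real) \<le> 11 / 10" by simp
    qed auto
    finally show ?thesis using s unfolding r2 by (simp add: mult_ac)
  qed
  have kbound: "real (2 * k + 4) \<le> 2 / 5 * l / g + 4"
  proof -
    have "W \<le> 11 / 10 * V" using W_up shr V by linarith
    then have "s * W \<le> (11 / 20 * exp (- saddle_const) * (r * r)) * (11 / 10 * V)"
      using s_up s W300 by (intro mult_mono) auto
    also have "\<dots> = 121 / 200 * (exp (- saddle_const) * (exp (pi * V / 2) * V))" unfolding r2 by simp
    also have "\<dots> \<le> 121 / 200 * (8 / 13 * (l / g))"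
      using range_V(2)[OF lp V(1)] V by (intro mult_left_mono) (auto simp: l_def g_def)
    also have "\<dots> \<le> 2 / 5 * (l / g)"
    proof -
      have le: "121 / 200 * (8 / 13 * y) \<le> 2 / 5 * y" if "0 \<le> y" for y :: real using that by simp
      show ?thesis by (rule le) (use l0 lpc in simp)
    qed
    finally show ?thesis using sW by simp
  qed
  define N where "N = 2 * k + 4"
  have me: "moment_error p N * (1 + (real N)\<^sup>2) \<le> exp (- real N) / 4"
    using lp kbound unfolding large_prime_def l_def g_def N_def by blast
  have me0: "0 \<le> moment_error p N" using p unfolding moment_error_def by simp
  have Wd2: "W\<^sup>2 / d\<^sup>2 \<le> (real N)\<^sup>2"
  proof -
    have "1 * W \<le> s * W" using s W300 by (intro mult_right_mono) auto
    then have WN: "W \<le> real N" "s * W \<le> real N" using sW by (auto simp: N_def)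
    have "W\<^sup>2 / d\<^sup>2 = (s * W) * W / 64" unfolding d2 by (simp add: power2_eq_square)
    also have "\<dots> \<le> (s * W) * W" using s W300 by simp
    also have "\<dots> \<le> real N * real N" using WN s W300 by (intro mult_mono) auto
    finally show ?thesis by (simp add: power2_eq_square)
  qed
  have err: "moment_error p N * (1 + W\<^sup>2 / d\<^sup>2) \<le> exp (- (s * W)) / 4"
  proof -
    have "moment_error p N * (1 + W\<^sup>2 / d\<^sup>2) \<le> moment_error p N * (1 + (real N)\<^sup>2)"
      using Wd2 me0 by (intro mult_left_mono) auto
    also have "\<dots> \<le> exp (- real N) / 4" by (rule me)
    also have "\<dots> \<le> exp (- (s * W)) / 4" using sW by (simp add: N_def)
    finally show ?thesis .
  qed
  have "1 / 2 * (W / (W + d)) ^ (2 * k) * exp (cumulant p (cot_weight p) s - s * W) \<le> tail_freq p (W - 2 * d)"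
    unfolding tail_freq_def
  proof (rule tail_lower_bound[OF _ _ W _ d0 _ sW small var err])
    show "\<bar>(\<Sum>K<p. cot_sum p K ^ m) / p - sign_mean p (cot_weight p) (\<lambda>x. x ^ m)\<bar> \<le> moment_error p N"
      if "m \<le> 2 * k + 4" for m
      using cot_sum_moments[OF lp, of m N] that by (simp add: N_def)
  qed (use p W300 d1 in auto)
  also have "\<dots> \<le> tail_freq p V" using Wd by (intro tail_freq_antimono) auto
  finally have main: "1 / 2 * (W / (W + d)) ^ (2 * k) * exp (cumulant p (cot_weight p) s - s * W) \<le> tail_freq p V" .
  have f1: "exp (- 1) \<le> (1 / 2 :: real)" using exp_ge_add_one_self[of "1::real"] by (simp add: exp_minus field_simps)
  have f2: "exp (- (s * d)) \<le> (W / (W + d)) ^ (2 * k)"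
  proof -
    have "1 + d / W \<le> exp (d / W)" by (rule exp_ge_add_one_self)
    then have "inverse (exp (d / W)) \<le> inverse (1 + d / W)" using d0 W300 by (intro le_imp_inverse_le) (auto intro: add_pos_pos)
    moreover have "inverse (1 + d / W) = W / (W + d)" using W300 d0 by (simp add: field_simps)
    ultimately have "exp (- (d / W)) \<le> W / (W + d)" by (simp add: exp_minus)
    then have "exp (- (d / W)) ^ (2 * k) \<le> (W / (W + d)) ^ (2 * k)" by (intro power_mono) auto
    moreover have "exp (- (d / W)) ^ (2 * k) = exp (- (2 * real k * (d / W)))" by (simp add: exp_of_nat_mult[symmetric])
    moreover have "2 * real k * (d / W) \<le> s * W * (d / W)" unfolding sW using d0 W300 by (intro mult_right_mono) auto
    moreover have "s * W * (d / W) = s * d" using W300 by simp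
    ultimately show ?thesis by (smt (verit) exp_le_cancel_iff)
  qed
  have "exp (- 1) * exp (- (s * d)) * exp (cumulant p (cot_weight p) s - s * W) \<le>
      1 / 2 * (W / (W + d)) ^ (2 * k) * exp (cumulant p (cot_weight p) s - s * W)"
    using f1 f2 by (intro mult_right_mono mult_mono) auto
  then have low: "exp (- 1 - s * d + (cumulant p (cot_weight p) s - s * W)) \<le> tail_freq p V"
    using main by (simp add: exp_add[symmetric])
  have "\<bar>cumulant p (cot_weight p) s - saddle_main s\<bar> \<le> 21"
    using s s4 by (intro cumulant_saddle_main[OF n]) auto
  moreover have "- (C2_minus * exp (pi * W / 2)) \<le> saddle_main s - s * W"
    using s by (intro saddle_min) auto
  ultimately have c1: "- (C2_minus * exp (pi * W / 2)) - 21 \<le> cumulant p (cot_weight p) s - s * W" by linarith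
  have C0: "0 \<le> C2_minus" by (simp add: C2_minus_def)
  have c2: "exp (pi * W / 2) \<le> exp (pi * V / 2) + pi * shift_const * r"
  proof -
    define y where "y = pi / 2 * (shift_const / r)"
    have y0: "0 \<le> y" unfolding y_def using shr(1) by (intro mult_nonneg_nonneg) auto
    have "y \<le> 2 * (1 / 50)" unfolding y_def using shr pi_less_4 by (intro mult_mono) auto
    then have y1: "y \<le> 1" by simp
    have "pi / 2 * W \<le> pi / 2 * V + y"
      unfolding y_def distrib_left[symmetric] using W_up by (intro mult_left_mono) auto
    then have "pi * W / 2 \<le> pi * V / 2 + y" by simp
    then have "exp (pi * W / 2) \<le> exp (pi * V / 2) * exp y" by (simp add: exp_add[symmetric])
    also have "exp y \<le> 1 + y + y\<^sup>2" using y0 y1 by (rule exp_bound)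
    also have "y\<^sup>2 \<le> y" using y0 y1 by (simp add: power2_eq_square mult_left_le)
    finally have "exp (pi * W / 2) \<le> exp (pi * V / 2) * (1 + 2 * y)" by (simp add: add.commute)
    also have "\<dots> = exp (pi * V / 2) + pi * shift_const * r"
      unfolding r2[symmetric] y_def using r1 by (simp add: field_simps)
    finally show ?thesis .
  qed
  have c3: "s * d \<le> 8 * exp (- saddle_const / 2) * r"
  proof -
    have "s \<le> 1 * exp (- saddle_const) * (r * r)"
      by (rule order_trans[OF s_up]) (intro mult_right_mono, auto)
    also have "\<dots> = (exp (- saddle_const / 2) * r)\<^sup>2"
      by (simp add: power_mult_distrib power2_eq_square exp_add[symmetric] mult_ac)
    finally have "sqrt s \<le> exp (- saddle_const / 2) * r" using r1 by (intro real_le_lsqrt) auto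
    moreover have "s / sqrt s = sqrt s" using s by (intro real_div_sqrt) auto
    moreover have "s * d = 8 * (s / sqrt s)" by (simp add: d_def)
    ultimately show ?thesis by simp
  qed
  have "C2_minus * exp (pi * W / 2) \<le> C2_minus * exp (pi * V / 2) + C2_minus * pi * shift_const * r"
    using mult_left_mono[OF c2 C0] by (simp add: algebra_simps)
  moreover have "22 \<le> 22 * r" using r1 by simp
  moreover have "(22 + 8 * exp (- saddle_const / 2) + C2_minus * pi * shift_const) * r =
      22 * r + 8 * exp (- saddle_const / 2) * r + C2_minus * pi * shift_const * r" by (simp add: algebra_simps)
  ultimately have "- (C2_minus * exp (pi * V / 2)) - (22 + 8 * exp (- saddle_const / 2) + C2_minus * pi * shift_const) * r
      \<le> - 1 - s * d + (cumulant p (cot_weight p) s - s * W)"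
    using c1 c3 by linarith
  then have "exp (- (C2_minus * exp (pi * V / 2)) - (22 + 8 * exp (- saddle_const / 2) + C2_minus * pi * shift_const) * r)
      \<le> exp (- 1 - s * d + (cumulant p (cot_weight p) s - s * W))" by (simp only: exp_le_cancel_iff)
  also have "\<dots> \<le> tail_freq p V" by (rule low)
  finally show ?thesis by (simp only: r_def)
qed

lemma moment_error_small:
  "eventually (\<lambda>l::real. \<forall>m. real m \<le> 2 / 5 * l / ln l + 4 \<longrightarrow>
     25 * real m * (4 * l) ^ m / exp (l / 2) * (1 + (real m)\<^sup>2) \<le> exp (- real m) / 4) at_top"
proof -
  have "eventually (\<lambda>l::real. 200 * l ^ 3 * exp ((2 / 5 * l / ln l + 4) * ln (12 * l)) \<le> exp (l / 2)) at_top"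
    by real_asymp
  moreover have "eventually (\<lambda>l::real. 2 / 5 * l / ln l + 4 \<le> l) at_top" by real_asymp
  moreover have "eventually (\<lambda>l::real. 1 \<le> l) at_top" by (rule eventually_ge_at_top)
  ultimately show ?thesis
  proof eventually_elim
    case (elim l)
    show ?case
    proof (intro allI impI)
      fix m :: nat assume m: "real m \<le> 2 / 5 * l / ln l + 4"
      then have ml: "real m \<le> l" using elim by linarith
      have l0: "0 < l" using elim by simp
      have "exp (real m) = exp 1 ^ m" by (simp add: exp_of_nat_mult[symmetric])
      then have "(4 * l) ^ m * exp (real m) = (4 * l * exp 1) ^ m" by (simp add: power_mult_distrib)
      also have "\<dots> \<le> (12 * l) ^ m"
        using exp_le l0 by (intro power_mono) (auto simp: mult.commute)
      also have "\<dots> = exp (ln (12 * l)) ^ m" using l0 by simp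
      also have "\<dots> = exp (real m * ln (12 * l))" by (simp only: exp_of_nat_mult)
      also have "\<dots> \<le> exp ((2 / 5 * l / ln l + 4) * ln (12 * l))"
      proof -
        have "real m * ln (12 * l) \<le> (2 / 5 * l / ln l + 4) * ln (12 * l)"
          using m elim by (intro mult_right_mono) auto
        then show ?thesis by simp
      qed
      finally have a: "(4 * l) ^ m * exp (real m) \<le> exp ((2 / 5 * l / ln l + 4) * ln (12 * l))" .
      have "1 \<le> l\<^sup>2" using elim by (simp add: one_le_power)
      moreover have "(real m)\<^sup>2 \<le> l\<^sup>2" using ml by (intro power_mono) auto
      ultimately have "1 + (real m)\<^sup>2 \<le> 2 * l\<^sup>2" by simp
      then have "real m * (1 + (real m)\<^sup>2) \<le> l * (2 * l\<^sup>2)" using ml by (intro mult_mono) auto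
      then have b: "100 * (real m * (1 + (real m)\<^sup>2)) \<le> 200 * l ^ 3" by (simp add: power2_eq_square power3_eq_cube)
      have "100 * (real m * (1 + (real m)\<^sup>2)) * ((4 * l) ^ m * exp (real m)) \<le> 200 * l ^ 3 * exp ((2 / 5 * l / ln l + 4) * ln (12 * l))"
        by (rule mult_mono[OF b a]) (use l0 in auto)
      also have "\<dots> \<le> exp (l / 2)" using elim by simp
      finally have c: "100 * (real m * (1 + (real m)\<^sup>2)) * ((4 * l) ^ m * exp (real m)) \<le> exp (l / 2)" .
      have "25 * real m * (4 * l) ^ m / exp (l / 2) * (1 + (real m)\<^sup>2) =
          (100 * (real m * (1 + (real m)\<^sup>2)) * ((4 * l) ^ m * exp (real m))) / (4 * exp (l / 2) * exp (real m))"
        by (simp add: field_simps)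
      also have "\<dots> \<le> exp (l / 2) / (4 * exp (l / 2) * exp (real m))" using c by (intro divide_right_mono) auto
      also have "\<dots> = exp (- real m) / 4" by (simp add: exp_minus field_simps)
      finally show "25 * real m * (4 * l) ^ m / exp (l / 2) * (1 + (real m)\<^sup>2) \<le> exp (- real m) / 4" .
    qed
  qed
qed

lemma eventually_large_prime:
  "eventually (\<lambda>p. prime p \<longrightarrow> large_prime p) sequentially"
proof -
  have lim: "filterlim (\<lambda>x::real. ln x) at_top at_top" by (rule ln_at_top)
  have lim2: "filterlim (\<lambda>x::real. ln (ln x)) at_top at_top" by real_asymp
  \<comment> \<open>With ln ln p at least \<open>T\<close>, the doubled logarithm in the slope bound
    at s = (ln p)^2 exceeds the required value by at least 2, which covers both the 1 and the term
    84 / (ln p)^2.\<close>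
  define T where "T = 3 * pi + \<bar>saddle_const\<bar> + 1"
  have "eventually (\<lambda>x::real. 2 < x) at_top" by (rule eventually_gt_at_top)
  moreover have "eventually (\<lambda>x::real. T \<le> ln (ln x)) at_top"
    using lim2 by (simp add: filterlim_at_top)
  moreover have "eventually (\<lambda>x::real. 4000 \<le> (ln x)\<^sup>2) at_top" by real_asymp
  moreover have "eventually (\<lambda>x::real. 16 * ((ln x)\<^sup>2 + 2)\<^sup>2 \<le> x) at_top" by real_asymp
  moreover have "eventually (\<lambda>x::real. \<forall>m. real m \<le> 2 / 5 * ln x / ln (ln x) + 4 \<longrightarrow>
     25 * real m * (4 * ln x) ^ m / exp (ln x / 2) * (1 + (real m)\<^sup>2) \<le> exp (- real m) / 4) at_top"
    using eventually_compose_filterlim[OF moment_error_small lim] .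
  ultimately have "eventually (\<lambda>x::real. 2 < x \<and> T \<le> ln (ln x) \<and> 4000 \<le> (ln x)\<^sup>2 \<and> 16 * ((ln x)\<^sup>2 + 2)\<^sup>2 \<le> x \<and>
     (\<forall>m. real m \<le> 2 / 5 * ln x / ln (ln x) + 4 \<longrightarrow>
     25 * real m * (4 * ln x) ^ m / exp (ln x / 2) * (1 + (real m)\<^sup>2) \<le> exp (- real m) / 4)) at_top"
    by eventually_elim blast
  then have "eventually (\<lambda>p::nat. 2 < real p \<and> T \<le> ln (ln (real p)) \<and> 4000 \<le> (ln (real p))\<^sup>2 \<and> 16 * ((ln (real p))\<^sup>2 + 2)\<^sup>2 \<le> real p \<and>
     (\<forall>m. real m \<le> 2 / 5 * ln (real p) / ln (ln (real p)) + 4 \<longrightarrow>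
     25 * real m * (4 * ln (real p)) ^ m / exp (ln (real p) / 2) * (1 + (real m)\<^sup>2) \<le> exp (- real m) / 4)) sequentially"
    using eventually_compose_filterlim[OF _ filterlim_real_sequentially] by blast
  then show ?thesis
  proof eventually_elim
    case (elim p)
    show ?case
    proof
      assume p: "prime p"
      define l g where "l = ln (real p)" and "g = ln l"
      have gT: "T \<le> g" and l4: "4000 \<le> l\<^sup>2" using elim by (auto simp: l_def g_def)
      have g1: "1 \<le> g" using gT pi_gt_zero unfolding T_def by linarith
      have "exp (l / 2) = sqrt (exp l)" by (rule real_sqrt_unique[symmetric]) (auto simp: exp_double[symmetric])
      also have "exp l = real p" using elim by (simp add: l_def)
      finally have sq: "exp (ln (real p) / 2) = sqrt (real p)" by (simp add: l_def)
      have "84 / l\<^sup>2 \<le> 84 / 4000" using l4 by (intro divide_left_mono) auto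
      moreover have "2 \<le> 2 / pi * (g + ln 2 + saddle_const)"
      proof -
        have "pi \<le> g + ln 2 + saddle_const" using gT pi_gt_zero ln_gt_zero[of "2::real"] unfolding T_def by linarith
        then have "2 / pi * pi \<le> 2 / pi * (g + ln 2 + saddle_const)" by (intro mult_left_mono) auto
        then show ?thesis by simp
      qed
      moreover have "2 / pi * (2 * g + ln 2 + saddle_const) = 2 / pi * g + 2 / pi * (g + ln 2 + saddle_const)"
        by (simp add: field_simps)
      ultimately have "2 / pi * g + 1 \<le> 2 / pi * (2 * g + ln 2 + saddle_const) - 84 / l\<^sup>2" by linarith
      then show "large_prime p"
        using elim p g1 unfolding large_prime_def moment_error_def sq l_def g_def by auto
    qed
  qed
qed

section \<open>From tail bounds to the relative error\<close>

lemma C2_minus_pos: "0 < C2_minus"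
  by (simp add: C2_minus_def)

text \<open>The lower bound makes P positive, so the equation can be solved for eta by taking
  logarithms. An additive error of order exp (pi V/4), divided by the main term of order exp (pi
  V/2), is the claimed relative error.\<close>

lemma exists_eta:
  assumes P: "exp (- (C2_minus * exp (pi * V / 2)) - x) \<le> P" "P \<le> exp (- (C2_minus * exp (pi * V / 2)) + x)"
    and x: "x \<le> B * C2_minus * exp (pi * V / 4)"
  shows "\<exists>\<eta>. \<bar>\<eta>\<bar> \<le> B * exp (- pi * V / 4) \<and> P = exp (- C2_minus * exp (pi * V / 2) * (1 + \<eta>))"
proof -
  define D where "D = C2_minus * exp (pi * V / 2)"
  have D0: "0 < D" using C2_minus_pos by (simp add: D_def)
  have P0: "0 < P" using P(1) exp_gt_zero by (rule less_le_trans[rotated])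
  define \<eta> where "\<eta> = - ln P / D - 1"
  have eq: "P = exp (- C2_minus * exp (pi * V / 2) * (1 + \<eta>))"
  proof -
    have "- C2_minus * exp (pi * V / 2) * (1 + \<eta>) = ln P" using D0 by (simp add: \<eta>_def D_def[symmetric])
    then show ?thesis using P0 by simp
  qed
  have "- D - x \<le> ln P" using P(1) P0 by (simp add: ln_ge_iff D_def)
  moreover have "ln P \<le> - D + x"
  proof -
    have "ln P \<le> ln (exp (- D + x))" using P(2) P0 by (subst ln_le_cancel_iff) (auto simp: D_def)
    then show ?thesis by simp
  qed
  ultimately have "\<bar>- ln P - D\<bar> \<le> x" by linarith
  moreover have "\<eta> = (- ln P - D) / D" using D0 by (simp add: \<eta>_def field_simps)
  ultimately have "\<bar>\<eta>\<bar> \<le> x / D" using D0 by (simp add: abs_divide divide_right_mono)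
  also have "\<dots> \<le> B * C2_minus * exp (pi * V / 4) / D" using x D0 by (intro divide_right_mono) auto
  also have "\<dots> = B * exp (- pi * V / 4)"
  proof -
    have "exp (pi * V / 2) = exp (pi * V / 4) * exp (pi * V / 4)" by (simp add: exp_add[symmetric])
    then show ?thesis using C2_minus_pos by (simp add: D_def exp_minus field_simps)
  qed
  finally show ?thesis using eq by blast
qed

text \<open>The two tail estimates need V beyond an absolute threshold \<open>V0\<close>. For
  smaller V monotonicity confines the frequency between its value at \<open>V0\<close> and 1; the
  exponent is then bounded, and the constant A absorbs it.\<close>

lemma tail_freq_asymptotic:
  "\<exists>A>0. eventually (\<lambda>p. prime p \<longrightarrow> (\<forall>V. 1 \<le> V \<longrightarrow>
     V \<le> 2 / pi * (ln (ln (real p)) - 2 * ln (ln (ln (real p)))) \<longrightarrow>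
     (\<exists>\<eta>. \<bar>\<eta>\<bar> \<le> A * exp (- pi * V / 4) \<and> tail_freq p V = exp (- C2_minus * exp (pi * V / 2) * (1 + \<eta>))))) sequentially"
proof -
  \<comment> \<open>25 is the larger of the constants in the two tails, 22 below and 25 above, so
    one \<open>A0\<close> serves both.\<close>
  define A0 where "A0 = 25 + 8 * exp (- saddle_const / 2) + C2_minus * pi * shift_const"
  have A0: "0 < A0" using C2_minus_pos shift_const_pos by (auto simp: A0_def intro!: add_pos_pos)
  have elim: "filterlim (\<lambda>V::real. exp (pi * V / 4)) at_top at_top" by real_asymp
  have elim2: "filterlim (\<lambda>V::real. exp (pi * V / 2)) at_top at_top" by real_asymp
  have "eventually (\<lambda>V::real. 300 \<le> V) at_top" "eventually (\<lambda>V::real. 2 / pi * (ln 4000 + 2 * ln 2 + saddle_const) + 1 \<le> V) at_top"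
    by (rule eventually_ge_at_top)+
  moreover have "eventually (\<lambda>V::real. 50 * shift_const \<le> exp (pi * V / 4)) at_top"
    using elim by (simp add: filterlim_at_top)
  moreover have "eventually (\<lambda>V::real. 2 * exp (saddle_const + 1) \<le> exp (pi * V / 2)) at_top"
    using elim2 by (simp add: filterlim_at_top)
  ultimately have "eventually (\<lambda>V::real. 300 \<le> V \<and> 2 / pi * (ln 4000 + 2 * ln 2 + saddle_const) + 1 \<le> V \<and>
      50 * shift_const \<le> exp (pi * V / 4) \<and> 2 * exp (saddle_const + 1) \<le> exp (pi * V / 2)) at_top"
    by eventually_elim blast
  then obtain V0 where V0: "\<And>V. V0 \<le> V \<Longrightarrow> 300 \<le> V \<and> 2 / pi * (ln 4000 + 2 * ln 2 + saddle_const) + 1 \<le> V \<and>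
      50 * shift_const \<le> exp (pi * V / 4) \<and> 2 * exp (saddle_const + 1) \<le> exp (pi * V / 2)"
    unfolding eventually_at_top_linorder by blast
  define r0 where "r0 = exp (pi * V0 / 4)"
  \<comment> \<open>The exponent of the lower bound at \<open>V0\<close>, used as an error term for
    every smaller V.\<close>
  define x0 where "x0 = C2_minus * exp (pi * V0 / 2) + A0 * r0"
  have x0: "0 < x0" using C2_minus_pos A0 by (auto simp: x0_def r0_def intro!: add_pos_pos)
  define A where "A = A0 / C2_minus + x0 / C2_minus"
  have A: "0 < A" "A0 \<le> A * C2_minus" "x0 \<le> A * C2_minus"
    using A0 x0 C2_minus_pos by (auto simp: A_def field_simps intro!: add_pos_pos)
  have both: "exp (- (C2_minus * exp (pi * V / 2)) - A0 * exp (pi * V / 4)) \<le> tail_freq p V"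
    "tail_freq p V \<le> exp (- (C2_minus * exp (pi * V / 2)) + A0 * exp (pi * V / 4))"
    if lp: "large_prime p" and V: "V0 \<le> V" "V \<le> 2 / pi * (ln (ln (real p)) - 2 * ln (ln (ln (real p))))" for p V
  proof -
    note V1 = V0[OF V(1)]
    have e1: "1 \<le> exp (pi * V / 4)" using V1 by simp
    have "exp (- (C2_minus * exp (pi * V / 2)) - A0 * exp (pi * V / 4)) \<le>
      exp (- (C2_minus * exp (pi * V / 2)) - (22 + 8 * exp (- saddle_const / 2) + C2_minus * pi * shift_const) * exp (pi * V / 4))"
      by (simp add: A0_def mult_right_mono)
    also have "\<dots> \<le> tail_freq p V" using V1 by (intro tail_freq_lower[OF lp V(2)]) auto
    finally show "exp (- (C2_minus * exp (pi * V / 2)) - A0 * exp (pi * V / 4)) \<le> tail_freq p V" .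
    have "2 \<le> exp (pi * V / 2) / exp (saddle_const + 1)" using V1 by (simp add: le_divide_eq)
    also have "\<dots> = exp (pi * V / 2 - saddle_const - 1)" by (simp add: exp_diff exp_add)
    finally have "tail_freq p V \<le> exp (- (C2_minus * exp (pi * V / 2)) + 25)"
      using V1 by (intro tail_freq_upper[OF lp V(2)]) auto
    also have "\<dots> \<le> exp (- (C2_minus * exp (pi * V / 2)) + A0 * exp (pi * V / 4))"
    proof -
      have "25 * 1 \<le> A0 * exp (pi * V / 4)"
        using e1 C2_minus_pos shift_const_pos by (intro mult_mono) (auto simp: A0_def intro!: add_nonneg_nonneg)
      then show ?thesis by simp
    qed
    finally show "tail_freq p V \<le> exp (- (C2_minus * exp (pi * V / 2)) + A0 * exp (pi * V / 4))" .
  qed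
  have "filterlim (\<lambda>x::real. ln (ln x) - 2 * ln (ln (ln x))) at_top at_top" by real_asymp
  then have "eventually (\<lambda>x::real. pi / 2 * V0 \<le> ln (ln x) - 2 * ln (ln (ln x))) at_top"
    unfolding filterlim_at_top by blast
  then have "eventually (\<lambda>p::nat. pi / 2 * V0 \<le> ln (ln (real p)) - 2 * ln (ln (ln (real p)))) sequentially"
    using eventually_compose_filterlim[OF _ filterlim_real_sequentially] by blast
  then have "eventually (\<lambda>p. prime p \<longrightarrow> (\<forall>V. 1 \<le> V \<longrightarrow>
     V \<le> 2 / pi * (ln (ln (real p)) - 2 * ln (ln (ln (real p)))) \<longrightarrow>
     (\<exists>\<eta>. \<bar>\<eta>\<bar> \<le> A * exp (- pi * V / 4) \<and> tail_freq p V = exp (- C2_minus * exp (pi * V / 2) * (1 + \<eta>))))) sequentially"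
    using eventually_large_prime
  proof eventually_elim
    case (elim p)
    show ?case
    proof (intro impI allI)
      fix V :: real
      assume "prime p" and V: "1 \<le> V" "V \<le> 2 / pi * (ln (ln (real p)) - 2 * ln (ln (ln (real p))))"
      then have lp: "large_prime p" using elim by blast
      show "\<exists>\<eta>. \<bar>\<eta>\<bar> \<le> A * exp (- pi * V / 4) \<and> tail_freq p V = exp (- C2_minus * exp (pi * V / 2) * (1 + \<eta>))"
      proof (cases "V0 \<le> V")
        case True
        show ?thesis
          using both[OF lp True V(2)] A(2) by (intro exists_eta[where x = "A0 * exp (pi * V / 4)"]) auto
      next
        case False
        \<comment> \<open>For large \<open>p\<close> the point \<open>V0\<close> lies itself in the
          admissible range, so the lower bound may be invoked there.\<close>
        have "2 / pi * (pi / 2 * V0) \<le> 2 / pi * (ln (ln (real p)) - 2 * ln (ln (ln (real p))))"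
          using elim(1) by (intro mult_left_mono) auto
        then have V0p: "V0 \<le> 2 / pi * (ln (ln (real p)) - 2 * ln (ln (ln (real p))))" by simp
        have e1: "1 \<le> exp (pi * V / 4)" using V by simp
        have CE: "C2_minus * exp (pi * V / 2) \<le> x0"
        proof -
          have "exp (pi * V / 2) \<le> exp (pi * V0 / 2)" using False by simp
          then have "C2_minus * exp (pi * V / 2) \<le> C2_minus * exp (pi * V0 / 2)" using C2_minus_pos by simp
          also have "\<dots> \<le> x0" using A0 by (simp add: x0_def r0_def)
          finally show ?thesis .
        qed
        show ?thesis
        proof (rule exists_eta[where x = x0])
          have "exp (- (C2_minus * exp (pi * V / 2)) - x0) \<le> exp (- x0)" using C2_minus_pos by simp
          also have "\<dots> = exp (- (C2_minus * exp (pi * V0 / 2)) - A0 * exp (pi * V0 / 4))"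
            by (simp add: x0_def r0_def)
          also have "\<dots> \<le> tail_freq p V0" using both(1)[OF lp order_refl V0p] .
          also have "\<dots> \<le> tail_freq p V" using False by (intro tail_freq_antimono) auto
          finally show "exp (- (C2_minus * exp (pi * V / 2)) - x0) \<le> tail_freq p V" .
          have "tail_freq p V \<le> exp 0" using tail_freq_le_1 by simp
          also have "\<dots> \<le> exp (- (C2_minus * exp (pi * V / 2)) + x0)"
            using CE by (simp only: exp_le_cancel_iff)
          finally show "tail_freq p V \<le> exp (- (C2_minus * exp (pi * V / 2)) + x0)" .
          have "x0 * 1 \<le> A * C2_minus * exp (pi * V / 4)"
            using A(3) e1 x0 by (intro mult_mono) auto
          then show "x0 \<le> A * C2_minus * exp (pi * V / 4)" by simp
        qed
      qed
    qed
  qed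
  with A(1) show ?thesis by blast
qed

theorem theorem1p1:
  shows "\<exists>A :: real. A > 0 \<and> (\<exists>p0 :: nat. \<forall>p :: nat. prime p \<longrightarrow> p \<ge> p0 \<longrightarrow>
    (\<forall>V :: real. 1 \<le> V \<longrightarrow>
      V \<le> 2 / pi * (ln (ln (real p)) - 2 * ln (ln (ln (real p)))) \<longrightarrow>
      (\<exists>\<eta> :: real. \<bar>\<eta>\<bar> \<le> A * exp (- pi * V / 4) \<and>
        1 / real p * real (card {K \<in> {0..<p}.
            1 / sqrt (real p) * cmod (fekete p (e_mod p (real K + 1 / 2))) \<ge> V})
          = exp (- C2_minus * exp (pi * V / 2) * (1 + \<eta>)))))"
proof -
  obtain A :: real where A: "0 < A" and ev: "eventually (\<lambda>p. prime p \<longrightarrow> (\<forall>V. 1 \<le> V \<longrightarrow>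
     V \<le> 2 / pi * (ln (ln (real p)) - 2 * ln (ln (ln (real p)))) \<longrightarrow>
     (\<exists>\<eta>. \<bar>\<eta>\<bar> \<le> A * exp (- pi * V / 4) \<and> tail_freq p V = exp (- C2_minus * exp (pi * V / 2) * (1 + \<eta>))))) sequentially"
    using tail_freq_asymptotic by blast
  obtain p1 where p1: "\<And>p. p1 \<le> p \<Longrightarrow> prime p \<longrightarrow> (\<forall>V. 1 \<le> V \<longrightarrow>
     V \<le> 2 / pi * (ln (ln (real p)) - 2 * ln (ln (ln (real p)))) \<longrightarrow>
     (\<exists>\<eta>. \<bar>\<eta>\<bar> \<le> A * exp (- pi * V / 4) \<and> tail_freq p V = exp (- C2_minus * exp (pi * V / 2) * (1 + \<eta>))))"
    using ev unfolding eventually_sequentially by blast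
  have freq: "1 / real p * real (card {K \<in> {0..<p}. 1 / sqrt (real p) * cmod (fekete p (e_mod p (real K + 1 / 2))) \<ge> V}) = tail_freq p V"
    if p: "prime p" "2 < p" for p :: nat and V :: real
  proof -
    have "1 / sqrt (real p) * cmod (fekete p (e_mod p (real K + 1 / 2))) = \<bar>cot_sum p K\<bar>" for K
      unfolding cot_sum_def leg_def[OF p] by (rule fekete_half_point[OF p])
    then show ?thesis by (simp only: tail_freq_def) simp
  qed
  show ?thesis
  \<comment> \<open>The maximum with 3 makes \<open>p\<close> odd, as the Gauss sum representation
    requires.\<close>
  proof (rule exI[of _ A], rule conjI[OF A], rule exI[of _ "max p1 3"], intro allI impI)
    fix p :: nat and V :: real
    assume p: "prime p" "max p1 3 \<le> p" and V: "1 \<le> V" "V \<le> 2 / pi * (ln (ln (real p)) - 2 * ln (ln (ln (real p))))"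
    show "\<exists>\<eta>. \<bar>\<eta>\<bar> \<le> A * exp (- pi * V / 4) \<and>
        1 / real p * real (card {K \<in> {0..<p}. 1 / sqrt (real p) * cmod (fekete p (e_mod p (real K + 1 / 2))) \<ge> V})
          = exp (- C2_minus * exp (pi * V / 2) * (1 + \<eta>))"
      using p1[of p] p V freq[of p V] by simp
  qed
qed

end
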